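(* Let $(G,\mathcal{B},\mathcal{L},\mathcal{F})$ be a quasi-biased graph in which each connected component of $G$ has at least two vertices, and suppose $M=M(G,\mathcal{B},\mathcal{L},\mathcal{F})$ is $3$-connected, unbreakable, and not graphic. Assume $G$ is $2$-connected but not $3$-connected. Then either $|V(G)|\le 6$, or $\mathrm{si}(G)$ is a cycle and $\mathcal{F}$ is degenerate.
   Context: Graphs are finite with loops and parallel edges allowed; cycles include loops and 2-cycles. A quasi-biased graph $(G,\mathcal{B},\mathcal{L},\mathcal{F})$ is a graph with a partition $(\mathcal{B},\mathcal{L},\mathcal{F})$ of its cycles such that no theta subgraph contains exactly two cycles of $\mathcal{B}$ and every cycle in $\mathcal{L}$ shares a vertex with every cycle in $\mathcal{F}$. $M(G,\mathcal{B},\mathcal{L},\mathcal{F})$ is the matroid on $E(G)$ with circuits: cycles in $\mathcal{B}$; theta subgraphs with no cycle in $\mathcal{B}$; tight handcuffs (two edge-disjoint cycles sharing exactly one vertex) with neither cycle in $\mathcal{B}$; unions of two vertex-disjoint cycles of $\mathcal{L}$; loose handcuffs (two vertex-disjoint cycles plus a minimal path joining them) with both cycles in $\mathcal{F}$. $\mathcal{F}$ is degenerate if no two cycles in $\mathcal{F}$ are vertex-disjoint. A matroid is unbreakable if it is connected and $M/F$ is connected for every flat $F$. $\mathrm{si}(G)$ is the simplification. *)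

theory Defs
  imports Main
begin

section \<open>Graphs with loops and parallel edges\<close>

record ('v, 'e) multigraph =
  vertices :: "'v set"
  edges :: "'e set"
  ends :: "'e \<Rightarrow> 'v set"

text \<open>A loop at \<open>v\<close> is an edge \<open>e\<close> with \<open>ends G e = {v}\<close>.\<close>

definition finite_multigraph :: "('v, 'e) multigraph \<Rightarrow> bool" where
  "finite_multigraph G \<longleftrightarrow> finite (vertices G) \<and> finite (edges G) \<and>
     (\<forall>e\<in>edges G. ends G e \<subseteq> vertices G \<and> card (ends G e) \<in> {1, 2})"

definition adjacency :: "('v, 'e) multigraph \<Rightarrow> ('v \<times> 'v) set" where
  "adjacency G = {(u, v). \<exists>e\<in>edges G. ends G e = {u, v}}"

definition graph_connected :: "('v, 'e) multigraph \<Rightarrow> bool" where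
  "graph_connected G \<longleftrightarrow> vertices G \<noteq> {} \<and>
     (\<forall>u\<in>vertices G. \<forall>v\<in>vertices G. (u, v) \<in> (adjacency G)\<^sup>*)"

definition component_vertex_sets :: "('v, 'e) multigraph \<Rightarrow> 'v set set" where
  "component_vertex_sets G =
     vertices G // {(u, v). u \<in> vertices G \<and> v \<in> vertices G \<and> (u, v) \<in> (adjacency G)\<^sup>*}"

definition delete_vertices :: "('v, 'e) multigraph \<Rightarrow> 'v set \<Rightarrow> ('v, 'e) multigraph" where
  "delete_vertices G S =
     G\<lparr>vertices := vertices G - S, edges := {e \<in> edges G. ends G e \<inter> S = {}}\<rparr>"

text \<open>Vertex connectivity; loops and parallel edges have no influence on it.\<close>

definition k_connected_graph :: "nat \<Rightarrow> ('v, 'e) multigraph \<Rightarrow> bool" where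
  "k_connected_graph k G \<longleftrightarrow> k < card (vertices G) \<and>
     (\<forall>S \<subseteq> vertices G. card S < k \<longrightarrow> graph_connected (delete_vertices G S))"

text \<open>Subgraphs without isolated vertices (cycles, thetas, handcuffs, nontrivial paths)
  are represented by their edge sets.\<close>

definition span_verts :: "('v, 'e) multigraph \<Rightarrow> 'e set \<Rightarrow> 'v set" where
  "span_verts G X = (\<Union>e\<in>X. ends G e)"

definition edge_subgraph :: "('v, 'e) multigraph \<Rightarrow> 'e set \<Rightarrow> ('v, 'e) multigraph" where
  "edge_subgraph G X = G\<lparr>vertices := span_verts G X, edges := X\<rparr>"

text \<open>A loop contributes two to the degree of its vertex.\<close>

definition vdegree :: "('v, 'e) multigraph \<Rightarrow> 'v \<Rightarrow> nat" where
  "vdegree G v = card {e \<in> edges G. v \<in> ends G e} + card {e \<in> edges G. ends G e = {v}}"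

text \<open>Cycles are the connected 2-regular subgraphs; these include loops and 2-cycles.\<close>

definition graph_cycles :: "('v, 'e) multigraph \<Rightarrow> 'e set set" where
  "graph_cycles G = {C. C \<subseteq> edges G \<and> graph_connected (edge_subgraph G C) \<and>
     (\<forall>v\<in>span_verts G C. vdegree (edge_subgraph G C) v = 2)}"

definition path_between :: "('v, 'e) multigraph \<Rightarrow> 'v \<Rightarrow> 'v \<Rightarrow> 'e set \<Rightarrow> bool" where
  "path_between G u v P \<longleftrightarrow> (\<exists>vs es.
     distinct vs \<and> length vs = length es + 1 \<and> hd vs = u \<and> last vs = v \<and>
     set vs \<subseteq> vertices G \<and> set es \<subseteq> edges G \<and> P = set es \<and>
     (\<forall>i<length es. ends G (es ! i) = {vs ! i, vs ! Suc i}))"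

text \<open>Edge-disjointness is not redundant below: it excludes using one edge as two of the
  three paths.\<close>

definition is_theta :: "('v, 'e) multigraph \<Rightarrow> 'e set \<Rightarrow> bool" where
  "is_theta G T \<longleftrightarrow> (\<exists>u v P Q R. u \<noteq> v \<and>
     path_between G u v P \<and> path_between G u v Q \<and> path_between G u v R \<and>
     P \<inter> Q = {} \<and> P \<inter> R = {} \<and> Q \<inter> R = {} \<and>
     span_verts G P \<inter> span_verts G Q = {u, v} \<and>
     span_verts G P \<inter> span_verts G R = {u, v} \<and>
     span_verts G Q \<inter> span_verts G R = {u, v} \<and>
     T = P \<union> Q \<union> R)"

definition vertex_disjoint :: "('v, 'e) multigraph \<Rightarrow> 'e set \<Rightarrow> 'e set \<Rightarrow> bool" where
  "vertex_disjoint G X Y \<longleftrightarrow> span_verts G X \<inter> span_verts G Y = {}"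

definition tight_handcuffs_of :: "('v, 'e) multigraph \<Rightarrow> 'e set \<Rightarrow> 'e set \<Rightarrow> 'e set \<Rightarrow> bool" where
  "tight_handcuffs_of G C D X \<longleftrightarrow> C \<in> graph_cycles G \<and> D \<in> graph_cycles G \<and>
     C \<inter> D = {} \<and> (\<exists>v. span_verts G C \<inter> span_verts G D = {v}) \<and> X = C \<union> D"

definition joining_path :: "('v, 'e) multigraph \<Rightarrow> 'e set \<Rightarrow> 'e set \<Rightarrow> 'e set \<Rightarrow> bool" where
  "joining_path G C D P \<longleftrightarrow>
     (\<exists>u\<in>span_verts G C. \<exists>v\<in>span_verts G D. path_between G u v P)"

definition loose_handcuffs_of :: "('v, 'e) multigraph \<Rightarrow> 'e set \<Rightarrow> 'e set \<Rightarrow> 'e set \<Rightarrow> bool" where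
  "loose_handcuffs_of G C D X \<longleftrightarrow> C \<in> graph_cycles G \<and> D \<in> graph_cycles G \<and>
     vertex_disjoint G C D \<and>
     (\<exists>P. joining_path G C D P \<and> (\<forall>Q. Q \<subset> P \<longrightarrow> \<not> joining_path G C D Q) \<and> X = C \<union> D \<union> P)"

text \<open>In the simplification, each class of parallel non-loop edges is replaced by the single
  edge named by the common pair of ends. This is, up to names of edges, the result of deleting
  all loops and all but one edge from each parallel class.\<close>

definition si :: "('v, 'e) multigraph \<Rightarrow> ('v, 'v set) multigraph" where
  "si G = \<lparr>vertices = vertices G, edges = ends G ` {e \<in> edges G. card (ends G e) = 2},
     ends = (\<lambda>p. p)\<rparr>"

definition is_cycle_graph :: "('v, 'e) multigraph \<Rightarrow> bool" where
  "is_cycle_graph G \<longleftrightarrow> edges G \<in> graph_cycles G \<and> span_verts G (edges G) = vertices G"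


section \<open>Matroids\<close>

text \<open>The record carries no axioms; the notions below are the usual ones when the independent
  sets are those of a matroid on a finite ground set.\<close>

record 'e pre_matroid =
  ground :: "'e set"
  indep :: "'e set \<Rightarrow> bool"

definition matroid_of_circuits :: "'e set \<Rightarrow> 'e set set \<Rightarrow> 'e pre_matroid" where
  "matroid_of_circuits E \<C> =
     \<lparr>ground = E, indep = (\<lambda>X. X \<subseteq> E \<and> (\<forall>C\<in>\<C>. \<not> C \<subseteq> X))\<rparr>"

definition circuits :: "'e pre_matroid \<Rightarrow> 'e set set" where
  "circuits M = {C. C \<subseteq> ground M \<and> \<not> indep M C \<and> (\<forall>X. X \<subset> C \<longrightarrow> indep M X)}"

lemma circuits_matroid_of_circuits:
  assumes "\<And>C. C \<in> \<C> \<Longrightarrow> C \<subseteq> E"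
    and "\<And>C D. C \<in> \<C> \<Longrightarrow> D \<in> \<C> \<Longrightarrow> C \<subseteq> D \<Longrightarrow> C = D"
  shows "circuits (matroid_of_circuits E \<C>) = \<C>"
proof (intro set_eqI iffI)
  fix X assume "X \<in> circuits (matroid_of_circuits E \<C>)"
  then have X: "X \<subseteq> E" "\<exists>C\<in>\<C>. C \<subseteq> X"
    and min: "\<And>Y. Y \<subset> X \<Longrightarrow> \<forall>C\<in>\<C>. \<not> C \<subseteq> Y"
    by (auto simp: circuits_def matroid_of_circuits_def)
  then obtain C where "C \<in> \<C>" "C \<subseteq> X" by blast
  with min[of C] show "X \<in> \<C>" by (cases "C = X") auto
next
  fix X assume X: "X \<in> \<C>"
  have "\<not> C \<subseteq> Y" if "Y \<subset> X" "C \<in> \<C>" for C Y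
    using assms(2)[OF that(2) X] that(1) by blast
  moreover have "X \<subseteq> E" using assms(1) X .
  ultimately show "X \<in> circuits (matroid_of_circuits E \<C>)"
    using X unfolding circuits_def matroid_of_circuits_def by simp blast
qed

definition mrank :: "'e pre_matroid \<Rightarrow> 'e set \<Rightarrow> nat" where
  "mrank M X = Max (card ` {I. I \<subseteq> X \<and> indep M I})"

definition is_flat :: "'e pre_matroid \<Rightarrow> 'e set \<Rightarrow> bool" where
  "is_flat M F \<longleftrightarrow> F \<subseteq> ground M \<and> (\<forall>e\<in>ground M - F. mrank M (insert e F) \<noteq> mrank M F)"

definition basis_of :: "'e pre_matroid \<Rightarrow> 'e set \<Rightarrow> 'e set \<Rightarrow> bool" where
  "basis_of M T B \<longleftrightarrow> B \<subseteq> T \<and> indep M B \<and> (\<forall>I. B \<subseteq> I \<and> I \<subseteq> T \<and> indep M I \<longrightarrow> I = B)"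

definition contraction :: "'e pre_matroid \<Rightarrow> 'e set \<Rightarrow> 'e pre_matroid" where
  "contraction M T = \<lparr>ground = ground M - T,
     indep = (\<lambda>I. I \<subseteq> ground M - T \<and> (\<exists>B. basis_of M T B \<and> indep M (I \<union> B)))\<rparr>"

text \<open>The empty matroid is connected, so contracting the flat \<open>ground M\<close> is harmless.\<close>

definition matroid_connected :: "'e pre_matroid \<Rightarrow> bool" where
  "matroid_connected M \<longleftrightarrow>
     (\<forall>e\<in>ground M. \<forall>f\<in>ground M. e \<noteq> f \<longrightarrow> (\<exists>C\<in>circuits M. e \<in> C \<and> f \<in> C))"

text \<open>The condition \<open>r(X) + r(E - X) - r(M) \<le> k - 1\<close>, without subtraction.\<close>

definition k_separation :: "nat \<Rightarrow> 'e pre_matroid \<Rightarrow> 'e set \<Rightarrow> bool" where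
  "k_separation k M X \<longleftrightarrow> X \<subseteq> ground M \<and> k \<le> card X \<and> k \<le> card (ground M - X) \<and>
     mrank M X + mrank M (ground M - X) < mrank M (ground M) + k"

definition n_connected_matroid :: "nat \<Rightarrow> 'e pre_matroid \<Rightarrow> bool" where
  "n_connected_matroid n M \<longleftrightarrow> (\<forall>k X. 1 \<le> k \<and> k < n \<longrightarrow> \<not> k_separation k M X)"

definition unbreakable :: "'e pre_matroid \<Rightarrow> bool" where
  "unbreakable M \<longleftrightarrow> matroid_connected M \<and>
     (\<forall>F. is_flat M F \<longrightarrow> matroid_connected (contraction M F))"

definition cycle_matroid :: "('v, 'e) multigraph \<Rightarrow> 'e pre_matroid" where
  "cycle_matroid H = matroid_of_circuits (edges H) (graph_cycles H)"

text \<open>Every finite graph whose cycle matroid is isomorphic to \<open>M\<close> can be relabelled so that its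
  edges are the elements of \<open>M\<close> and its vertices are natural numbers.\<close>

definition graphic :: "'e pre_matroid \<Rightarrow> bool" where
  "graphic M \<longleftrightarrow> (\<exists>H :: (nat, 'e) multigraph. finite_multigraph H \<and> M = cycle_matroid H)"


section \<open>Quasi-biased graphs\<close>

definition quasi_biased_graph ::
  "('v, 'e) multigraph \<Rightarrow> 'e set set \<Rightarrow> 'e set set \<Rightarrow> 'e set set \<Rightarrow> bool" where
  "quasi_biased_graph G \<B> \<L> \<F> \<longleftrightarrow> finite_multigraph G \<and>
     \<B> \<union> \<L> \<union> \<F> = graph_cycles G \<and> \<B> \<inter> \<L> = {} \<and> \<B> \<inter> \<F> = {} \<and> \<L> \<inter> \<F> = {} \<and>
     (\<forall>T. is_theta G T \<longrightarrow> card {C \<in> \<B>. C \<subseteq> T} \<noteq> 2) \<and>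
     (\<forall>C\<in>\<L>. \<forall>D\<in>\<F>. \<not> vertex_disjoint G C D)"

definition quasi_graphic_circuits ::
  "('v, 'e) multigraph \<Rightarrow> 'e set set \<Rightarrow> 'e set set \<Rightarrow> 'e set set \<Rightarrow> 'e set set" where
  "quasi_graphic_circuits G \<B> \<L> \<F> =
     \<B> \<union>
     {T. is_theta G T \<and> (\<forall>C\<in>\<B>. \<not> C \<subseteq> T)} \<union>
     {X. \<exists>C D. tight_handcuffs_of G C D X \<and> C \<notin> \<B> \<and> D \<notin> \<B>} \<union>
     {C \<union> D | C D. C \<in> \<L> \<and> D \<in> \<L> \<and> vertex_disjoint G C D} \<union>
     {X. \<exists>C D. loose_handcuffs_of G C D X \<and> C \<in> \<F> \<and> D \<in> \<F>}"

definition quasi_graphic_matroid ::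
  "('v, 'e) multigraph \<Rightarrow> 'e set set \<Rightarrow> 'e set set \<Rightarrow> 'e set set \<Rightarrow> 'e pre_matroid" where
  "quasi_graphic_matroid G \<B> \<L> \<F> =
     matroid_of_circuits (edges G) (quasi_graphic_circuits G \<B> \<L> \<F>)"

definition degenerate :: "('v, 'e) multigraph \<Rightarrow> 'e set set \<Rightarrow> bool" where
  "degenerate G \<F> \<longleftrightarrow> \<not> (\<exists>C\<in>\<F>. \<exists>D\<in>\<F>. vertex_disjoint G C D)"

end

theory Submission
  imports Defs
begin

text \<open>
  The matroid has rank function \<open>r(X) = |V| - c(X) + l(X)\<close>, where \<open>c\<close> counts components and \<open>l(X)\<close> is
  1 if \<open>X\<close> contains a cycle of \<open>\<L>\<close> and otherwise the number of unbalanced components. The matroid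
  hypotheses enter only through three consequences. By submodularity, the union of two connected
  balanced subgraphs whose intersection is connected is balanced. By 3-connectivity, for a 2-cut
  \<open>{u, v}\<close> with side \<open>A\<close> the edges meeting \<open>A\<close> are unbalanced. By unbreakability, a vertex set \<open>Z\<close>
  inducing rank \<open>|Z|\<close> (for instance, a connected unbalanced one) has a connected complement, since
  contracting the closure of its edges leaves a connected matroid; applied to the union of two
  separated \<open>\<F>\<close>-cycles this also gives degeneracy.

  Call a vertex \<open>b\<close> of a side \<open>D\<close> good if \<open>D \<union> {u, v} - {b}\<close> is connected. If \<open>D\<close> has a good vertex \<open>b\<close>,
  then \<open>G - {a, b}\<close> is connected, hence balanced, for each \<open>a\<close> on the other side \<open>A\<close>; three such \<open>a\<close>
  would make \<open>G - b\<close> a union of balanced pieces, so \<open>|A| \<le> 2\<close>. If neither side has a good vertex, both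
  are chordless paths and \<open>si G\<close> is a cycle. If only \<open>A\<close> has one, then \<open>|D| \<le> 2\<close>; after possibly
  changing the cut all vertices of \<open>A\<close> are good, \<open>A\<close> is a clique, and \<open>|V| \<ge> 7\<close> leads to a contradiction.
\<close>

section \<open>Paths and cycles\<close>

text \<open>Nothing says in advance that the circuit family belongs to a matroid. So
  \<open>rho\<close> is treated as a bare formula, shown to obey local rank axioms that involve only
  one or two added edges, and only then identified with the rank of \<open>M\<close>. The conditions
  on a quasi-biased graph pay for these axioms: that \<open>L\<close>-cycles meet
  \<open>F\<close>-cycles keeps \<open>rho\<close> from dropping when the first
  \<open>L\<close>-cycle appears, and the theta condition makes closure stable under adding a
  spanned edge. The bound 6 is 2 + 2 + 2. Three vertices are the fewest such that every edge avoids
  at least one of them, so a balanced union needs a triple, and a good vertex leaves at most two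
  vertices opposite; the two cut vertices are added. Degeneracy needs the same threshold, so that
  around a cycle two unbalanced pairs of consecutive vertices can be kept apart by two nonadjacent
  cut vertices. Non-graphicness enters as the existence of a cycle outside \<open>B\<close>, which
  gives \<open>M\<close> the full rank \<open>card V\<close>.\<close>

locale mgraph =
  fixes G :: "('v, 'e) multigraph"
  assumes finite_graph: "finite_multigraph G"
begin

abbreviation "V \<equiv> vertices G"
abbreviation "E \<equiv> edges G"
abbreviation "en \<equiv> ends G"
abbreviation "sp \<equiv> span_verts G"
abbreviation "cycles \<equiv> graph_cycles G"

lemma finite_V: "finite V" and finite_E: "finite E"
  using finite_graph by (auto simp: finite_multigraph_def)

lemma ends_subset: "e \<in> E \<Longrightarrow> en e \<subseteq> V"
  using finite_graph by (auto simp: finite_multigraph_def)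

lemma finite_edges: "X \<subseteq> E \<Longrightarrow> finite X"
  using finite_E finite_subset by blast

lemma obtain_ends:
  assumes "e \<in> E" obtains x y where "en e = {x, y}" "x \<in> V" "y \<in> V"
proof -
  have "card (en e) = 1 \<or> card (en e) = 2"
    using assms finite_graph by (auto simp: finite_multigraph_def)
  then obtain x y where "en e = {x, y}"
    by (metis card_1_singletonE card_2_iff insert_absorb2)
  with ends_subset[OF assms] that show ?thesis by auto
qed

lemma ends_nonempty: "e \<in> E \<Longrightarrow> en e \<noteq> {}"
  by (metis insert_not_empty obtain_ends)

lemma obtain_other_end:
  assumes "e \<in> E" "x \<in> en e" obtains y where "en e = {x, y}" "y \<in> V"
  using obtain_ends[OF assms(1)] assms(2) by (metis doubleton_eq_iff insertE singletonD)

lemma sp_iff: "v \<in> sp X \<longleftrightarrow> (\<exists>e\<in>X. v \<in> en e)"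
  by (auto simp: span_verts_def)

lemma sp_mono: "X \<subseteq> Y \<Longrightarrow> sp X \<subseteq> sp Y"
  by (auto simp: span_verts_def)

lemma sp_Un: "sp (X \<union> Y) = sp X \<union> sp Y"
  by (auto simp: span_verts_def)

lemma sp_V: "X \<subseteq> E \<Longrightarrow> sp X \<subseteq> V"
  using ends_subset by (auto simp: span_verts_def)

section \<open>Reachability through an edge set\<close>

definition con :: "'e set \<Rightarrow> 'v \<Rightarrow> 'v \<Rightarrow> bool" where
  "con X x y \<longleftrightarrow> (x, y) \<in> {(u, v). \<exists>e\<in>X. en e = {u, v}}\<^sup>*"

lemma con_refl [simp]: "con X x x"
  by (simp add: con_def)

lemma con_trans: "con X x y \<Longrightarrow> con X y z \<Longrightarrow> con X x z"
  unfolding con_def by (rule rtrancl_trans)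

lemma con_sym: "con X x y \<Longrightarrow> con X y x"
proof -
  have "sym {(u, v). \<exists>e\<in>X. en e = {u, v}}" by (auto simp: sym_def insert_commute)
  then show "con X x y \<Longrightarrow> con X y x" unfolding con_def by (meson sym_rtrancl symD)
qed

lemma con_edge: "e \<in> X \<Longrightarrow> en e = {x, y} \<Longrightarrow> con X x y"
  unfolding con_def by (rule r_into_rtrancl) auto

lemma con_ends: "e \<in> X \<Longrightarrow> X \<subseteq> E \<Longrightarrow> x \<in> en e \<Longrightarrow> y \<in> en e \<Longrightarrow> con X x y"
proof -
  assume a: "e \<in> X" "X \<subseteq> E" "x \<in> en e" "y \<in> en e"
  then obtain z where z: "en e = {x, z}" using obtain_other_end by blast
  with a have "y = x \<or> y = z" by auto
  then show "con X x y" using con_edge[OF a(1) z] by auto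
qed

lemma con_induct [consumes 1, case_names refl step]:
  assumes "con X x y" "P x"
    and "\<And>y z e. con X x y \<Longrightarrow> P y \<Longrightarrow> e \<in> X \<Longrightarrow> en e = {y, z} \<Longrightarrow> P z"
  shows "P y"
  using assms(1) unfolding con_def
  by (induction rule: rtrancl_induct) (use assms(2,3) in \<open>auto simp: con_def\<close>)

lemma con_subst:
  assumes "con X x y" "\<And>e u v. e \<in> X \<Longrightarrow> en e = {u, v} \<Longrightarrow> con Y u v"
  shows "con Y x y"
  using assms(1) by (induction rule: con_induct) (use assms(2) con_trans in \<open>auto\<close>)

lemma con_mono: "con X x y \<Longrightarrow> X \<subseteq> Y \<Longrightarrow> con Y x y"
  by (rule con_subst) (auto intro: con_edge)

text \<open>The basic way to refute connectivity: exhibit a vertex set that no edge of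
  \<open>X\<close> leaves.\<close>

lemma con_closed:
  assumes "con X x y" "x \<in> S" "\<And>e. e \<in> X \<Longrightarrow> en e \<inter> S \<noteq> {} \<Longrightarrow> en e \<subseteq> S"
  shows "y \<in> S"
  using assms(1) by (induction rule: con_induct) (use assms(2,3) in auto)

lemma con_eq_or_span:
  assumes "con X x y" shows "x = y \<or> x \<in> sp X \<and> y \<in> sp X"
  using assms by (induction rule: con_induct) (auto simp: sp_iff)

text \<open>A walk can be shortened so that it uses \<open>e\<close> at most once, in one of two
  directions; hence the three alternatives.\<close>

lemma con_insert:
  assumes "en e = {a, b}"
  shows "con (insert e X) x y \<longleftrightarrow> con X x y \<or> con X x a \<and> con X b y \<or> con X x b \<and> con X a y"
    (is "?l \<longleftrightarrow> ?r y")
proof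
  assume ?l then show "?r y"
  proof (induction rule: con_induct)
    case (step y z f)
    show ?case
    proof (cases "f \<in> X")
      case True
      then have "con X y z" using step con_edge by blast
      with step.IH show ?thesis using con_trans by blast
    next
      case False
      with step have "{y, z} = {a, b}" using assms by auto
      then have "y = a \<and> z = b \<or> y = b \<and> z = a" by (auto simp: doubleton_eq_iff)
      with step.IH show ?thesis using con_trans con_refl by blast
    qed
  qed simp
next
  have "con (insert e X) a b" using con_edge[of e "insert e X" a b] assms by simp
  moreover assume "?r y"
  ultimately show ?l using con_mono[of X _ _ "insert e X"] con_trans con_sym
    by (metis subset_insertI)
qed

lemma con_insert_redundant:
  assumes "en e = {a, b}" "con X a b"
  shows "con (insert e X) x y \<longleftrightarrow> con X x y"
  using con_insert[OF assms(1)] assms(2) con_trans con_sym by metis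

text \<open>Simple paths with vertex set \<open>S\<close> and edge set \<open>P\<close> as explicit
  data; the side condition on \<open>S\<close> in \<open>Cons\<close> forbids repetition. They agree
  with the list form of \<open>path_between\<close>, but splitting and gluing become statements
  about sets.\<close>

inductive ipath :: "'v \<Rightarrow> 'v \<Rightarrow> 'v set \<Rightarrow> 'e set \<Rightarrow> bool" where
  Nil: "x \<in> V \<Longrightarrow> ipath x x {x} {}"
| Cons: "e \<in> E \<Longrightarrow> en e = {x, y} \<Longrightarrow> x \<notin> S \<Longrightarrow> ipath y z S P \<Longrightarrow> ipath x z (insert x S) (insert e P)"

lemma ipath_basic:
  assumes "ipath x y S P"
  shows "x \<in> S" "y \<in> S" "S \<subseteq> V" "P \<subseteq> E" "finite S" "finite P" "\<And>e. e \<in> P \<Longrightarrow> en e \<subseteq> S"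
    "w \<in> S \<Longrightarrow> con P x w" "card S = card P + 1" "x = y \<longleftrightarrow> P = {}" "P = {} \<Longrightarrow> S = {x}"
proof -
  have "x \<in> S \<and> y \<in> S \<and> S \<subseteq> V \<and> P \<subseteq> E \<and> finite S \<and> finite P \<and> (\<forall>e\<in>P. en e \<subseteq> S)
    \<and> (\<forall>w\<in>S. con P x w) \<and> card S = card P + 1 \<and> (x = y \<longleftrightarrow> P = {}) \<and> (P = {} \<longrightarrow> S = {x})"
    using assms
  proof (induction rule: ipath.induct)
    case (Cons e x y S z P)
    have "e \<notin> P" using Cons by auto
    moreover have "con (insert e P) x w" if "w \<in> S" for w
    proof -
      have "con P y w" using Cons.IH that by blast
      then show ?thesis using con_insert[OF Cons.hyps(2), of P x w] by simp
    qed
    ultimately show ?case using Cons ends_subset by auto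
  qed simp
  then show "x \<in> S" "y \<in> S" "S \<subseteq> V" "P \<subseteq> E" "finite S" "finite P" "\<And>e. e \<in> P \<Longrightarrow> en e \<subseteq> S"
    "w \<in> S \<Longrightarrow> con P x w" "card S = card P + 1" "x = y \<longleftrightarrow> P = {}" "P = {} \<Longrightarrow> S = {x}"
    by blast+
qed

lemma ipath_con: "ipath x y S P \<Longrightarrow> v \<in> S \<Longrightarrow> w \<in> S \<Longrightarrow> con P v w"
  by (meson con_sym con_trans ipath_basic(8))

lemma ipath_span_subset: "ipath x y S P \<Longrightarrow> sp P \<subseteq> S"
  using ipath_basic(7)[of x y S P] by (auto simp: span_verts_def)

lemma ipath_span: assumes "ipath x y S P" "x \<noteq> y" shows "sp P = S"
proof -
  have "w \<in> sp P" if "w \<in> S" for w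
    using con_eq_or_span[OF ipath_con[OF assms(1) ipath_basic(1)[OF assms(1)] that]]
      con_eq_or_span[OF ipath_con[OF assms(1) ipath_basic(2)[OF assms(1)] that]] assms(2) by auto
  with ipath_span_subset[OF assms(1)] show ?thesis by auto
qed

lemma ipath_single: "e \<in> E \<Longrightarrow> en e = {x, y} \<Longrightarrow> x \<noteq> y \<Longrightarrow> ipath x y {x, y} {e}"
  using ipath.Cons[of e x y "{y}" y "{}"] ipath.Nil[of y] ends_subset[of e] by auto

lemma ipath_append:
  assumes "ipath x y S P" "ipath y z T Q" "S \<inter> T = {y}"
  shows "ipath x z (S \<union> T) (P \<union> Q)"
  using assms
proof (induction rule: ipath.induct)
  case (Nil x)
  then have "insert x T = T" by auto
  with Nil show ?case by simp
next
  case (Cons e x y S w P)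
  have "S \<inter> T = {w}" using Cons.prems(2) ipath_basic(2)[OF Cons.hyps(4)] ipath_basic(1)[OF Cons.prems(1)] by auto
  then have "ipath y z (S \<union> T) (P \<union> Q)" using Cons by blast
  moreover have "x \<notin> T" using Cons ipath_basic(2)[OF Cons.hyps(4)] by auto
  ultimately show ?case using ipath.Cons[of e x y "S \<union> T" z "P \<union> Q"] Cons by simp
qed

lemma ipath_rev: "ipath x y S P \<Longrightarrow> ipath y x S P"
proof (induction rule: ipath.induct)
  case (Nil x) then show ?case by (rule ipath.Nil)
next
  case (Cons e x y S z P)
  have "ipath y x {y, x} {e}"
    using Cons ipath_single[of e y x] ipath_basic(1)[OF Cons.hyps(4)] by (auto simp: insert_commute)
  moreover have "S \<inter> {y, x} = {y}" using Cons ipath_basic(1)[OF Cons.hyps(4)] by auto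
  ultimately have "ipath z x (S \<union> {y, x}) (P \<union> {e})" using Cons.IH ipath_append by blast
  moreover have "S \<union> {y, x} = insert x S" using ipath_basic(1)[OF Cons.hyps(4)] by auto
  ultimately show ?case by simp
qed

lemma ipath_split:
  assumes "ipath x y S P" "w \<in> S"
  obtains S1 P1 S2 P2 where "ipath x w S1 P1" "ipath w y S2 P2" "S = S1 \<union> S2" "S1 \<inter> S2 = {w}"
    "P = P1 \<union> P2" "P1 \<inter> P2 = {}"
proof -
  have "\<exists>S1 P1 S2 P2. ipath x w S1 P1 \<and> ipath w y S2 P2 \<and> S = S1 \<union> S2 \<and> S1 \<inter> S2 = {w}
    \<and> P = P1 \<union> P2 \<and> P1 \<inter> P2 = {}"
    using assms
  proof (induction rule: ipath.induct)
    case (Nil x)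
    then show ?case by (metis Int_absorb Int_empty_right Un_absorb ipath.Nil singletonD)
  next
    case (Cons e x y S z P)
    show ?case
    proof (cases "w = x")
      case True
      have "ipath x w {x} {}" using True ipath.Nil[of x] ends_subset[OF Cons.hyps(1)] Cons.hyps(2) by auto
      moreover have "ipath w z (insert x S) (insert e P)" using True Cons ipath.Cons by blast
      ultimately show ?thesis using True
        by (intro exI[of _ "{x}"] exI[of _ "{}"] exI[of _ "insert x S"] exI[of _ "insert e P"]) auto
    next
      case False
      then obtain S1 P1 S2 P2 where h: "ipath y w S1 P1" "ipath w z S2 P2" "S = S1 \<union> S2" "S1 \<inter> S2 = {w}"
        "P = P1 \<union> P2" "P1 \<inter> P2 = {}" using Cons by blast
      have "e \<notin> P2" using Cons.hyps(2,3) ipath_basic(7)[OF h(2)] h(3) by auto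
      moreover have "ipath x w (insert x S1) (insert e P1)" using ipath.Cons[of e x y S1] Cons h by auto
      ultimately show ?thesis using h Cons.hyps(3)
        by (intro exI[of _ "insert x S1"] exI[of _ "insert e P1"] exI[of _ S2] exI[of _ P2]) auto
    qed
  qed
  with that show ?thesis by blast
qed

lemma con_ipath:
  assumes "con X x y" "X \<subseteq> E" "x \<in> V"
  obtains S P where "ipath x y S P" "P \<subseteq> X"
proof -
  have "\<exists>S P. ipath y x S P \<and> P \<subseteq> X"
    using assms(1)
  proof (induction rule: con_induct)
    case refl
    then show ?case using ipath.Nil[OF assms(3)] by blast
  next
    case (step y z e)
    then obtain S P where SP: "ipath y x S P" "P \<subseteq> X" by blast
    show ?case
    proof (cases "z \<in> S")
      \<comment> \<open>The new vertex already lies on the path: keep only the part from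
        \<open>z\<close> on, so that the path stays simple.\<close>
      case True
      from ipath_split[OF SP(1) True] obtain S2 P2 where "ipath z x S2 P2" "P2 \<subseteq> P" by blast
      then show ?thesis using SP by blast
    next
      case False
      then have "ipath z x (insert z S) (insert e P)"
        using ipath.Cons[of e z y S x P] SP step assms(2) by (auto simp: insert_commute)
      then show ?thesis using SP step by blast
    qed
  qed
  with that ipath_rev show ?thesis by blast
qed

section \<open>Degrees, and cycles as connected 2-regular edge sets\<close>

definition dg :: "'e set \<Rightarrow> 'v \<Rightarrow> nat" where
  "dg X v = card {e \<in> X. v \<in> en e} + card {e \<in> X. en e = {v}}"

lemma con_iff_adjacency: "con X x y \<longleftrightarrow> (x, y) \<in> (adjacency (edge_subgraph G X))\<^sup>*"
  by (simp add: con_def adjacency_def edge_subgraph_def)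

lemma cycle_iff:
  "C \<in> cycles \<longleftrightarrow> C \<subseteq> E \<and> C \<noteq> {} \<and> (\<forall>x\<in>sp C. \<forall>y\<in>sp C. con C x y) \<and> (\<forall>v\<in>sp C. dg C v = 2)"
proof -
  have "sp C \<noteq> {} \<longleftrightarrow> C \<noteq> {}" if "C \<subseteq> E"
  proof
    assume "C \<noteq> {}"
    then obtain e where "e \<in> C" by blast
    with ends_nonempty[of e] that show "sp C \<noteq> {}" by (auto simp: span_verts_def)
  qed (auto simp: span_verts_def)
  then show ?thesis
    unfolding graph_cycles_def graph_connected_def con_iff_adjacency
    by (auto simp: vdegree_def dg_def edge_subgraph_def)
qed

lemma cycleD:
  assumes "C \<in> cycles"
  shows "C \<subseteq> E" "C \<noteq> {}" "\<And>x y. x \<in> sp C \<Longrightarrow> y \<in> sp C \<Longrightarrow> con C x y" "\<And>v. v \<in> sp C \<Longrightarrow> dg C v = 2"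
    "finite C" "sp C \<noteq> {}" "sp C \<subseteq> V"
proof -
  show *: "C \<subseteq> E" "C \<noteq> {}" "\<And>x y. x \<in> sp C \<Longrightarrow> y \<in> sp C \<Longrightarrow> con C x y" "\<And>v. v \<in> sp C \<Longrightarrow> dg C v = 2"
    using assms unfolding cycle_iff by blast+
  show "finite C" using *(1) finite_edges by blast
  obtain e where "e \<in> C" using *(2) by blast
  with ends_nonempty[of e] *(1) show "sp C \<noteq> {}" by (auto simp: span_verts_def)
  show "sp C \<subseteq> V" using sp_V *(1) .
qed

text \<open>Double counting of incidences, a loop counting twice at its only end. \<open>W\<close>
  may exceed the span, as vertices off \<open>X\<close> have degree 0.\<close>

lemma handshake:
  assumes "X \<subseteq> E" "sp X \<subseteq> W" "finite W"
  shows "sum (dg X) W = 2 * card X"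
proof -
  have fX: "finite X" using assms finite_edges by blast
  have "sum (dg X) W = (\<Sum>v\<in>W. \<Sum>e\<in>X. (if v \<in> en e then 1 else 0) + (if en e = {v} then 1 else 0))"
    unfolding dg_def
    by (rule sum.cong) (use fX in \<open>auto simp: sum.distrib sum.If_cases Int_def\<close>)
  also have "\<dots> = (\<Sum>e\<in>X. \<Sum>v\<in>W. (if v \<in> en e then 1 else 0) + (if en e = {v} then 1 else 0))"
    by (rule sum.swap)
  also have "\<dots> = (\<Sum>e\<in>X. 2)"
  proof (rule sum.cong)
    fix e assume e: "e \<in> X"
    then have "e \<in> E" using assms(1) by blast
    then obtain x y where xy: "en e = {x, y}" by (rule obtain_ends)
    have s: "x \<in> W" "y \<in> W" using e xy assms(2) by (auto simp: span_verts_def)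
    have 1: "W \<inter> {v. v \<in> en e} = {x, y}" using xy s by auto
    have 2: "W \<inter> {v. en e = {v}} = (if x = y then {x} else {})" using xy s by (auto simp: doubleton_eq_iff)
    show "(\<Sum>v\<in>W. (if v \<in> en e then 1 else 0) + (if en e = {v} then 1 else 0)) = (2::nat)"
      using 1 2 assms(3) by (simp add: sum.distrib sum.If_cases)
  qed simp
  finally show ?thesis by simp
qed

text \<open>Parity: if \<open>e\<close> were a bridge of \<open>C\<close>, the part of
  \<open>C - {e}\<close> reachable from \<open>x\<close> would have \<open>x\<close> as its only
  vertex of odd degree.\<close>

lemma cycle_minus_edge:
  assumes C: "C \<in> cycles" and e: "e \<in> C" "en e = {x, y}"
  shows "con (C - {e}) x y"
proof (rule ccontr)
  assume n: "\<not> con (C - {e}) x y"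
  then have xy: "x \<noteq> y" by auto
  define W where "W = {w. con (C - {e}) x w}"
  have WC: "W \<subseteq> sp C"
    using con_eq_or_span e sp_mono[of "C - {e}" C] by (fastforce simp: W_def sp_iff)
  then have fW: "finite W" using cycleD(7)[OF C] finite_V finite_subset by metis
  define X where "X = {f \<in> C - {e}. en f \<subseteq> W}"
  have XE: "X \<subseteq> E" and fX: "finite X" using cycleD(1,5)[OF C] by (auto simp: X_def)
  have Wcl: "f \<in> X" if "f \<in> C" "f \<noteq> e" "v \<in> en f" "v \<in> W" for f v
    using that con_ends[of f "C - {e}" v] cycleD(1)[OF C] con_trans
    unfolding X_def W_def by blast
  have yW: "y \<notin> W" "x \<in> W" using n by (auto simp: W_def)
  have loops: "{f \<in> C. en f = {v}} = {f \<in> X. en f = {v}}" if "v \<in> W" for v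
    using that Wcl e xy unfolding X_def by auto
  have 1: "dg X v = 2" if "v \<in> W" "v \<noteq> x" for v
  proof -
    have "{f \<in> C. v \<in> en f} = {f \<in> X. v \<in> en f}"
      using that Wcl e yW by (auto simp: X_def)
    then show ?thesis using loops cycleD(4)[OF C, of v] that WC by (auto simp: dg_def)
  qed
  \<comment> \<open>\<open>x\<close> loses \<open>e\<close> and nothing else, because
    \<open>y\<close> lies outside \<open>W\<close>.\<close>
  have 2: "dg X x = 1"
  proof -
    have "{f \<in> C. x \<in> en f} = insert e {f \<in> X. x \<in> en f}" "e \<notin> X"
      using Wcl yW e by (auto simp: X_def)
    then have "dg C x = Suc (dg X x)" using loops[of x] yW fX by (simp add: dg_def)
    then show ?thesis using cycleD(4)[OF C, of x] WC yW by auto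
  qed
  have "sum (dg X) W = dg X x + sum (dg X) (W - {x})"
    using fW yW by (simp add: sum.remove)
  also have "\<dots> = 1 + 2 * card (W - {x})" using 1 2 by simp
  finally have "sum (dg X) W = 1 + 2 * card (W - {x})" .
  moreover have "sum (dg X) W = 2 * card X"
    by (rule handshake[OF XE _ fW]) (auto simp: X_def sp_iff)
  ultimately show False by presburger
qed

text \<open>At a vertex of \<open>C\<close>, the edges of \<open>C\<close> already use up the degree
  2 available in \<open>D\<close>, so no edge of \<open>D\<close> leaves the span of
  \<open>C\<close>.\<close>

lemma cycle_antichain:
  assumes C: "C \<in> cycles" and D: "D \<in> cycles" and sub: "C \<subseteq> D"
  shows "C = D"
proof -
  have at: "f \<in> C" if "v \<in> sp C" "f \<in> D" "v \<in> en f" for v f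
  proof -
    have v: "v \<in> sp D" using that sub sp_mono by blast
    have 1: "card {e \<in> C. v \<in> en e} \<le> card {e \<in> D. v \<in> en e}"
      and 2: "card {e \<in> C. en e = {v}} \<le> card {e \<in> D. en e = {v}}"
      using cycleD(5)[OF D] sub by (auto intro!: card_mono)
    then have "card {e \<in> C. v \<in> en e} = card {e \<in> D. v \<in> en e}"
      using cycleD(4)[OF C that(1)] cycleD(4)[OF D v] unfolding dg_def by linarith
    then have "{e \<in> C. v \<in> en e} = {e \<in> D. v \<in> en e}"
      using cycleD(5)[OF D] sub by (intro card_subset_eq) auto
    then show ?thesis using that by blast
  qed
  obtain x where x: "x \<in> sp C" using cycleD(6)[OF C] by blast
  have "y \<in> sp C" if "y \<in> sp D" for y
  proof -
    have "con D x y" using cycleD(3)[OF D] x that sp_mono[OF sub] by blast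
    then show ?thesis by (rule con_closed) (use x at in \<open>auto simp: sp_iff\<close>)
  qed
  then have "f \<in> C" if "f \<in> D" for f
  proof -
    have "f \<in> E" using that cycleD(1)[OF D] by blast
    then obtain u w where "en f = {u, w}" by (rule obtain_ends)
    moreover from this have "u \<in> sp D" using that by (auto simp: sp_iff)
    ultimately show ?thesis using at[of u f] that \<open>\<And>y. y \<in> sp D \<Longrightarrow> y \<in> sp C\<close> by simp
  qed
  with sub show ?thesis by blast
qed

lemma dg_ipath:
  assumes "ipath x y S P"
  shows "dg P v = (if x \<noteq> y \<and> v \<in> S then if v = x \<or> v = y then 1 else 2 else 0)"
  using assms
proof (induction rule: ipath.induct)
  case (Nil x) then show ?case by (simp add: dg_def)
next
  case (Cons e x y S z P)
  note b = ipath_basic[OF Cons.hyps(4)]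
  have eP: "e \<notin> P" using Cons.hyps(2,3) b(7)[of e] by auto
  have ne: "x \<noteq> y" "x \<noteq> z" using Cons b by auto
  have l: "{f. (f = e \<or> f \<in> P) \<and> en f = {v}} = {f \<in> P. en f = {v}}"
    using Cons.hyps(2) ne by auto
  have m: "{f. (f = e \<or> f \<in> P) \<and> v \<in> en f} = (if v \<in> {x, y} then insert e else id) {f \<in> P. v \<in> en f}"
    using Cons.hyps(2) by auto
  have "dg (insert e P) v = dg P v + (if v \<in> {x, y} then 1 else 0)"
    unfolding dg_def using eP b(6) by (simp add: l m)
  then show ?case using Cons.IH ne b(1,2,10,11) Cons.hyps(3) by auto
qed

lemma path_edge_cycle:
  assumes P: "ipath x y S P" and e: "e \<in> E" "e \<notin> P" "en e = {x, y}" and xy: "x \<noteq> y"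
  shows "insert e P \<in> cycles" "sp (insert e P) = S"
proof -
  note b = ipath_basic[OF P]
  show sp: "sp (insert e P) = S"
    using ipath_span[OF P xy] e b by (auto simp: span_verts_def)
  have l: "{f. (f = e \<or> f \<in> P) \<and> en f = {v}} = {f \<in> P. en f = {v}}" for v
    using e xy by auto
  have m: "{f. (f = e \<or> f \<in> P) \<and> v \<in> en f} = (if v \<in> {x, y} then insert e else id) {f \<in> P. v \<in> en f}" for v
    using e by auto
  have "dg (insert e P) v = dg P v + (if v \<in> {x, y} then 1 else 0)" for v
    unfolding dg_def using e b(6) by (simp add: l m)
  then have "dg (insert e P) v = 2" if "v \<in> S" for v
    using that dg_ipath[OF P, of v] xy by auto
  moreover have "con (insert e P) v w" if "v \<in> S" "w \<in> S" for v w
    using ipath_con[OF P that] con_mono by blast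
  ultimately show "insert e P \<in> cycles"
    unfolding cycle_iff sp using e b by auto
qed

lemma loop_cycle: "e \<in> E \<Longrightarrow> en e = {x} \<Longrightarrow> {e} \<in> cycles"
  unfolding cycle_iff by (auto simp: sp_iff dg_def card_1_singleton_iff Collect_conv_if)

lemma con_cycle:
  assumes "X \<subseteq> E" "e \<in> E" "e \<notin> X" "en e = {x, y}" "con X x y"
  obtains C where "C \<in> cycles" "e \<in> C" "C \<subseteq> insert e X"
proof (cases "x = y")
  case True then show ?thesis using that loop_cycle[of e x] assms by auto
next
  case False
  have "x \<in> V" using ends_subset[OF assms(2)] assms(4) by auto
  then obtain S P where "ipath x y S P" "P \<subseteq> X" using con_ipath[OF assms(5,1)] by blast
  moreover from this have "e \<notin> P" using assms(3) by blast
  ultimately show ?thesis using that[of "insert e P"] path_edge_cycle(1)[of x y S P e] assms False by blast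
qed

lemma cycle_loop:
  assumes "C \<in> cycles" "e \<in> C" "en e = {x}"
  shows "C = {e}"
  using cycle_antichain[OF loop_cycle[OF _ assms(3)] assms(1)] cycleD(1)[OF assms(1)] assms(2) by blast

text \<open>A path in \<open>C - {e}\<close> between the ends of \<open>e\<close> closes to a cycle
  inside \<open>C\<close>, which is all of \<open>C\<close> because cycles form an
  antichain.\<close>

lemma cycle_path:
  assumes C: "C \<in> cycles" and e: "e \<in> C" "en e = {x, y}" "x \<noteq> y"
  shows "ipath x y (sp C) (C - {e})"
proof -
  have E: "C \<subseteq> E" using cycleD(1)[OF C] .
  have "x \<in> V" using ends_subset[of e] e E by auto
  then obtain S P where P: "ipath x y S P" "P \<subseteq> C - {e}"
    using con_ipath[OF cycle_minus_edge[OF C e(1,2)] _ \<open>x \<in> V\<close>] E by blast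
  have "e \<in> E" "e \<notin> P" using P(2) e(1) E by auto
  then have "insert e P \<in> cycles" "sp (insert e P) = S" using path_edge_cycle[OF P(1)] e by blast+
  moreover from this have "insert e P = C" using cycle_antichain[OF _ C] P e by blast
  ultimately show ?thesis using P by (metis Diff_insert_absorb insert_Diff subset_Diff_insert)
qed

text \<open>Setting the first edge of \<open>Q\<close> aside reduces this to a path plus one
  edge.\<close>

lemma two_paths_cycle:
  assumes P: "ipath x y S P" and Q: "ipath x y T Q" and xy: "x \<noteq> y"
    and "S \<inter> T = {x, y}" "P \<inter> Q = {}"
  shows "P \<union> Q \<in> cycles" "sp (P \<union> Q) = S \<union> T"
proof -
  show "sp (P \<union> Q) = S \<union> T" using ipath_span[OF P xy] ipath_span[OF Q xy] by (simp add: sp_Un)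
  from Q xy obtain e x' T' Q' where h: "e \<in> E" "en e = {x, x'}" "x \<notin> T'" "ipath x' y T' Q'"
    "T = insert x T'" "Q = insert e Q'" by (auto elim: ipath.cases)
  have r: "ipath y x' T' Q'" using ipath_rev[OF h(4)] .
  have "S \<inter> T' = {y}" using assms(4) h(3) ipath_basic(1)[OF r] ipath_basic(2)[OF P] unfolding h(5) by auto
  from ipath_append[OF P r this] have "ipath x x' (S \<union> T') (P \<union> Q')" .
  moreover have "e \<notin> P \<union> Q'" using assms(5) h ipath_basic(7)[OF h(4)] by auto
  moreover have "x \<noteq> x'" using h(3) ipath_basic(2)[OF r] by auto
  ultimately have "insert e (P \<union> Q') \<in> cycles" using path_edge_cycle(1) h by blast
  then show "P \<union> Q \<in> cycles" using h by simp
qed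

lemma cycle_split:
  assumes C: "C \<in> cycles" and pq: "p \<in> sp C" "q \<in> sp C" "p \<noteq> q"
  obtains S P T Q where "ipath p q S P" "ipath p q T Q" "S \<inter> T = {p, q}" "P \<inter> Q = {}"
    "C = P \<union> Q" "sp C = S \<union> T"
proof -
  obtain e where e: "e \<in> C" "p \<in> en e" using pq by (auto simp: sp_iff)
  then have eE: "e \<in> E" using cycleD(1)[OF C] by blast
  obtain y where y: "en e = {p, y}" using obtain_other_end[OF eE e(2)] .
  have py: "p \<noteq> y"
  proof
    assume "p = y"
    then have "C = {e}" using cycle_loop[OF C e(1), of p] y by simp
    then show False using pq y \<open>p = y\<close> by (auto simp: sp_iff)
  qed
  have P0: "ipath p y (sp C) (C - {e})" using cycle_path[OF C e(1) y py] .
  obtain S1 P1 S2 P2 where h: "ipath p q S1 P1" "ipath q y S2 P2" "sp C = S1 \<union> S2" "S1 \<inter> S2 = {q}"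
    "C - {e} = P1 \<union> P2" "P1 \<inter> P2 = {}" using ipath_split[OF P0 pq(2)] by blast
  have "p \<notin> S2" using h(4) pq ipath_basic(1)[OF h(1)] by auto
  then have "ipath p q (insert p S2) (insert e P2)"
    using ipath.Cons[OF eE y _ ipath_rev[OF h(2)]] by blast
  moreover have "S1 \<inter> insert p S2 = {p, q}" using h(4) ipath_basic(1)[OF h(1)] by auto
  moreover have "P1 \<inter> insert e P2 = {}" using h by auto
  moreover have "C = P1 \<union> insert e P2" using h e by auto
  moreover have "sp C = S1 \<union> insert p S2" using h ipath_basic(1)[OF h(1)] by auto
  ultimately show ?thesis using that h(1) by blast
qed

end

section \<open>Components and theta subgraphs\<close>

lemma Int_singletonD: "A \<inter> B = {w} \<Longrightarrow> y \<in> A \<Longrightarrow> y \<in> B \<Longrightarrow> y = w"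
  by blast

section \<open>Ears, and agreement with paths given by lists\<close>

context mgraph
begin

text \<open>The vertices of \<open>W\<close> cut the path into segments. If \<open>R\<close> related
  the ends of every segment, transitivity would relate \<open>x\<close> to \<open>y\<close>; so some
  segment is an ear on \<open>W\<close> whose ends are not related.\<close>

lemma ear:
  assumes "ipath x y S P" "x \<in> W" "y \<in> W" "\<not> R x y"
    and "\<And>a b c. a \<in> W \<Longrightarrow> b \<in> W \<Longrightarrow> c \<in> W \<Longrightarrow> R a b \<Longrightarrow> R b c \<Longrightarrow> R a c"
  shows "\<exists>p q S' P'. ipath p q S' P' \<and> P' \<subseteq> P \<and> S' \<inter> W = {p, q} \<and> \<not> R p q"
  using assms(1-4)
proof (induction "card S" arbitrary: x y S P rule: less_induct)
  case less
  note b = ipath_basic[OF less.prems(1)]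
  show ?case
  proof (cases "S \<inter> W = {x, y}")
    case True
    with less.prems show ?thesis by blast
  next
    case False
    then obtain w where w: "w \<in> S" "w \<in> W" "w \<noteq> x" "w \<noteq> y" using b less.prems by blast
    obtain S1 P1 S2 P2 where h: "ipath x w S1 P1" "ipath w y S2 P2" "S = S1 \<union> S2" "S1 \<inter> S2 = {w}"
      "P = P1 \<union> P2" "P1 \<inter> P2 = {}" using ipath_split[OF less.prems(1) w(1)] .
    have "y \<notin> S1" using Int_singletonD[OF h(4)] w(4) ipath_basic(2)[OF h(2)] by metis
    then have 1: "card S1 < card S" using b(2,5) h(3) by (intro psubset_card_mono) auto
    have "x \<notin> S2" using Int_singletonD[OF h(4)] w(3) ipath_basic(1)[OF h(1)] by metis
    then have 2: "card S2 < card S" using b(1,5) h(3) by (intro psubset_card_mono) auto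
    have "\<not> R x w \<or> \<not> R w y" using assms(5) less.prems w by blast
    then show ?thesis
    proof
      assume "\<not> R x w"
      from less.hyps[OF 1 h(1) less.prems(2) w(2) this] show ?thesis using h(5) by blast
    next
      assume "\<not> R w y"
      from less.hyps[OF 2 h(2) w(2) less.prems(3) this] show ?thesis using h(5) by blast
    qed
  qed
qed

lemma first_hit:
  assumes "ipath x y S P" "S \<inter> W \<noteq> {}"
  shows "\<exists>w S1 P1 S2 P2. ipath x w S1 P1 \<and> ipath w y S2 P2 \<and> S = S1 \<union> S2 \<and> S1 \<inter> S2 = {w}
    \<and> P = P1 \<union> P2 \<and> S1 \<inter> W = {w}"
  using assms
proof (induction rule: ipath.induct)
  case (Nil x)
  then show ?case using ipath.Nil[of x]
    by (intro exI[of _ x] exI[of _ "{x}"] exI[of _ "{}"] exI[of _ "{x}"] exI[of _ "{}"]) auto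
next
  case (Cons e x y S z P)
  have x: "ipath x x {x} {}" using Cons.hyps ends_subset[of e] by (auto intro: ipath.Nil)
  show ?case
  proof (cases "x \<in> W")
    case True
    then show ?thesis using x ipath.Cons[OF Cons.hyps(1-4)]
      by (intro exI[of _ x] exI[of _ "{x}"] exI[of _ "{}"] exI[of _ "insert x S"] exI[of _ "insert e P"]) auto
  next
    case False
    then obtain w S1 P1 S2 P2 where h: "ipath y w S1 P1" "ipath w z S2 P2" "S = S1 \<union> S2" "S1 \<inter> S2 = {w}"
      "P = P1 \<union> P2" "S1 \<inter> W = {w}" using Cons.IH Cons.prems by blast
    have "ipath x w (insert x S1) (insert e P1)" using ipath.Cons[OF Cons.hyps(1,2) _ h(1)] Cons.hyps(3) h(3) by blast
    moreover have "insert x S = insert x S1 \<union> S2" "insert e P = insert e P1 \<union> P2" using h(3,5) by auto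
    moreover have "insert x S1 \<inter> S2 = {w}" using h(4) Cons.hyps(3) unfolding h(3) by auto
    moreover have "insert x S1 \<inter> W = {w}" using h(6) False by auto
    ultimately show ?thesis using h(2) by blast
  qed
qed

lemma ipath_of_lists:
  assumes "distinct vs" "length vs = length es + 1" "set vs \<subseteq> V" "set es \<subseteq> E"
    "\<forall>i<length es. en (es ! i) = {vs ! i, vs ! Suc i}"
  shows "ipath (hd vs) (last vs) (set vs) (set es)"
  using assms
proof (induction es arbitrary: vs)
  case Nil
  then obtain a where "vs = [a]" by (metis One_nat_def add_0 length_0_conv length_Suc_conv list.size(3))
  then show ?case using Nil ipath.Nil[of a] by simp
next
  case (Cons e es)
  then obtain a vs' where vs: "vs = a # vs'" "length vs' = length es + 1" by (cases vs) auto
  then obtain b vs'' where vs': "vs' = b # vs''" by (cases vs') auto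
  have "\<forall>i<length es. en (es ! i) = {vs' ! i, vs' ! Suc i}"
    using Cons.prems(5) vs by (metis length_Cons not_less_eq nth_Cons_Suc)
  then have "ipath (hd vs') (last vs') (set vs') (set es)" using Cons vs by auto
  moreover have "en e = {a, b}" using Cons.prems(5) vs vs' by force
  ultimately show ?case using ipath.Cons[of e a b "set vs'" "last vs'" "set es"] Cons.prems vs vs' by auto
qed

lemma lists_of_ipath:
  assumes "ipath x y S P"
  shows "\<exists>vs es. distinct vs \<and> length vs = length es + 1 \<and> hd vs = x \<and> last vs = y \<and> set vs = S \<and> set es = P \<and>
     (\<forall>i<length es. en (es ! i) = {vs ! i, vs ! Suc i})"
  using assms
proof (induction rule: ipath.induct)
  case (Nil x)
  then show ?case by (intro exI[of _ "[x]"] exI[of _ "[]"]) auto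
next
  case (Cons e x y S z P)
  then obtain vs es where h: "distinct vs" "length vs = length es + 1" "hd vs = y" "last vs = z" "set vs = S"
    "set es = P" "\<forall>i<length es. en (es ! i) = {vs ! i, vs ! Suc i}" by blast
  have "vs \<noteq> []" using h by auto
  then have "en ((e # es) ! i) = {(x # vs) ! i, (x # vs) ! Suc i}" if "i < length (e # es)" for i
    using that h Cons.hyps by (cases i) (auto simp: hd_conv_nth)
  then show ?case using h Cons.hyps \<open>vs \<noteq> []\<close>
    by (intro exI[of _ "x # vs"] exI[of _ "e # es"]) auto
qed

lemma path_between_iff: "path_between G u v P \<longleftrightarrow> (\<exists>S. ipath u v S P)"
proof
  assume "path_between G u v P"
  then show "\<exists>S. ipath u v S P" unfolding path_between_def using ipath_of_lists by blast
next
  assume "\<exists>S. ipath u v S P"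
  then obtain S where S: "ipath u v S P" by blast
  from lists_of_ipath[OF S] ipath_basic(3,4)[OF S] show "path_between G u v P"
    unfolding path_between_def by blast
qed

lemma con_left: "con X v a \<Longrightarrow> con X v w \<longleftrightarrow> con X a w"
  using con_sym con_trans by blast

section \<open>Components and cycle counting\<close>

definition comp :: "'e set \<Rightarrow> 'v \<Rightarrow> 'v set" where
  "comp X v = {w \<in> V. con X v w}"

text \<open>Vertices that meet no edge of \<open>X\<close> count as components of their own, so that
  \<open>card V - card (comps X)\<close> is the rank of \<open>X\<close> in the cycle
  matroid.\<close>

definition comps :: "'e set \<Rightarrow> 'v set set" where
  "comps X = comp X ` V"

lemma finite_comps: "finite (comps X)"
  by (simp add: comps_def finite_V)

lemma comp_eq_iff:
  assumes "v \<in> V" "w \<in> V"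
  shows "comp X v = comp X w \<longleftrightarrow> con X v w"
proof
  assume "comp X v = comp X w"
  then have "w \<in> comp X v" using assms by (simp add: comp_def)
  then show "con X v w" by (simp add: comp_def)
next
  assume "con X v w"
  then show "comp X v = comp X w" unfolding comp_def using con_sym con_trans by blast
qed

lemma comps_cong: "(\<And>v w. con X v w \<longleftrightarrow> con Y v w) \<Longrightarrow> comps X = comps Y"
  by (simp add: comps_def comp_def)

lemma comp_insert:
  assumes "en e = {a, b}" "\<not> con X a b"
  shows "comp (insert e X) v = (if con X v a \<or> con X v b then comp X a \<union> comp X b else comp X v)"
proof -
  consider "con X v a" "\<not> con X v b" | "con X v b" "\<not> con X v a" | "\<not> con X v a" "\<not> con X v b"
    using con_left[of X v a b] assms(2) by metis
  then show ?thesis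
  proof cases
    case 1
    then show ?thesis unfolding comp_def con_insert[OF assms(1), of X v] con_left[OF 1(1)] by auto
  next
    case 2
    then show ?thesis unfolding comp_def con_insert[OF assms(1), of X v] con_left[OF 2(1)] by auto
  next
    case 3
    then show ?thesis unfolding comp_def con_insert[OF assms(1), of X v] by auto
  qed
qed

lemma comps_insert:
  assumes "e \<in> E" "en e = {a, b}" "\<not> con X a b"
  shows "comps (insert e X) = insert (comp X a \<union> comp X b) (comps X - {comp X a, comp X b})"
proof -
  have ab: "a \<in> V" "b \<in> V" using ends_subset[OF assms(1)] assms(2) by auto
  show ?thesis
  proof (intro set_eqI iffI)
    fix K assume "K \<in> comps (insert e X)"
    then obtain v where "v \<in> V" "K = comp (insert e X) v" by (auto simp: comps_def)
    then show "K \<in> insert (comp X a \<union> comp X b) (comps X - {comp X a, comp X b})"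
      using comp_insert[OF assms(2,3)] comp_eq_iff ab unfolding comps_def by auto
  next
    fix K assume K: "K \<in> insert (comp X a \<union> comp X b) (comps X - {comp X a, comp X b})"
    show "K \<in> comps (insert e X)"
    proof (cases "K = comp X a \<union> comp X b")
      case True then show ?thesis using comp_insert[OF assms(2,3), of a] ab by (auto simp: comps_def)
    next
      case False
      with K obtain v where v: "v \<in> V" "K = comp X v" "K \<noteq> comp X a" "K \<noteq> comp X b" by (auto simp: comps_def)
      then show ?thesis using comp_insert[OF assms(2,3), of v] comp_eq_iff ab by (auto simp: comps_def)
    qed
  qed
qed

lemma comp_Un_notin:
  assumes "a \<in> V" "b \<in> V" "\<not> con X a b"
  shows "comp X a \<union> comp X b \<notin> comps X"
proof
  assume "comp X a \<union> comp X b \<in> comps X"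
  then obtain v where "v \<in> V" "comp X a \<union> comp X b = comp X v" by (auto simp: comps_def)
  moreover have "a \<in> comp X a" "b \<in> comp X b" using assms by (auto simp: comp_def)
  ultimately have "a \<in> comp X v" "b \<in> comp X v" by blast+
  then have "con X v a" "con X v b" by (simp_all add: comp_def)
  then show False using assms(3) con_left[of X v a b] by simp
qed

lemma comp_mem_comps: "a \<in> V \<Longrightarrow> comp X a \<in> comps X"
  by (simp add: comps_def)

lemma card_comps_insert:
  assumes "e \<in> E" "en e = {a, b}" "\<not> con X a b"
  shows "card (comps X) = Suc (card (comps (insert e X)))"
proof -
  have ab: "a \<in> V" "b \<in> V" using ends_subset[OF assms(1)] assms(2) by auto
  have ne: "comp X a \<noteq> comp X b" using comp_eq_iff[OF ab] assms(3) by simp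
  have "{comp X a, comp X b} \<subseteq> comps X" using ab by (simp add: comp_mem_comps)
  then have "card (comps X) \<ge> 2" using card_mono[OF finite_comps, of "{comp X a, comp X b}" X] ne by simp
  moreover have "card (comps X - {comp X a, comp X b}) = card (comps X) - 2"
    using \<open>_ \<subseteq> comps X\<close> ne by (simp add: card_Diff_subset)
  ultimately show ?thesis
    unfolding comps_insert[OF assms] using comp_Un_notin[OF ab assms(3)] finite_comps by simp
qed

lemma comps_insert_redundant:
  assumes "en e = {a, b}" "con X a b"
  shows "comps (insert e X) = comps X"
  by (rule comps_cong) (rule con_insert_redundant[OF assms])

lemma comps_remove_cycle_edge:
  assumes "C \<in> cycles" "e \<in> C" "C \<subseteq> X"
  shows "comps (X - {e}) = comps X"
proof -
  have "e \<in> E" using cycleD(1)[OF assms(1)] assms(2) by blast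
  then obtain x y where xy: "en e = {x, y}" by (rule obtain_ends)
  have "con (X - {e}) x y" using cycle_minus_edge[OF assms(1,2) xy] by (rule con_mono) (use assms(3) in blast)
  from comps_insert_redundant[OF xy this] show ?thesis using assms by (simp add: insert_absorb subsetD)
qed

lemma comps_empty: "card (comps {}) = card V"
proof -
  have "con {} v w \<longleftrightarrow> v = w" for v w using con_eq_or_span[of "{}" v w] by (auto simp: span_verts_def)
  then have "comps {} = (\<lambda>v. {v}) ` V" by (auto simp: comps_def comp_def)
  then show ?thesis by (simp add: card_image)
qed

text \<open>Each added edge merges at most two components; in other words, the cyclomatic number is
  nonnegative.\<close>

lemma card_comps_lower: "X \<subseteq> E \<Longrightarrow> card V \<le> card (comps X) + card X"
proof (induction X rule: infinite_finite_induct)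
  case (infinite X) then show ?case using finite_edges by blast
next
  case empty then show ?case by (simp add: comps_empty)
next
  case (insert e X)
  have eE: "e \<in> E" using insert by blast
  obtain a b where "en e = {a, b}" using obtain_ends[OF eE] .
  then have "card (comps X) \<le> Suc (card (comps (insert e X)))"
    using comps_insert_redundant card_comps_insert[OF eE] by (cases "con X a b") auto
  then show ?case using insert by simp
qed

text \<open>Removing \<open>e\<close> from \<open>C\<close> and then an edge from \<open>D\<close>,
  which avoids \<open>e\<close>, changes no component: the cyclomatic number is at least 2. This
  count later shows that every circuit other than a cycle of \<open>B\<close> is dependent.\<close>

lemma two_cycles_excess:
  assumes "X \<subseteq> E" "C \<in> cycles" "e \<in> C" "C \<subseteq> X" "D \<in> cycles" "e \<notin> D" "D \<subseteq> X"
  shows "card V + 2 \<le> card (comps X) + card X"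
proof -
  obtain f where f: "f \<in> D" using cycleD(2)[OF assms(5)] by blast
  have fe: "f \<noteq> e" "f \<in> X" "e \<in> X" using f assms by auto
  have "comps (X - {e} - {f}) = comps X"
    using comps_remove_cycle_edge[OF assms(2,3,4)] comps_remove_cycle_edge[OF assms(5) f, of "X - {e}"] assms(6,7)
    by blast
  moreover have "card X = card (X - {e} - {f}) + 2"
    using fe finite_edges[OF assms(1)] card.remove[of X e] card.remove[of "X - {e}" f] by simp
  ultimately show ?thesis using card_comps_lower[of "X - {e} - {f}"] assms(1) by auto
qed

lemma cycle_excess:
  assumes "X \<subseteq> E" "C \<in> cycles" "C \<subseteq> X"
  shows "card V + 1 \<le> card (comps X) + card X"
proof -
  obtain e where e: "e \<in> C" using cycleD(2)[OF assms(2)] by blast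
  have "card X = card (X - {e}) + 1"
    using e assms finite_edges[OF assms(1)] by (metis Suc_eq_plus1 card.remove subsetD)
  then show ?thesis using card_comps_lower[of "X - {e}"] comps_remove_cycle_edge[OF assms(2) e assms(3)] assms(1) by auto
qed

lemma comps_connected:
  assumes "W \<subseteq> V" "W \<noteq> {}" "sp X \<subseteq> W" "\<And>x y. x \<in> W \<Longrightarrow> y \<in> W \<Longrightarrow> con X x y"
  shows "comps X = insert W ((\<lambda>v. {v}) ` (V - W))" "card (comps X) = card V - card W + 1"
proof -
  have "comp X v = (if v \<in> W then W else {v})" if "v \<in> V" for v
    using con_eq_or_span[of X v] assms that unfolding comp_def by auto
  then show *: "comps X = insert W ((\<lambda>v. {v}) ` (V - W))" using assms(1,2) unfolding comps_def by auto
  have "card ((\<lambda>v. {v}) ` (V - W)) = card V - card W"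
    using assms(1) finite_V by (simp add: card_image card_Diff_subset finite_subset)
  moreover have "W \<notin> (\<lambda>v. {v}) ` (V - W)" by auto
  ultimately show "card (comps X) = card V - card W + 1" unfolding * using finite_V by simp
qed

section \<open>Theta subgraphs\<close>

definition theta3 :: "'v \<Rightarrow> 'v \<Rightarrow> 'e set \<Rightarrow> 'e set \<Rightarrow> 'e set \<Rightarrow> bool" where
  "theta3 u v P Q R \<longleftrightarrow> u \<noteq> v \<and> (\<exists>S1 S2 S3. ipath u v S1 P \<and> ipath u v S2 Q \<and> ipath u v S3 R \<and>
     P \<inter> Q = {} \<and> P \<inter> R = {} \<and> Q \<inter> R = {} \<and> S1 \<inter> S2 = {u, v} \<and> S1 \<inter> S3 = {u, v} \<and> S2 \<inter> S3 = {u, v})"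

lemma is_theta_iff: "is_theta G T \<longleftrightarrow> (\<exists>u v P Q R. theta3 u v P Q R \<and> T = P \<union> Q \<union> R)"
proof
  assume "is_theta G T"
  then obtain u v P Q R S1 S2 S3 where h: "u \<noteq> v" "ipath u v S1 P" "ipath u v S2 Q" "ipath u v S3 R"
    "P \<inter> Q = {}" "P \<inter> R = {}" "Q \<inter> R = {}" "sp P \<inter> sp Q = {u, v}" "sp P \<inter> sp R = {u, v}"
    "sp Q \<inter> sp R = {u, v}" "T = P \<union> Q \<union> R"
    unfolding is_theta_def path_between_iff by blast
  then have "theta3 u v P Q R"
    unfolding theta3_def ipath_span[OF h(2,1)] ipath_span[OF h(3,1)] ipath_span[OF h(4,1)] by blast
  then show "\<exists>u v P Q R. theta3 u v P Q R \<and> T = P \<union> Q \<union> R" using h by blast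
next
  assume "\<exists>u v P Q R. theta3 u v P Q R \<and> T = P \<union> Q \<union> R"
  then obtain u v P Q R S1 S2 S3 where h: "u \<noteq> v" "ipath u v S1 P" "ipath u v S2 Q" "ipath u v S3 R"
    "P \<inter> Q = {}" "P \<inter> R = {}" "Q \<inter> R = {}" "S1 \<inter> S2 = {u, v}" "S1 \<inter> S3 = {u, v}"
    "S2 \<inter> S3 = {u, v}" "T = P \<union> Q \<union> R"
    unfolding theta3_def by blast
  note s = ipath_span[OF h(2,1)] ipath_span[OF h(3,1)] ipath_span[OF h(4,1)]
  show "is_theta G T"
    unfolding is_theta_def path_between_iff
    by (rule exI[of _ u], rule exI[of _ v], rule exI[of _ P], rule exI[of _ Q], rule exI[of _ R])
      (use h s in \<open>auto intro: exI[of _ S1] exI[of _ S2] exI[of _ S3]\<close>)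
qed

lemma theta3_swap12: "theta3 u v P Q R \<Longrightarrow> theta3 u v Q P R"
  and theta3_swap23: "theta3 u v P Q R \<Longrightarrow> theta3 u v P R Q"
  unfolding theta3_def by (metis Int_commute)+

lemma theta3_cycle:
  assumes "theta3 u v P Q R" shows "P \<union> Q \<in> cycles" "P \<union> R \<in> cycles" "Q \<union> R \<in> cycles"
  using assms two_paths_cycle(1) unfolding theta3_def by blast+

text \<open>A theta has cyclomatic number 2. A cycle missing an edge on each of two of the paths
  would permit three successive deletions that keep all components, one too many. Otherwise the
  cycle contains two whole paths and equals their union.\<close>

lemma theta3_only_cycles:
  assumes T: "theta3 u v P Q R" and D: "D \<in> cycles" "D \<subseteq> P \<union> Q \<union> R"
  shows "D = P \<union> Q \<or> D = P \<union> R \<or> D = Q \<union> R"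
proof -
  have key: False if T: "theta3 u v P Q R" and D: "D \<in> cycles" "D \<subseteq> P \<union> Q \<union> R"
    and p: "p \<in> P" "p \<notin> D" and q: "q \<in> Q" "q \<notin> D" for p q P Q R
  proof -
    obtain S1 S2 S3 where h: "u \<noteq> v" "ipath u v S1 P" "ipath u v S2 Q" "ipath u v S3 R"
      "P \<inter> Q = {}" "P \<inter> R = {}" "Q \<inter> R = {}" "S1 \<inter> S2 = {u, v}" "S1 \<inter> S3 = {u, v}" "S2 \<inter> S3 = {u, v}"
      using T unfolding theta3_def by blast
    note b = ipath_basic[OF h(2)] ipath_basic[OF h(3)] ipath_basic[OF h(4)]
    define X where "X = P \<union> Q \<union> R"
    define S where "S = S1 \<union> S2 \<union> S3"
    have XE: "X \<subseteq> E" using b by (simp add: X_def)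
    have sV: "S \<subseteq> V" using b by (simp add: S_def)
    have conX: "con X u w" if "w \<in> S" for w
      using that ipath_con[OF h(2) b(1)] ipath_con[OF h(3) b(12)] ipath_con[OF h(4) b(23)] con_mono
      unfolding S_def X_def by (metis UnE sup_ge1 sup_ge2 le_supI1)
    have cS: "card (comps X) = card V - card S + 1"
    proof (rule comps_connected(2))
      show "sp X \<subseteq> S" unfolding X_def S_def sp_Un using ipath_span_subset h(2-4) by blast
      show "con X x y" if "x \<in> S" "y \<in> S" for x y using conX[OF that(1)] conX[OF that(2)] con_sym con_trans by blast
      show "S \<noteq> {}" using b by (auto simp: S_def)
    qed (rule sV)
    have cX: "card X = card P + card Q + card R"
      unfolding X_def using h b by (simp add: card_Un_disjoint Int_Un_distrib2)
    have "card (S1 \<union> S2) + card {u, v} = card S1 + card S2" using card_Un_Int[OF b(5) b(16)] h(8) by simp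
    moreover have "card S + card ((S1 \<union> S2) \<inter> S3) = card (S1 \<union> S2) + card S3"
      unfolding S_def using card_Un_Int[of "S1 \<union> S2" S3] b by simp
    moreover have "(S1 \<union> S2) \<inter> S3 = {u, v}" using h by blast
    ultimately have cS2: "card S + 1 = card X" using cX h(1) b(9) b(20) b(31) by simp
    have CD: "P \<union> Q \<in> cycles" "Q \<union> R \<in> cycles" using theta3_cycle[OF T] by auto
    obtain f where f: "f \<in> D" using cycleD(2)[OF D(1)] by blast
    have pq: "p \<noteq> q" "p \<notin> Q \<union> R" using p q h(5,6) by auto
    \<comment> \<open>The order matters: \<open>p\<close> lies on \<open>P \<union> Q\<close>, then
      \<open>q\<close> on \<open>Q \<union> R\<close>, which avoids \<open>p\<close>, then
      \<open>f\<close> on \<open>D\<close>, which avoids both.\<close>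
    have 1: "comps (X - {p}) = comps X"
      by (rule comps_remove_cycle_edge[OF CD(1)]) (use p in \<open>auto simp: X_def\<close>)
    have 2: "comps (X - {p} - {q}) = comps (X - {p})"
      by (rule comps_remove_cycle_edge[OF CD(2)]) (use q pq in \<open>auto simp: X_def\<close>)
    have 3: "comps (X - {p} - {q} - {f}) = comps (X - {p} - {q})"
      by (rule comps_remove_cycle_edge[OF D(1) f]) (use D(2) p q in \<open>auto simp: X_def\<close>)
    have "p \<noteq> f" "q \<noteq> f" using p q f by auto
    then have "{p, q, f} \<subseteq> X" "card {p, q, f} = 3" using p q f D(2) pq by (auto simp: X_def)
    moreover have "X - {p} - {q} - {f} = X - {p, q, f}" by auto
    ultimately have "card (X - {p} - {q} - {f}) = card X - 3" "3 \<le> card X"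
      using finite_edges[OF XE] card_Diff_subset[of "{p, q, f}" X] card_mono[of X "{p, q, f}"] by simp_all
    moreover have "card S \<le> card V" using sV finite_V by (rule card_mono[rotated])
    moreover have "card V \<le> card (comps (X - {p} - {q} - {f})) + card (X - {p} - {q} - {f})"
      by (rule card_comps_lower) (use XE in auto)
    ultimately show False using cS cS2 1 2 3 by simp
  qed
  have sub: "D = C" if "C \<in> cycles" "C \<subseteq> D" for C using cycle_antichain[OF that(1) D(1) that(2)] by simp
  consider "P \<union> Q \<subseteq> D" | "P \<union> R \<subseteq> D" | "Q \<union> R \<subseteq> D" | p q where "p \<in> P" "p \<notin> D" "q \<in> Q" "q \<notin> D"
    | p q where "p \<in> P" "p \<notin> D" "q \<in> R" "q \<notin> D" | p q where "p \<in> Q" "p \<notin> D" "q \<in> R" "q \<notin> D" by blast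
  then show ?thesis
  proof cases
    case 4 then show ?thesis using key[OF T D] by blast
  next
    case 5 then show ?thesis using key[OF theta3_swap23[OF T] D(1), of p q] D(2) by blast
  next
    case 6 then show ?thesis using key[OF theta3_swap23[OF theta3_swap12[OF T]] D(1), of p q] D(2) by blast
  qed (use sub theta3_cycle[OF T] in blast)+
qed

text \<open>From \<open>e\<close>, follow \<open>D\<close> in both directions until it first meets
  \<open>C\<close>. This is an ear on \<open>C\<close>, and a cycle with an ear is a theta.\<close>

lemma two_cycles_theta:
  assumes C: "C \<in> cycles" and D: "D \<in> cycles" and e: "e \<in> D" "e \<notin> C"
    and pq: "p \<noteq> q" "{p, q} \<subseteq> sp C \<inter> sp D"
  obtains T where "is_theta G T" "T \<subseteq> C \<union> D"
proof -
  have eE: "e \<in> E" using cycleD(1)[OF D] e by blast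
  obtain x y where xy: "en e = {x, y}" using obtain_ends[OF eE] .
  have nl: "en g \<noteq> {z}" if "g \<in> D" for g z
  proof
    assume "en g = {z}"
    then have "sp D = {z}" using cycle_loop[OF D that] by (auto simp: span_verts_def)
    then show False using pq by auto
  qed
  have "x \<noteq> y" using nl[OF e(1), of x] xy by auto
  then have P: "ipath x y (sp D) (D - {e})" using cycle_path[OF D e(1) xy] by simp
  obtain w S1 P1 S2 P2 where h: "ipath x w S1 P1" "ipath w y S2 P2" "sp D = S1 \<union> S2" "S1 \<inter> S2 = {w}"
    "D - {e} = P1 \<union> P2" "S1 \<inter> sp C = {w}"
  proof -
    have "sp D \<inter> sp C \<noteq> {}" using pq by auto
    then show ?thesis using first_hit[OF P, of "sp C"] that by metis
  qed
  have "w \<in> S2 \<inter> sp C" using h by blast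
  then obtain z S3 P3 S4 P4 where k: "ipath y z S3 P3" "ipath z w S4 P4" "S2 = S3 \<union> S4" "S3 \<inter> S4 = {z}"
    "P2 = P3 \<union> P4" "S3 \<inter> sp C = {z}" using first_hit[OF ipath_rev[OF h(2)], of "sp C"] by blast
  \<comment> \<open>If both directions reached \<open>C\<close> at the same vertex, \<open>D\<close>
    would meet \<open>C\<close> only there, against the two common vertices \<open>p\<close> and
    \<open>q\<close>.\<close>
  have zw: "z \<noteq> w"
  proof
    assume "z = w"
    then have "S4 = {w}" using ipath_basic(10,11)[OF k(2)] by simp
    then have "S2 = S3" using k(3) ipath_basic(2)[OF k(1)] \<open>z = w\<close> by auto
    then have "sp D \<inter> sp C = {w}" using k(6) h(6) \<open>z = w\<close> unfolding h(3) by (simp add: Int_Un_distrib2)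
    then show False using pq Int_singletonD by (metis Int_iff insert_subset)
  qed
  have wS3: "w \<notin> S3" using Int_singletonD[OF k(6)] zw h(6) by (metis Int_iff insertI1)
  then have dis: "S1 \<inter> S3 = {}" using h(4) unfolding k(3) by auto
  define S where "S = S1 \<union> insert x S3"
  have xS1: "x \<in> S1" using ipath_basic(1)[OF h(1)] .
  have "ipath x z (insert x S3) (insert e P3)" using ipath.Cons[OF eE xy _ k(1)] dis xS1 by blast
  moreover have "S1 \<inter> insert x S3 = {x}" using dis xS1 by auto
  ultimately have Q: "ipath w z S (P1 \<union> insert e P3)" using ipath_append[OF ipath_rev[OF h(1)]] unfolding S_def by blast
  have SC: "S \<inter> sp C = {w, z}" using h(6) k(6) xS1 unfolding S_def by auto
  have "g \<notin> C" if "g \<in> P1 \<union> P3" for g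
  proof
    assume g: "g \<in> C"
    have gD: "g \<in> D" using that h(5) k(5) by blast
    then have gE: "g \<in> E" using cycleD(1)[OF D] by blast
    have "en g \<subseteq> sp C" using g by (auto simp: sp_iff)
    moreover have "en g \<subseteq> S1 \<or> en g \<subseteq> S3" using that ipath_basic(7)[OF h(1)] ipath_basic(7)[OF k(1)] by blast
    ultimately have "en g \<subseteq> {w} \<or> en g \<subseteq> {z}" using h(6) k(6) by blast
    then show False using nl[OF gD] ends_nonempty[OF gE] by blast
  qed
  then have QC: "(P1 \<union> insert e P3) \<inter> C = {}" using e by auto
  have wz: "w \<in> sp C" "z \<in> sp C" using SC by auto
  obtain A1 Q1 A2 Q2 where c: "ipath w z A1 Q1" "ipath w z A2 Q2" "A1 \<inter> A2 = {w, z}" "Q1 \<inter> Q2 = {}"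
    "C = Q1 \<union> Q2" "sp C = A1 \<union> A2" using cycle_split[OF C wz] zw by metis
  have "w \<in> A1" "z \<in> A1" "w \<in> A2" "z \<in> A2" using c(3) by auto
  then have "A1 \<inter> S = {w, z}" "A2 \<inter> S = {w, z}" using SC unfolding c(6) by auto
  have "theta3 w z Q1 Q2 (P1 \<union> insert e P3)"
    unfolding theta3_def
  proof (intro conjI exI)
    show "ipath w z A1 Q1" "ipath w z A2 Q2" "ipath w z S (P1 \<union> insert e P3)" using c Q by auto
    show "Q1 \<inter> (P1 \<union> insert e P3) = {}" "Q2 \<inter> (P1 \<union> insert e P3) = {}" using QC unfolding c(5) by auto
  qed (use c zw \<open>A1 \<inter> S = {w, z}\<close> \<open>A2 \<inter> S = {w, z}\<close> in auto)
  then have "is_theta G (Q1 \<union> Q2 \<union> (P1 \<union> insert e P3))" unfolding is_theta_iff by blast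
  moreover have "Q1 \<union> Q2 \<union> (P1 \<union> insert e P3) \<subseteq> C \<union> D" using c(5) h(5) k(5) e by blast
  ultimately show ?thesis using that by blast
qed

end

section \<open>Balance in quasi-biased graphs\<close>

locale qbgraph = mgraph G for G :: "('v, 'e) multigraph" +
  fixes B L F :: "'e set set"
  assumes quasi: "quasi_biased_graph G B L F"
begin

lemma classes: "B \<union> L \<union> F = cycles" "B \<inter> L = {}" "B \<inter> F = {}" "L \<inter> F = {}"
  and theta_B: "is_theta G T \<Longrightarrow> card {C \<in> B. C \<subseteq> T} \<noteq> 2"
  and LF_meet: "C \<in> L \<Longrightarrow> D \<in> F \<Longrightarrow> sp C \<inter> sp D \<noteq> {}"
  using quasi by (auto simp: quasi_biased_graph_def vertex_disjoint_def)

text \<open>The theta condition in its closure form. Since it counts members of \<open>B\<close>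
  inside an edge set, it must be known that a theta has no further cycles and that the two given
  ones differ.\<close>

lemma theta3_B:
  assumes T: "theta3 u v P Q R" and "P \<union> Q \<in> B" "P \<union> R \<in> B" shows "Q \<union> R \<in> B"
proof (rule ccontr)
  assume n: "Q \<union> R \<notin> B"
  let ?T = "P \<union> Q \<union> R"
  have "{C \<in> B. C \<subseteq> ?T} = {P \<union> Q, P \<union> R}"
    using theta3_only_cycles[OF T] n assms(2,3) classes(1) by blast
  moreover have "P \<union> Q \<noteq> P \<union> R"
  proof
    assume "P \<union> Q = P \<union> R"
    then have "Q = {}" using T unfolding theta3_def by blast
    then show False using T ipath_basic(10) unfolding theta3_def by blast
  qed
  moreover have "is_theta G ?T" unfolding is_theta_iff using T by metis
  ultimately show False using theta_B[of ?T] by simp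
qed

definition bal :: "'e set \<Rightarrow> bool" where
  "bal X \<longleftrightarrow> (\<forall>C\<in>cycles. C \<subseteq> X \<longrightarrow> C \<in> B)"

lemma bal_mono: "bal Y \<Longrightarrow> X \<subseteq> Y \<Longrightarrow> bal X"
  unfolding bal_def by blast

text \<open>If \<open>C\<close> uses both \<open>e\<close> and \<open>f\<close>, removing them
  leaves two pieces of \<open>C\<close>, and a path in \<open>X\<close> between the ends of
  \<open>e\<close> contains an ear that joins the pieces. In the resulting theta each of the other
  two cycles uses just one of \<open>e\<close>, \<open>f\<close>, so both are in \<open>B\<close>,
  and hence so is \<open>C\<close>.\<close>

lemma bal_insert2:
  assumes X: "X \<subseteq> E" and be: "bal (insert e X)" and bf: "bal (insert f X)"
    and C: "C \<in> cycles" "C \<subseteq> insert e (insert f X)"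
    and con: "\<And>x y. en e = {x, y} \<Longrightarrow> con X x y"
  shows "C \<in> B"
proof (cases "e \<in> C \<and> f \<in> C \<and> e \<noteq> f \<and> e \<notin> X \<and> f \<notin> X")
  case False
  then have "C \<subseteq> insert e X \<or> C \<subseteq> insert f X" using C(2) by blast
  then show ?thesis using be bf C(1) unfolding bal_def by blast
next
  case True
  then have ef: "e \<in> C" "f \<in> C" "e \<noteq> f" "e \<notin> X" "f \<notin> X" by auto
  have CE: "C \<subseteq> E" using cycleD(1)[OF C(1)] .
  then have eE: "e \<in> E" "f \<in> E" using ef by auto
  obtain x y where xy: "en e = {x, y}" "x \<in> V" using obtain_ends[OF eE(1)] .
  define R where "R p q = con (C - {e, f}) p q" for p q
  have "\<not> R x y"
  proof
    assume "R x y"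
    moreover have "C - {e, f} \<subseteq> E" using CE by blast
    ultimately obtain D where D: "D \<in> cycles" "D \<subseteq> insert e (C - {e, f})"
      using con_cycle[of "C - {e, f}" e x y] eE(1) xy(1) unfolding R_def by blast
    then show False using cycle_antichain[OF D(1) C(1)] ef by blast
  qed
  moreover obtain S P where P: "ipath x y S P" "P \<subseteq> X" using con_ipath[OF con[OF xy(1)] X xy(2)] .
  moreover have "x \<in> sp C" "y \<in> sp C" using ef xy by (auto simp: sp_iff)
  ultimately obtain p q S' Q where Q: "ipath p q S' Q" "Q \<subseteq> P" "S' \<inter> sp C = {p, q}" "\<not> R p q"
    using ear[OF P(1), of "sp C" R] con_trans unfolding R_def by blast
  have pq: "p \<noteq> q" "p \<in> sp C" "q \<in> sp C" using Q by (auto simp: R_def)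
  \<comment> \<open>An edge shared with \<open>C\<close> would join \<open>p\<close> to
    \<open>q\<close> inside \<open>C - {e, f}\<close>, contrary to the choice of the ear.\<close>
  have QC: "g \<notin> C" if g: "g \<in> Q" for g
  proof
    assume gC: "g \<in> C"
    have gE: "g \<in> E" using gC CE by blast
    have gef: "g \<noteq> e" "g \<noteq> f" using g Q(2) P(2) ef by auto
    have "en g \<subseteq> S' \<inter> sp C" using gC ipath_basic(7)[OF Q(1) g] by (auto simp: sp_iff)
    then have "en g \<subseteq> {p, q}" unfolding Q(3) .
    moreover have "en g \<noteq> {z}" for z using cycle_loop[OF C(1) gC, of z] ef gef by auto
    ultimately have "en g = {p, q}" using ends_nonempty[OF gE] by blast
    then have "R p q" unfolding R_def using con_edge[of g "C - {e, f}"] gC gef by blast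
    then show False using Q(4) by blast
  qed
  obtain A1 Q1 A2 Q2 where c: "ipath p q A1 Q1" "ipath p q A2 Q2" "A1 \<inter> A2 = {p, q}" "Q1 \<inter> Q2 = {}"
    "C = Q1 \<union> Q2" "sp C = A1 \<union> A2" using cycle_split[OF C(1) pq(2,3,1)] .
  have "p \<in> A1" "q \<in> A1" "p \<in> A2" "q \<in> A2" using c(3) by auto
  then have "A1 \<inter> S' = {p, q}" "A2 \<inter> S' = {p, q}" using Q(3) c(6) by auto
  moreover have "Q1 \<inter> Q = {}" "Q2 \<inter> Q = {}" using QC c(5) by auto
  ultimately have T: "theta3 p q Q Q1 Q2"
    unfolding theta3_def using c Q(1) pq(1) by (metis Int_commute)
  have "\<not> {e, f} \<inter> Q1 = {}" "\<not> {e, f} \<inter> Q2 = {}"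
  proof -
    have "con Q1 p q" "con Q2 p q" using ipath_con[OF c(1)] ipath_con[OF c(2)] c(3) by blast+
    then have "Q1 \<subseteq> C - {e, f} \<Longrightarrow> R p q" "Q2 \<subseteq> C - {e, f} \<Longrightarrow> R p q" unfolding R_def using con_mono by blast+
    then show "\<not> {e, f} \<inter> Q1 = {}" "\<not> {e, f} \<inter> Q2 = {}" using Q(4) c(5) by blast+
  qed
  then have "Q \<union> Q1 \<subseteq> insert e X \<and> Q \<union> Q2 \<subseteq> insert f X \<or> Q \<union> Q1 \<subseteq> insert f X \<and> Q \<union> Q2 \<subseteq> insert e X"
    using c(4,5) C(2) Q(2) P(2) by blast
  then have "Q \<union> Q1 \<in> B" "Q \<union> Q2 \<in> B"
    using be bf theta3_cycle[OF T] unfolding bal_def by blast+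
  then show ?thesis using theta3_B[OF T] c(5) by simp
qed

text \<open>The number of common vertices decides. With none, the cycles have the same class,
  because \<open>L\<close>-cycles meet \<open>F\<close>-cycles, and give an \<open>L\<close>-pair or
  loose handcuffs; with one, tight handcuffs; with more, a theta, which is a circuit unless it
  contains a member of \<open>B\<close>, itself a circuit.\<close>

lemma connected_cycles_contain_circuit:
  assumes "X \<subseteq> E" "C \<in> cycles" "D \<in> cycles" "C \<notin> B" "D \<notin> B" "C \<noteq> D" "C \<subseteq> X" "D \<subseteq> X"
    "p \<in> sp C" "q \<in> sp D" "con X p q"
  shows "\<exists>K\<in>quasi_graphic_circuits G B L F. K \<subseteq> X"
proof -
  have ex: "\<exists>K\<in>quasi_graphic_circuits G B L F. K \<subseteq> X" if "K \<in> quasi_graphic_circuits G B L F" "K \<subseteq> X" for K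
    using that by blast
  consider "sp C \<inter> sp D = {}" | v where "sp C \<inter> sp D = {v}" | u v where "u \<noteq> v" "{u, v} \<subseteq> sp C \<inter> sp D"
    by blast
  then show ?thesis
  proof cases
    case 1
    have CD: "C \<in> L \<and> D \<in> L \<or> C \<in> F \<and> D \<in> F"
      using classes(1) assms(2-5) LF_meet 1 by (metis Int_commute UnE)
    then show ?thesis
    proof
      assume "C \<in> L \<and> D \<in> L"
      then have "C \<union> D \<in> quasi_graphic_circuits G B L F"
        using 1 unfolding quasi_graphic_circuits_def vertex_disjoint_def by blast
      then show ?thesis by (rule ex) (use assms in blast)
    next
      assume F: "C \<in> F \<and> D \<in> F"
      have "p \<in> V" using assms(9) cycleD(7)[OF assms(2)] by blast
      then obtain S P where "ipath p q S P" "P \<subseteq> X" using con_ipath[OF assms(11,1)] by blast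
      then have "\<exists>P. joining_path G C D P \<and> P \<subseteq> X"
        unfolding joining_path_def path_between_iff using assms(9,10) by blast
      \<comment> \<open>Least cardinality among the joining paths inside \<open>X\<close>; this
        yields the minimality under inclusion that loose handcuffs require.\<close>
      then obtain P where P: "joining_path G C D P \<and> P \<subseteq> X"
        and min: "\<And>Q. joining_path G C D Q \<and> Q \<subseteq> X \<Longrightarrow> card P \<le> card Q"
        using exists_least_iff[of "\<lambda>n. \<exists>P. (joining_path G C D P \<and> P \<subseteq> X) \<and> n = card P"]
        by (metis (no_types, lifting) leI)
      have "\<not> joining_path G C D Q" if "Q \<subset> P" for Q
      proof
        assume "joining_path G C D Q"
        then have "card P \<le> card Q" using min P that by blast
        moreover have "finite P" using P assms(1) finite_edges by blast
        ultimately show False using psubset_card_mono[OF _ that] by simp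
      qed
      then have "loose_handcuffs_of G C D (C \<union> D \<union> P)"
        unfolding loose_handcuffs_of_def vertex_disjoint_def using P assms(2,3) 1 by blast
      then have "C \<union> D \<union> P \<in> quasi_graphic_circuits G B L F"
        unfolding quasi_graphic_circuits_def using F by blast
      then show ?thesis by (rule ex) (use assms P in blast)
    qed
  next
    case (2 v)
    have "C \<inter> D = {}"
    proof (rule ccontr)
      assume "C \<inter> D \<noteq> {}"
      then obtain g where g: "g \<in> C" "g \<in> D" by blast
      then have "en g \<subseteq> sp C \<inter> sp D" by (auto simp: sp_iff)
      then have "en g \<subseteq> {v}" unfolding 2 .
      then have "en g = {v}" using ends_nonempty[of g] g cycleD(1)[OF assms(2)] by blast
      then show False using cycle_loop[OF assms(2) g(1)] cycle_loop[OF assms(3) g(2)] assms(6) by simp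
    qed
    then have "tight_handcuffs_of G C D (C \<union> D)"
      unfolding tight_handcuffs_of_def using 2 assms(2,3) by blast
    then have "C \<union> D \<in> quasi_graphic_circuits G B L F"
      unfolding quasi_graphic_circuits_def using assms(4,5) by blast
    then show ?thesis by (rule ex) (use assms in blast)
  next
    case (3 u v)
    obtain e where "e \<in> D" "e \<notin> C" using cycle_antichain[OF assms(3,2)] assms(6) by blast
    then obtain T where T: "is_theta G T" "T \<subseteq> C \<union> D" using two_cycles_theta[OF assms(2,3) _ _ 3] by blast
    show ?thesis
    proof (cases "\<exists>K\<in>B. K \<subseteq> T")
      case True
      then obtain K where "K \<in> B" "K \<subseteq> T" by blast
      then have "K \<in> quasi_graphic_circuits G B L F" unfolding quasi_graphic_circuits_def by simp
      then show ?thesis by (rule ex) (use \<open>K \<subseteq> T\<close> T(2) assms(7,8) in blast)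
    next
      case False
      then have "T \<in> quasi_graphic_circuits G B L F" unfolding quasi_graphic_circuits_def using T by simp
      then show ?thesis by (rule ex) (use assms T in blast)
    qed
  qed
qed

end

section \<open>The matroid of a quasi-biased graph\<close>

text \<open>Unit increase and local closure are the local form of the matroid rank axioms.
  Monotonicity and submodularity follow from them.\<close>

locale rank_function =
  fixes U :: "'e set" and r :: "'e set \<Rightarrow> nat"
  assumes finite_U: "finite U"
    and r_empty: "r {} = 0"
    and r_up: "X \<subseteq> U \<Longrightarrow> e \<in> U \<Longrightarrow> r X \<le> r (insert e X) \<and> r (insert e X) \<le> r X + 1"
    and r_local: "X \<subseteq> U \<Longrightarrow> e \<in> U \<Longrightarrow> f \<in> U \<Longrightarrow> r (insert e X) = r X \<Longrightarrow> r (insert f X) = r X \<Longrightarrow>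
      r (insert f (insert e X)) = r X"
begin

lemma finite_sub: "X \<subseteq> U \<Longrightarrow> finite X"
  using finite_U finite_subset by blast

lemma r_add_mono:
  assumes "finite Z" "Z \<subseteq> U" "X \<subseteq> U" shows "r X \<le> r (X \<union> Z)"
  using assms
proof (induction Z)
  case (insert e Z)
  then have "r (X \<union> Z) \<le> r (insert e (X \<union> Z))" using r_up[of "X \<union> Z" e] by simp
  with insert show ?case by simp
qed simp

lemma r_mono: "X \<subseteq> Y \<Longrightarrow> Y \<subseteq> U \<Longrightarrow> r X \<le> r Y"
  using r_add_mono[of Y X] finite_sub by (metis Un_absorb1 order_trans)

lemma r_dim1:
  assumes "X \<subseteq> U" "e \<in> U" "f \<in> U" "r (insert e X) = r X"
  shows "r (insert e (insert f X)) = r (insert f X)"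
proof (cases "r (insert f X) = r X")
  case True
  then show ?thesis using r_local[OF assms(1-4)] by (simp add: insert_commute)
next
  case False
  then have "r (insert f X) = r X + 1" using r_up[OF assms(1,3)] by linarith
  moreover have "r (insert f (insert e X)) \<le> r (insert e X) + 1" using r_up[of "insert e X" f] assms by blast
  moreover have "r (insert f X) \<le> r (insert e (insert f X))" using r_up[of "insert f X" e] assms by blast
  ultimately show ?thesis using assms(4) by (simp add: insert_commute)
qed

lemma r_dim:
  assumes "X \<subseteq> Y" "Y \<subseteq> U" "e \<in> U" "r (insert e X) = r X"
  shows "r (insert e Y) = r Y"
proof -
  have "r (insert e (X \<union> Z)) = r (X \<union> Z)" if "finite Z" "Z \<subseteq> U" for Z
    using that
  proof (induction Z)
    case (insert f Z)
    then show ?case using r_dim1[of "X \<union> Z" e f] assms by simp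
  qed (use assms in simp)
  from this[of Y] show ?thesis using assms finite_sub by (simp add: Un_absorb1)
qed

lemma r_closure:
  assumes "X \<subseteq> U" "Y \<subseteq> U" "\<And>e. e \<in> Y \<Longrightarrow> r (insert e X) = r X"
  shows "r (X \<union> Y) = r X"
proof -
  have "finite Z \<Longrightarrow> Z \<subseteq> Y \<Longrightarrow> r (X \<union> Z) = r X" for Z
  proof (induction Z rule: finite_induct)
    case (insert f Z)
    then show ?case using r_dim[of X "X \<union> Z" f] assms by auto
  qed simp
  then show ?thesis using finite_sub assms by blast
qed

text \<open>The elements of \<open>Y - X\<close> are added one by one both to \<open>X\<close> and
  to \<open>X \<inter> Y\<close>; by \<open>r_dim\<close>, a step that raises the larger rank also
  raises the smaller one.\<close>

lemma r_submodular:
  assumes "X \<subseteq> U" "Y \<subseteq> U"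
  shows "r (X \<union> Y) + r (X \<inter> Y) \<le> r X + r Y"
proof -
  define W where "W = X \<inter> Y"
  have W: "W \<subseteq> X" by (simp add: W_def)
  have "r (X \<union> Z) + r W \<le> r X + r (W \<union> Z)" if "finite Z" "Z \<subseteq> U" for Z
    using that
  proof (induction Z)
    case (insert e Z)
    have sub: "X \<union> Z \<subseteq> U" "W \<union> Z \<subseteq> U" "e \<in> U" "W \<union> Z \<subseteq> X \<union> Z" using insert assms W by auto
    show ?case
    proof (cases "r (insert e (W \<union> Z)) = r (W \<union> Z)")
      case True
      then have "r (insert e (X \<union> Z)) = r (X \<union> Z)" using r_dim sub by blast
      with True insert show ?thesis by simp
    next
      case False
      then have "r (insert e (W \<union> Z)) = r (W \<union> Z) + 1" using r_up[OF sub(2,3)] by linarith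
      with r_up[OF sub(1,3)] insert show ?thesis by simp
    qed
  qed simp
  from this[of "Y - X"] have "r (X \<union> (Y - X)) + r W \<le> r X + r (W \<union> (Y - X))"
    using assms finite_sub by blast
  moreover have "W \<union> (Y - X) = Y" "X \<union> (Y - X) = X \<union> Y" by (auto simp: W_def)
  ultimately show ?thesis by (simp add: W_def)
qed

lemma r_le_card: "X \<subseteq> U \<Longrightarrow> r X \<le> card X"
proof (induction X rule: infinite_finite_induct)
  case (infinite X) then show ?case using finite_sub by blast
next
  case empty then show ?case by (simp add: r_empty)
next
  case (insert e X) then show ?case using r_up[of X e] by fastforce
qed

lemma r_Un_le:
  assumes "X \<subseteq> U" "Y \<subseteq> U" shows "r (X \<union> Y) \<le> r X + card Y"
  using r_submodular[OF assms] r_le_card[OF assms(2)] by linarith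

lemma r_indep_subset:
  assumes "I \<subseteq> U" "J \<subseteq> I" "r I = card I" shows "r J = card J"
proof -
  have JU: "J \<subseteq> U" "I - J \<subseteq> U" using assms by auto
  have "r I \<le> r J + card (I - J)" using r_Un_le[OF JU] assms(2) by (simp add: Un_absorb1)
  moreover have "card I = card J + card (I - J)"
    using assms finite_sub[OF assms(1)] card_Un_disjoint[of J "I - J"] finite_subset[OF assms(2)] by (simp add: Un_absorb1)
  ultimately show ?thesis using assms(3) r_le_card[OF JU(1)] by linarith
qed

text \<open>No element of \<open>X\<close> raises the rank of a maximal independent
  \<open>I\<close>, and by \<open>r_closure\<close> neither do all of them together.\<close>

lemma r_maximal_indep:
  assumes "X \<subseteq> U" "I \<subseteq> X" "r I = card I" and max: "\<And>e. e \<in> X - I \<Longrightarrow> r (insert e I) \<noteq> card (insert e I)"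
  shows "r I = r X"
proof -
  have "r (insert e I) = r I" if "e \<in> X" for e
  proof (cases "e \<in> I")
    case False
    then have "card (insert e I) = card I + 1" using assms finite_sub finite_subset by (metis Suc_eq_plus1 card_insert_disjoint order_trans)
    moreover have "r I \<le> r (insert e I)" "r (insert e I) \<le> r I + 1" using r_up[of I e] that assms by blast+
    moreover have "r (insert e I) \<noteq> card (insert e I)" using max that False by blast
    ultimately show ?thesis using assms(3) by linarith
  qed (simp add: insert_absorb)
  then have "r (I \<union> X) = r I" using r_closure[of I X] assms by blast
  then show ?thesis using assms(2) by (simp add: Un_absorb1)
qed

lemma r_basis:
  assumes "X \<subseteq> U" obtains I where "I \<subseteq> X" "r I = card I" "r I = r X"
proof -
  have fX: "finite X" using finite_sub assms .
  let ?S = "{I. I \<subseteq> X \<and> r I = card I}"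
  have "{} \<in> ?S" using r_empty by simp
  moreover have "\<forall>I. I \<in> ?S \<longrightarrow> card I < Suc (card X)" using card_mono[OF fX] by (auto simp: less_Suc_eq_le)
  ultimately obtain I where I: "I \<in> ?S" "\<And>J. J \<in> ?S \<Longrightarrow> card J \<le> card I"
    using ex_has_greatest_nat[of "\<lambda>I. I \<in> ?S" "{}" card "Suc (card X)"] by (metis (no_types, lifting))
  have "r (insert e I) \<noteq> card (insert e I)" if e: "e \<in> X - I" for e
  proof
    assume "r (insert e I) = card (insert e I)"
    then have "card (insert e I) \<le> card I" using I e by blast
    then show False using e I(1) fX finite_subset[of I X] by simp
  qed
  then show ?thesis using r_maximal_indep[OF assms] I(1) that by blast
qed

end

section \<open>Matroids whose independence is given by a rank function\<close>

locale matroid_rank = rank_function U r for U :: "'e set" and r +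
  fixes M :: "'e pre_matroid"
  assumes ground: "ground M = U"
    and indep_iff: "indep M I \<longleftrightarrow> I \<subseteq> U \<and> r I = card I"
begin

lemma mrank_eq: assumes "X \<subseteq> U" shows "mrank M X = r X"
  unfolding mrank_def
proof (rule Max_eqI)
  show "finite (card ` {I. I \<subseteq> X \<and> indep M I})" using finite_sub[OF assms] by auto
  fix n assume "n \<in> card ` {I. I \<subseteq> X \<and> indep M I}"
  then obtain I where "I \<subseteq> X" "r I = card I" "n = card I" by (auto simp: indep_iff)
  then show "n \<le> r X" using r_mono[of I X] assms by simp
next
  obtain I where "I \<subseteq> X" "r I = card I" "r I = r X" using r_basis[OF assms] .
  then show "r X \<in> card ` {I. I \<subseteq> X \<and> indep M I}" using assms by (auto simp: indep_iff intro!: image_eqI[of _ _ I])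
qed

lemma basis_ofD:
  assumes "basis_of M T A" "T \<subseteq> U" shows "A \<subseteq> T" "r A = card A" "r A = r T"
proof -
  have A: "A \<subseteq> T" "r A = card A" and max: "\<And>I. A \<subseteq> I \<Longrightarrow> I \<subseteq> T \<Longrightarrow> r I = card I \<Longrightarrow> I = A"
    using assms by (auto simp: basis_of_def indep_iff)
  then show "A \<subseteq> T" "r A = card A" by auto
  show "r A = r T"
    by (rule r_maximal_indep[OF assms(2) A]) (use max A in blast)
qed

text \<open>A basis \<open>A\<close> of \<open>T\<close> has the rank of \<open>T\<close>, so
  \<open>r (I \<union> A) = r (I \<union> T)\<close>, and the choice of the basis in the definition
  of \<open>contraction\<close> is immaterial.\<close>

lemma indep_contraction_iff:
  assumes T: "T \<subseteq> U"
  shows "indep (contraction M T) I \<longleftrightarrow> I \<subseteq> U - T \<and> r (I \<union> T) = card I + r T"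
proof -
  have key: "r (I \<union> A) = card (I \<union> A) \<longleftrightarrow> r (I \<union> T) = card I + r T"
    if I: "I \<subseteq> U - T" and A: "A \<subseteq> T" "r A = card A" "r A = r T" for A
  proof -
    have sub: "I \<union> A \<subseteq> U" "I \<union> A \<subseteq> I \<union> T" "I \<union> T \<subseteq> U" using I A T by auto
    have "r (I \<union> A \<union> T) + r ((I \<union> A) \<inter> T) \<le> r (I \<union> A) + r T" using r_submodular[OF sub(1) T] .
    moreover have "I \<union> A \<union> T = I \<union> T" "(I \<union> A) \<inter> T = A" using I A by auto
    ultimately have "r (I \<union> T) \<le> r (I \<union> A)" using A by simp
    then have "r (I \<union> T) = r (I \<union> A)" using r_mono[OF sub(2,3)] by simp
    moreover have "finite I" "finite A" using sub finite_sub finite_subset by (meson Un_upper1 Un_upper2 order_trans)+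
    then have "card (I \<union> A) = card I + card A" using I A by (intro card_Un_disjoint) auto
    ultimately show ?thesis using A by simp
  qed
  obtain A where A: "A \<subseteq> T" "r A = card A" "r A = r T" using r_basis[OF T] .
  have "basis_of M T A"
    unfolding basis_of_def indep_iff
  proof (intro conjI allI impI)
    fix I assume "A \<subseteq> I \<and> I \<subseteq> T \<and> I \<subseteq> U \<and> r I = card I"
    then have "card I \<le> card A" "A \<subseteq> I" "finite I" using r_mono[of I T] T A finite_sub by auto
    then show "I = A" by (metis card_seteq)
  qed (use A T in auto)
  moreover have "indep (contraction M T) I \<longleftrightarrow> I \<subseteq> U - T \<and> (\<exists>A. basis_of M T A \<and> I \<union> A \<subseteq> U \<and> r (I \<union> A) = card (I \<union> A))"
    by (simp add: contraction_def ground indep_iff)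
  moreover have "A' \<subseteq> U" if "basis_of M T A'" for A' using basis_ofD(1)[OF that T] T by blast
  moreover have "\<exists>A. basis_of M T A \<and> I \<union> A \<subseteq> U \<and> r (I \<union> A) = card (I \<union> A)"
    if "I \<subseteq> U - T" "r (I \<union> T) = card I + r T"
    using \<open>basis_of M T A\<close> key[OF that(1) A] that A(1) T by blast
  moreover have "r (I \<union> T) = card I + r T" if "I \<subseteq> U - T" "basis_of M T A'" "r (I \<union> A') = card (I \<union> A')" for A'
    using key[OF that(1) basis_ofD[OF that(2) T]] that(3) by simp
  ultimately show ?thesis by blast
qed

text \<open>The rank inequality says that \<open>X\<close> and \<open>Y\<close> separate
  \<open>M / F\<close>. As \<open>F\<close> need not be a flat, its closure \<open>H\<close> is
  contracted. The strict inequalities leave an element of each side outside \<open>H\<close>, and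
  submodularity makes a circuit through both independent.\<close>

lemma unbreakable_no_separation:
  assumes ub: "unbreakable M" and U: "U = F \<union> X \<union> Y" and dis: "X \<inter> Y = {}"
    and sep: "r (F \<union> X) + r (F \<union> Y) \<le> r U + r F" and pX: "r F < r (F \<union> X)" and pY: "r F < r (F \<union> Y)"
  shows False
proof -
  define H where "H = {e \<in> U. r (insert e F) = r F}"
  have FU: "F \<subseteq> U" "X \<subseteq> U" "Y \<subseteq> U" using U by auto
  have FH: "F \<subseteq> H" "H \<subseteq> U" using FU by (auto simp: H_def insert_absorb)
  have rH: "r H = r F" using r_closure[OF FU(1) FH(2)] FH(1) by (simp add: H_def Un_absorb1)
  have "is_flat M H"
    unfolding is_flat_def ground
  proof (intro conjI ballI)
    fix e assume e: "e \<in> U - H"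
    have "r (insert e F) \<le> r (insert e H)" using r_mono[of "insert e F" "insert e H"] e FH by blast
    moreover have "r (insert e F) \<noteq> r F" "r F \<le> r (insert e F)" using e r_up[OF FU(1), of e] by (auto simp: H_def)
    ultimately show "mrank M (insert e H) \<noteq> mrank M H" using mrank_eq FH e rH by simp
  qed (rule FH)
  then have con: "matroid_connected (contraction M H)" using ub by (simp add: unbreakable_def)
  have ex: "\<exists>e\<in>Z. e \<notin> H" if "Z \<subseteq> U" "r F < r (F \<union> Z)" for Z
  proof (rule ccontr)
    assume "\<not> ?thesis"
    then have "F \<union> Z \<subseteq> H" using FH by blast
    then show False using r_mono[of "F \<union> Z" H] FH rH that by simp
  qed
  obtain e f where ef: "e \<in> X" "e \<notin> H" "f \<in> Y" "f \<notin> H" using ex[OF FU(2) pX] ex[OF FU(3) pY] by blast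
  have "ground (contraction M H) = U - H" by (simp add: contraction_def ground)
  then obtain C where C: "C \<in> circuits (contraction M H)" "e \<in> C" "f \<in> C"
  proof -
    have "e \<in> U - H" "f \<in> U - H" "e \<noteq> f" using ef FU dis by auto
    then show ?thesis using con that \<open>ground (contraction M H) = U - H\<close> unfolding matroid_connected_def by metis
  qed
  have CU: "C \<subseteq> U - H" and nC: "\<not> indep (contraction M H) C" and
    pC: "\<And>I. I \<subset> C \<Longrightarrow> indep (contraction M H) I"
    using C(1) unfolding circuits_def contraction_def ground by auto
  define CX CY where "CX = C \<inter> X" and "CY = C - X"
  have C12: "CX \<subset> C" "CY \<subset> C" "C = CX \<union> CY" "CX \<inter> CY = {}" using C ef dis unfolding CX_def CY_def by auto
  have CYY: "CY \<subseteq> Y" using CU U FH unfolding CY_def by auto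
  have rX: "r (CX \<union> H) = card CX + r H" and rY: "r (CY \<union> H) = card CY + r H"
    using pC C12 indep_contraction_iff[OF FH(2)] by auto
  have "finite C" using CU finite_sub by blast
  then have cC: "card C = card CX + card CY" using C12 by (metis card_Un_disjoint finite_Un)
  \<comment> \<open>Passing from \<open>F\<close> to its closure does not increase these ranks, so
    the separation survives.\<close>
  have HZ: "r (H \<union> Z) \<le> r (F \<union> Z)" if "Z \<subseteq> U" for Z
  proof -
    have "r (H \<union> (F \<union> Z)) + r (H \<inter> (F \<union> Z)) \<le> r H + r (F \<union> Z)" using r_submodular FH FU that by simp
    moreover have "r F \<le> r (H \<inter> (F \<union> Z))" using r_mono[of F "H \<inter> (F \<union> Z)"] FH by auto
    moreover have "H \<union> (F \<union> Z) = H \<union> Z" using FH by auto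
    ultimately show ?thesis using rH by simp
  qed
  \<comment> \<open>Two applications of submodularity, first adding \<open>X\<close> to
    \<open>C \<union> H\<close> and then \<open>Y\<close>, bound the rank of
    \<open>C \<union> H\<close> below by \<open>card C + r H\<close>.\<close>
  have 1: "r (C \<union> H \<union> (H \<union> X)) + r ((C \<union> H) \<inter> (H \<union> X)) \<le> r (C \<union> H) + r (H \<union> X)"
    using r_submodular[of "C \<union> H" "H \<union> X"] CU FH FU by blast
  have 2: "r (CX \<union> H) \<le> r ((C \<union> H) \<inter> (H \<union> X))" using r_mono[of "CX \<union> H" "(C \<union> H) \<inter> (H \<union> X)"] CU FH by (auto simp: CX_def)
  have 3: "r (C \<union> H \<union> (H \<union> X) \<union> (H \<union> Y)) + r ((C \<union> H \<union> (H \<union> X)) \<inter> (H \<union> Y)) \<le> r (C \<union> H \<union> (H \<union> X)) + r (H \<union> Y)"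
    using r_submodular[of "C \<union> H \<union> (H \<union> X)" "H \<union> Y"] CU FH FU by blast
  have 4: "r (CY \<union> H) \<le> r ((C \<union> H \<union> (H \<union> X)) \<inter> (H \<union> Y))"
  proof (rule r_mono)
    show "CY \<union> H \<subseteq> (C \<union> H \<union> (H \<union> X)) \<inter> (H \<union> Y)" using CYY C12(2) by blast
    show "(C \<union> H \<union> (H \<union> X)) \<inter> (H \<union> Y) \<subseteq> U" using FH FU by blast
  qed
  have 5: "C \<union> H \<union> (H \<union> X) \<union> (H \<union> Y) = U" using CU FH U by auto
  have "card C + r H \<le> r (C \<union> H)" using 1 2 3 4 rX rY cC HZ[OF FU(2)] HZ[OF FU(3)] sep rH unfolding 5 by linarith
  moreover have "r (C \<union> H) \<le> card C + r H" using r_Un_le[of H C] FH(2) subset_trans[OF CU Diff_subset] by (simp add: Un_commute)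
  ultimately show False using nC indep_contraction_iff[OF FH(2), of C] CU by simp
qed

lemma three_connected_no_separation:
  assumes "n_connected_matroid 3 M" "X \<subseteq> U" "2 \<le> card X" "2 \<le> card (U - X)"
  shows "r U + 2 \<le> r X + r (U - X)"
proof -
  have "\<not> k_separation 2 M X" using assms(1) by (simp add: n_connected_matroid_def)
  then show ?thesis using assms(2-4) mrank_eq by (simp add: k_separation_def ground)
qed

end

section \<open>The rank formula\<close>

context qbgraph
begin

definition unb_at :: "'e set \<Rightarrow> 'v \<Rightarrow> bool" where
  "unb_at X v \<longleftrightarrow> (\<exists>C\<in>cycles. C \<subseteq> X \<and> C \<notin> B \<and> (\<exists>w\<in>sp C. con X v w))"

definition hasL :: "'e set \<Rightarrow> bool" where
  "hasL X \<longleftrightarrow> (\<exists>C\<in>L. C \<subseteq> X)"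

definition unbs :: "'e set \<Rightarrow> 'v set set" where
  "unbs X = comp X ` {v \<in> V. unb_at X v}"

definition newunb :: "'e set \<Rightarrow> 'e \<Rightarrow> bool" where
  "newunb X e \<longleftrightarrow> (\<exists>C\<in>cycles. e \<in> C \<and> C \<subseteq> insert e X \<and> C \<notin> B)"

text \<open>\<open>unbs\<close> ranges over components, so several unbalanced cycles in one
  component count once. The subtraction never truncates, as there are at most \<open>card V\<close>
  components.\<close>

definition rho :: "'e set \<Rightarrow> nat" where
  "rho X = card V - card (comps X) + (if hasL X then 1 else card (unbs X))"

text \<open>The edges that do not raise \<open>rho\<close>. An edge inside a component can only
  contribute its first unbalanced cycle. An edge between two components lowers their number, which
  is offset exactly if both are unbalanced and no \<open>L\<close>-cycle fixes the last summand at
  1.\<close>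

definition spans :: "'e set \<Rightarrow> 'e \<Rightarrow> bool" where
  "spans X e \<longleftrightarrow> (\<exists>a b. en e = {a, b} \<and>
     (if con X a b then newunb X e \<longrightarrow> unb_at X a \<or> hasL X
      else \<not> hasL X \<and> unb_at X a \<and> unb_at X b))"

lemma card_comps_le: "card (comps X) \<le> card V"
  unfolding comps_def by (rule card_image_le[OF finite_V])

lemma finite_unbs: "finite (unbs X)"
  unfolding unbs_def using finite_V by simp

lemma unbs_sub: "unbs X \<subseteq> comps X"
  unfolding unbs_def comps_def by auto

lemma unb_at_con: "con X v w \<Longrightarrow> unb_at X v \<longleftrightarrow> unb_at X w"
  unfolding unb_at_def using con_left[of X v w] by simp

lemma comp_in_unbs_iff: "v \<in> V \<Longrightarrow> comp X v \<in> unbs X \<longleftrightarrow> unb_at X v"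
  unfolding unbs_def using comp_eq_iff unb_at_con by auto

lemma unb_at_mono: "unb_at X v \<Longrightarrow> X \<subseteq> Y \<Longrightarrow> unb_at Y v"
  unfolding unb_at_def by (meson con_mono order_trans)

lemma cycle_in_insert_bridge:
  assumes "C \<in> cycles" "C \<subseteq> insert e X" "en e = {a, b}" "\<not> con X a b" shows "C \<subseteq> X"
proof -
  have "e \<notin> C"
  proof
    assume "e \<in> C"
    then have "con (C - {e}) a b" using cycle_minus_edge assms by blast
    then show False using assms(2,4) con_mono[of "C - {e}" a b X] by blast
  qed
  then show ?thesis using assms(2) by blast
qed

lemma unb_at_bridge:
  assumes "en e = {a, b}" "\<not> con X a b"
  shows "unb_at (insert e X) v \<longleftrightarrow> unb_at X v \<or> con X v a \<and> unb_at X b \<or> con X v b \<and> unb_at X a"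
proof -
  have "unb_at (insert e X) v \<longleftrightarrow> (\<exists>C\<in>cycles. C \<subseteq> X \<and> C \<notin> B \<and> (\<exists>w\<in>sp C. con (insert e X) v w))"
    unfolding unb_at_def using cycle_in_insert_bridge[OF _ _ assms] by blast
  also have "\<dots> \<longleftrightarrow> (\<exists>C\<in>cycles. C \<subseteq> X \<and> C \<notin> B \<and> (\<exists>w\<in>sp C. con X v w))
      \<or> con X v a \<and> (\<exists>C\<in>cycles. C \<subseteq> X \<and> C \<notin> B \<and> (\<exists>w\<in>sp C. con X b w))
      \<or> con X v b \<and> (\<exists>C\<in>cycles. C \<subseteq> X \<and> C \<notin> B \<and> (\<exists>w\<in>sp C. con X a w))"
    unfolding con_insert[OF assms(1)] by (simp only: bex_disj_distrib conj_disj_distribL bex_simps conj_left_commute ex_disj_distrib) blast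
  finally show ?thesis unfolding unb_at_def .
qed

lemma hasL_bridge:
  assumes "en e = {a, b}" "\<not> con X a b" shows "hasL (insert e X) = hasL X"
proof -
  have "C \<subseteq> insert e X \<longleftrightarrow> C \<subseteq> X" if "C \<in> L" for C
    using that classes(1) cycle_in_insert_bridge[OF _ _ assms] by blast
  then show ?thesis unfolding hasL_def by blast
qed

text \<open>A bridge closes no cycle, so \<open>hasL\<close> is unchanged. Two components become
  one, and the number of unbalanced ones drops exactly when both were unbalanced.\<close>

lemma rho_bridge:
  assumes e: "e \<in> E" "en e = {a, b}" and n: "\<not> con X a b"
  shows "rho (insert e X) = rho X + (if \<not> hasL X \<and> unb_at X a \<and> unb_at X b then 0 else 1)"
proof -
  have ab: "a \<in> V" "b \<in> V" using ends_subset[OF e(1)] e(2) by auto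
  have c: "card (comps X) = Suc (card (comps (insert e X)))" using card_comps_insert[OF e n] .
  have le: "card (comps X) \<le> card V" using card_comps_le .
  have L: "hasL (insert e X) = hasL X" using hasL_bridge[OF e(2) n] .
  let ?A = "comp X a" and ?B = "comp X b"
  have AB: "?A \<noteq> ?B" using comp_eq_iff[OF ab] n by simp
  have mem: "K \<in> unbs (insert e X) \<longleftrightarrow> (if unb_at X a \<or> unb_at X b then K = ?A \<union> ?B \<or> K \<in> unbs X - {?A, ?B} else K \<in> unbs X)" for K
  proof -
    have eqA: "comp X v = ?A \<longleftrightarrow> con X v a" "comp X v = ?B \<longleftrightarrow> con X v b" if "v \<in> V" for v
      using comp_eq_iff that ab by blast+
    have ub: "unb_at (insert e X) v \<longleftrightarrow> unb_at X v \<or> con X v a \<and> unb_at X b \<or> con X v b \<and> unb_at X a" for v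
      using unb_at_bridge[OF e(2) n] .
    show ?thesis
    proof
      assume "K \<in> unbs (insert e X)"
      then obtain v where v: "v \<in> V" "unb_at (insert e X) v" "K = comp (insert e X) v" unfolding unbs_def by auto
      show "if unb_at X a \<or> unb_at X b then K = ?A \<union> ?B \<or> K \<in> unbs X - {?A, ?B} else K \<in> unbs X"
      proof (cases "con X v a \<or> con X v b")
        case True
        then have "unb_at X a \<or> unb_at X b" using v(2) ub unb_at_con by blast
        then show ?thesis using comp_insert[OF e(2) n] v(3) True by simp
      next
        case False
        then have "unb_at X v" "K = comp X v" using v ub comp_insert[OF e(2) n] by auto
        then show ?thesis using comp_in_unbs_iff[OF v(1)] eqA[OF v(1)] False by simp
      qed
    next
      assume K: "if unb_at X a \<or> unb_at X b then K = ?A \<union> ?B \<or> K \<in> unbs X - {?A, ?B} else K \<in> unbs X"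
      show "K \<in> unbs (insert e X)"
      proof (cases "(unb_at X a \<or> unb_at X b) \<and> K = ?A \<union> ?B")
        case True
        then have "unb_at (insert e X) a" "comp (insert e X) a = K" using ub[of a] comp_insert[OF e(2) n] by auto
        then show ?thesis using comp_in_unbs_iff[OF ab(1), of "insert e X"] by simp
      next
        case False
        then have "K \<in> unbs X" "unb_at X a \<or> unb_at X b \<Longrightarrow> K \<noteq> ?A \<and> K \<noteq> ?B" using K by (auto split: if_splits)
        then obtain v where v: "v \<in> V" "unb_at X v" "K = comp X v" unfolding unbs_def by auto
        have "\<not> con X v a" "\<not> con X v b"
          using \<open>unb_at X a \<or> unb_at X b \<Longrightarrow> K \<noteq> ?A \<and> K \<noteq> ?B\<close> v eqA[OF v(1)] unb_at_con by blast+
        then have "comp (insert e X) v = K" "unb_at (insert e X) v" using comp_insert[OF e(2) n] v ub by auto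
        then show ?thesis using comp_in_unbs_iff[OF v(1), of "insert e X"] by simp
      qed
    qed
  qed
  have notin: "?A \<union> ?B \<notin> unbs X" using comp_Un_notin[OF ab n] unbs_sub by blast
  have fin: "finite (unbs X)" by (rule finite_unbs)
  have A: "?A \<in> unbs X \<longleftrightarrow> unb_at X a" "?B \<in> unbs X \<longleftrightarrow> unb_at X b" using comp_in_unbs_iff ab by blast+
  have "card (unbs (insert e X)) + (if unb_at X a \<and> unb_at X b then 1 else 0) = card (unbs X)"
  proof (cases "unb_at X a \<or> unb_at X b")
    case False
    then have "unbs (insert e X) = unbs X" using mem by auto
    then show ?thesis using False by auto
  next
    case True
    then have "unbs (insert e X) = insert (?A \<union> ?B) (unbs X - {?A, ?B})" using mem by auto
    then have 1: "card (unbs (insert e X)) = Suc (card (unbs X - {?A, ?B}))" using notin fin by simp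
    show ?thesis
    proof (cases "unb_at X a \<and> unb_at X b")
      case True
      then have "card (unbs X - {?A, ?B}) = card (unbs X) - 2" "2 \<le> card (unbs X)"
        using A AB fin card_Diff_subset[of "{?A, ?B}" "unbs X"] card_mono[of "unbs X" "{?A, ?B}"] by auto
      then show ?thesis using 1 True by simp
    next
      case False
      then have "?A \<in> unbs X \<and> ?B \<notin> unbs X \<or> ?B \<in> unbs X \<and> ?A \<notin> unbs X" using A True by blast
      then have "card (unbs X) = Suc (card (unbs X - {?A, ?B}))"
      proof
        assume h: "?A \<in> unbs X \<and> ?B \<notin> unbs X"
        then have "unbs X - {?A, ?B} = unbs X - {?A}" by auto
        then show ?thesis using card.remove[OF fin, of ?A] h by simp
      next
        assume h: "?B \<in> unbs X \<and> ?A \<notin> unbs X"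
        then have "unbs X - {?A, ?B} = unbs X - {?B}" by auto
        then show ?thesis using card.remove[OF fin, of ?B] h by simp
      qed
      moreover have "\<not> (unb_at X a \<and> unb_at X b)" using False .
      ultimately show ?thesis using 1 by presburger
    qed
  qed
  then show ?thesis unfolding rho_def L using c le by auto
qed

text \<open>The components stay the same, so only the last summand can move. The critical case is
  the first \<open>L\<close>-cycle, where a number of unbalanced components is replaced by
  1.\<close>

lemma rho_no_bridge:
  assumes X: "X \<subseteq> E" and e: "e \<in> E" "en e = {a, b}" and con: "con X a b"
  shows "rho (insert e X) = rho X + (if newunb X e \<longrightarrow> unb_at X a \<or> hasL X then 0 else 1)"
proof -
  have ab: "a \<in> V" "b \<in> V" using ends_subset[OF e(1)] e(2) by auto
  have cc: "con (insert e X) v w \<longleftrightarrow> con X v w" for v w using con_insert_redundant[OF e(2) con] .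
  have comp: "comps (insert e X) = comps X" "\<And>v. comp (insert e X) v = comp X v"
    using comps_insert_redundant[OF e(2) con] cc by (auto simp: comp_def)
  have aC: "con X a w" if "C \<in> cycles" "e \<in> C" "C \<subseteq> insert e X" "w \<in> sp C" for C w
  proof -
    have "a \<in> sp C" using that(2) e(2) by (auto simp: sp_iff)
    then have "con C a w" using cycleD(3)[OF that(1)] that(4) by blast
    then show ?thesis using con_mono[OF _ that(3)] cc by blast
  qed
  have ub: "unb_at (insert e X) v \<longleftrightarrow> unb_at X v \<or> con X v a \<and> newunb X e" for v
  proof
    assume "unb_at (insert e X) v"
    then obtain C w where C: "C \<in> cycles" "C \<subseteq> insert e X" "C \<notin> B" "w \<in> sp C" "con X v w"
      unfolding unb_at_def cc by blast
    show "unb_at X v \<or> con X v a \<and> newunb X e"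
    proof (cases "e \<in> C")
      case True
      then have "con X a w" using aC C by blast
      then have "con X v a" using C(5) con_sym con_trans by metis
      then show ?thesis using C True unfolding newunb_def by blast
    next
      case False
      then show ?thesis using C unfolding unb_at_def by blast
    qed
  next
    assume "unb_at X v \<or> con X v a \<and> newunb X e"
    then show "unb_at (insert e X) v"
    proof
      assume "unb_at X v" then show ?thesis using unb_at_mono by blast
    next
      assume h: "con X v a \<and> newunb X e"
      then obtain C where C: "C \<in> cycles" "e \<in> C" "C \<subseteq> insert e X" "C \<notin> B" unfolding newunb_def by blast
      have "a \<in> sp C" using C(2) e(2) by (auto simp: sp_iff)
      then show ?thesis unfolding unb_at_def cc using C h by blast
    qed
  qed
  have unbs: "unbs (insert e X) = unbs X \<union> (if newunb X e then {comp X a} else {})"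
  proof -
    have "comp X ` {v \<in> V. con X v a} = {comp X a}" using comp_eq_iff ab by auto
    moreover have "{v \<in> V. unb_at X v \<or> con X v a \<and> newunb X e}
        = {v \<in> V. unb_at X v} \<union> (if newunb X e then {v \<in> V. con X v a} else {})" by auto
    ultimately have "comp X ` {v \<in> V. unb_at X v \<or> con X v a \<and> newunb X e} = comp X ` {v \<in> V. unb_at X v} \<union> (if newunb X e then {comp X a} else {})"
      by (simp add: image_Un)
    then show ?thesis unfolding unbs_def ub comp(2) .
  qed
  \<comment> \<open>Without an \<open>L\<close>-cycle in \<open>X\<close>, every unbalanced cycle of
    \<open>X\<close> is in \<open>F\<close>, so it meets the new \<open>L\<close>-cycle and lies in
    the component of \<open>a\<close>. Hence at most one component was unbalanced before.\<close>
  have Lmeet: "unb_at X v \<Longrightarrow> con X v a" if C: "C \<in> L" "e \<in> C" "C \<subseteq> insert e X" "\<not> hasL X" for C v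
  proof -
    assume "unb_at X v"
    then obtain D w where D: "D \<in> cycles" "D \<subseteq> X" "D \<notin> B" "w \<in> sp D" "con X v w" unfolding unb_at_def by blast
    then have "D \<in> F" using classes(1) C(4) unfolding hasL_def by blast
    then obtain z where z: "z \<in> sp C" "z \<in> sp D" using LF_meet[OF C(1)] by blast
    have "con X a z" using aC[of C z] C z classes(1) by blast
    moreover have "con X w z" using cycleD(3)[OF D(1) D(4) z(2)] con_mono D(2) by blast
    ultimately show "con X v a" using D(5) con_sym con_trans by metis
  qed
  have Lcase: "hasL (insert e X) \<Longrightarrow> \<not> hasL X \<Longrightarrow> \<exists>C\<in>L. e \<in> C \<and> C \<subseteq> insert e X"
    unfolding hasL_def by blast
  have Lmono: "hasL X \<Longrightarrow> hasL (insert e X)" unfolding hasL_def by blast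
  have A: "comp X a \<in> unbs X \<longleftrightarrow> unb_at X a" using comp_in_unbs_iff ab by blast
  have fin: "finite (unbs X)" by (rule finite_unbs)
  show ?thesis
  proof (cases "hasL X")
    case True
    then show ?thesis unfolding rho_def comp(1) using Lmono by simp
  next
    case nL: False
    show ?thesis
    proof (cases "hasL (insert e X)")
      case True
      then obtain C where C: "C \<in> L" "e \<in> C" "C \<subseteq> insert e X" using Lcase nL by blast
      then have new: "newunb X e" unfolding newunb_def using classes(1,2) by blast
      have "unbs X = (if unb_at X a then {comp X a} else {})"
      proof -
        have "K = comp X a \<and> unb_at X a" if K: "K \<in> unbs X" for K
        proof -
          obtain v where v: "v \<in> V" "unb_at X v" "K = comp X v" using K unfolding unbs_def by auto
          then have "con X v a" using Lmeet[OF C nL] by blast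
          then show ?thesis using v comp_eq_iff[OF v(1) ab(1)] unb_at_con by blast
        qed
        then show ?thesis using A by auto
      qed
      then show ?thesis unfolding rho_def comp(1) using nL True new by simp
    next
      case False
      then show ?thesis unfolding rho_def comp(1) unbs using nL A fin by (auto simp: insert_absorb)
    qed
  qed
qed

lemma rho_insert:
  assumes "X \<subseteq> E" "e \<in> E"
  shows "rho (insert e X) = rho X + (if spans X e then 0 else 1)"
proof -
  obtain a b where ab: "en e = {a, b}" using obtain_ends[OF assms(2)] .
  \<comment> \<open>The existential over orderings of the ends in \<open>spans\<close> is harmless:
    the condition is symmetric in \<open>a\<close> and \<open>b\<close>.\<close>
  have sp: "spans X e \<longleftrightarrow> (if con X a b then newunb X e \<longrightarrow> unb_at X a \<or> hasL X
      else \<not> hasL X \<and> unb_at X a \<and> unb_at X b)"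
  proof -
    have *: "con X c d \<longleftrightarrow> con X a b" "con X a b \<Longrightarrow> unb_at X c \<longleftrightarrow> unb_at X a"
      "unb_at X c \<and> unb_at X d \<longleftrightarrow> unb_at X a \<and> unb_at X b" if "en e = {c, d}" for c d
    proof -
      have "c = a \<and> d = b \<or> c = b \<and> d = a" using that ab by (auto simp: doubleton_eq_iff)
      then show "con X c d \<longleftrightarrow> con X a b" "con X a b \<Longrightarrow> unb_at X c \<longleftrightarrow> unb_at X a"
        "unb_at X c \<and> unb_at X d \<longleftrightarrow> unb_at X a \<and> unb_at X b" using con_sym unb_at_con by metis+
    qed
    show ?thesis
    proof
      assume "spans X e"
      then obtain c d where cd: "en e = {c, d}" "if con X c d then newunb X e \<longrightarrow> unb_at X c \<or> hasL X
        else \<not> hasL X \<and> unb_at X c \<and> unb_at X d" unfolding spans_def by blast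
      then show "if con X a b then newunb X e \<longrightarrow> unb_at X a \<or> hasL X
        else \<not> hasL X \<and> unb_at X a \<and> unb_at X b" using *[OF cd(1)] by (auto split: if_splits)
    qed (use ab in \<open>unfold spans_def, blast\<close>)
  qed
  show ?thesis
  proof (cases "con X a b")
    case True
    then show ?thesis using rho_no_bridge[OF assms ab True] sp by simp
  next
    case False
    then show ?thesis using rho_bridge[OF assms(2) ab False] sp by simp
  qed
qed

lemma spansE:
  assumes "spans X e" obtains a b where "en e = {a, b}" "if con X a b then newunb X e \<longrightarrow> unb_at X a \<or> hasL X
      else \<not> hasL X \<and> unb_at X a \<and> unb_at X b"
  using assms unfolding spans_def by blast

lemma con_restrict:
  assumes "con X a b" "con X v a"
  shows "con {g \<in> X. \<forall>w\<in>en g. con X v w} a b"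
  using assms(1)
proof (induction rule: con_induct)
  case (step y z g)
  have "con X v y" using assms(2) step(1) by (rule con_trans)
  moreover from this have "con X v z" using con_edge[OF step(2,3)] by (rule con_trans)
  ultimately have "con {g \<in> X. \<forall>w\<in>en g. con X v w} y z" using con_edge[of g _ y z] step by auto
  with step.IH show ?case by (rule con_trans)
qed simp

text \<open>The local closure axiom for \<open>rho\<close>. If both edges lie inside components,
  \<open>f\<close> might close an unbalanced cycle that also uses \<open>e\<close>;
  \<open>bal_insert2\<close> excludes this. If only \<open>f\<close> joins two components, the
  danger is an \<open>L\<close>-cycle created by \<open>e\<close>.\<close>

lemma spans_mono1:
  assumes X: "X \<subseteq> E" and eE: "e \<in> E" "f \<in> E" and se: "spans X e" and sf: "spans X f"
  shows "spans (insert e X) f"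
proof -
  let ?X = "insert e X"
  obtain a b where ab: "en e = {a, b}" and se': "if con X a b then newunb X e \<longrightarrow> unb_at X a \<or> hasL X
      else \<not> hasL X \<and> unb_at X a \<and> unb_at X b" using se by (rule spansE)
  obtain c d where cd: "en f = {c, d}" and sf': "if con X c d then newunb X f \<longrightarrow> unb_at X c \<or> hasL X
      else \<not> hasL X \<and> unb_at X c \<and> unb_at X d" using sf by (rule spansE)
  have "if con ?X c d then newunb ?X f \<longrightarrow> unb_at ?X c \<or> hasL ?X
      else \<not> hasL ?X \<and> unb_at ?X c \<and> unb_at ?X d"
  proof (cases "con X a b")
    case conab: True
    have cc: "con ?X v w \<longleftrightarrow> con X v w" for v w using con_insert_redundant[OF ab conab] .
    show ?thesis
    proof (cases "con X c d")
      case concd: True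
      have "unb_at ?X c \<or> hasL ?X" if new: "newunb ?X f"
      proof (rule ccontr)
        assume n: "\<not> (unb_at ?X c \<or> hasL ?X)"
        then have n2: "\<not> unb_at X c" "\<not> hasL X" using unb_at_mono[of X c ?X] by (auto simp: hasL_def)
        then have nf: "\<not> newunb X f" using sf' concd by simp
        obtain C where C: "C \<in> cycles" "f \<in> C" "C \<subseteq> insert f ?X" "C \<notin> B" using new unfolding newunb_def by blast
        \<comment> \<open>Other components may well contain unbalanced cycles, so \<open>X\<close>
          is cut down to the component of \<open>c\<close> before \<open>bal_insert2\<close> is
          applied.\<close>
        define X0 where "X0 = {g \<in> X. \<forall>w\<in>en g. con X c w}"
        have ccf: "con (insert f ?X) v w \<longleftrightarrow> con X v w" for v w
          using con_insert_redundant[OF cd, of ?X] concd cc by simp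
        have cC: "con X c w" if "w \<in> sp C" for w
        proof -
          have "c \<in> sp C" using C(2) cd by (auto simp: sp_iff)
          then have "con C c w" using cycleD(3)[OF C(1)] that by blast
          then show ?thesis using con_mono[OF _ C(3)] ccf by blast
        qed
        have CX0: "C \<subseteq> insert e (insert f X0)" using C(3) cC by (auto simp: X0_def sp_iff)
        have X0: "X0 \<subseteq> X" by (auto simp: X0_def)
        have wit: "\<exists>w\<in>sp D. con X c w" if D: "D \<in> cycles" "D \<subseteq> insert g X0" "\<forall>w\<in>en g. con X c w" for D g
        proof -
          obtain w where w: "w \<in> sp D" using cycleD(6)[OF D(1)] by blast
          then obtain h where "h \<in> D" "w \<in> en h" by (auto simp: sp_iff)
          then have "con X c w" using D(2,3) unfolding X0_def by auto
          with w show ?thesis by blast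
        qed
        have cf: "\<forall>w\<in>en f. con X c w" using cd concd by simp
        have bf: "bal (insert f X0)"
          unfolding bal_def
        proof (intro ballI impI)
          fix D assume D: "D \<in> cycles" "D \<subseteq> insert f X0"
          show "D \<in> B"
          proof (cases "f \<in> D")
            case True
            then show ?thesis using nf D X0 unfolding newunb_def by blast
          next
            case False
            then have "D \<subseteq> X" using D X0 by blast
            then show ?thesis using wit[OF D cf] n2(1) D(1) unfolding unb_at_def by blast
          qed
        qed
        show False
        proof (cases "e \<in> C")
          case False
          then have "C \<subseteq> insert f X0" using CX0 by blast
          then show False using bf C unfolding bal_def by blast
        next
          case True
          then have ce: "\<forall>w\<in>en e. con X c w" using cC by (auto simp: sp_iff)
          have be: "bal (insert e X0)"
            unfolding bal_def
          proof (intro ballI impI)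
            fix D assume D: "D \<in> cycles" "D \<subseteq> insert e X0"
            then have "D \<subseteq> ?X" using X0 by blast
            then show "D \<in> B" using wit[OF D ce] n D(1) unfolding unb_at_def cc by blast
          qed
          have "con X0 x y" if "en e = {x, y}" for x y
          proof -
            have "con X c x" "con X c y" using ce that by auto
            then have "con X x y" using con_sym con_trans by metis
            then show ?thesis unfolding X0_def using con_restrict \<open>con X c x\<close> by blast
          qed
          then have "C \<in> B" using bal_insert2[OF _ be bf C(1) CX0] X0 X by blast
          then show False using C(4) by blast
        qed
      qed
      then show ?thesis using cc concd by simp
    next
      case ncd: False
      then have h: "\<not> hasL X" "unb_at X c" "unb_at X d" using sf' by auto
      \<comment> \<open>Each of \<open>c\<close> and \<open>d\<close> reaches an
        \<open>F\<close>-cycle of \<open>X\<close>. A new \<open>L\<close>-cycle would meet both of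
        these and so connect \<open>c\<close> to \<open>d\<close>.\<close>
      have "\<not> hasL ?X"
      proof
        assume "hasL ?X"
        then obtain C where C: "C \<in> L" "C \<subseteq> ?X" unfolding hasL_def by blast
        have "\<exists>z\<in>sp C. con X v z" if uv: "unb_at X v" for v
        proof -
          obtain D w where D: "D \<in> cycles" "D \<subseteq> X" "D \<notin> B" "w \<in> sp D" "con X v w" using uv unfolding unb_at_def by blast
          then have "D \<in> F" using classes(1) h(1) unfolding hasL_def by blast
          then obtain z where z: "z \<in> sp C" "z \<in> sp D" using LF_meet[OF C(1)] by blast
          have "con X w z" using cycleD(3)[OF D(1) D(4) z(2)] con_mono D(2) by blast
          then show ?thesis using z con_trans[OF D(5)] by blast
        qed
        then obtain z1 z2 where z: "z1 \<in> sp C" "con X c z1" "z2 \<in> sp C" "con X d z2" using h by blast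
        have "con C z1 z2" using cycleD(3) z C(1) classes(1) by blast
        then have "con X z1 z2" using con_mono[OF _ C(2)] cc by blast
        then have "con X c d" using z con_sym con_trans by metis
        then show False using ncd by blast
      qed
      then show ?thesis using h cc ncd unb_at_mono[of X _ ?X] by auto
    qed
  next
    case nab: False
    then have h: "\<not> hasL X" "unb_at X a" "unb_at X b" using se' by auto
    have nL: "\<not> hasL ?X" using hasL_bridge[OF ab nab] h by simp
    show ?thesis
    proof (cases "con X c d")
      case concd: True
      have "unb_at ?X c" if new: "newunb ?X f"
      proof -
        obtain C where C: "C \<in> cycles" "f \<in> C" "C \<subseteq> insert f ?X" "C \<notin> B" using new unfolding newunb_def by blast
        \<comment> \<open>\<open>e\<close> remains a bridge after \<open>f\<close> is added, so the
          cycle avoids \<open>e\<close>.\<close>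
        have "\<not> con (insert f X) a b" using con_insert_redundant[OF cd concd] nab by simp
        then have "C \<subseteq> insert f X" using cycle_in_insert_bridge[OF C(1) _ ab, of "insert f X"] C(3) by (simp add: insert_commute)
        then have "newunb X f" using C unfolding newunb_def by blast
        then show ?thesis using sf' concd h(1) unb_at_mono[of X c ?X] by auto
      qed
      then show ?thesis using concd con_mono[of X c d ?X] by auto
    next
      case False
      then show ?thesis using sf' nL unb_at_mono[of X _ ?X] by auto
    qed
  qed
  then show ?thesis unfolding spans_def using cd by blast
qed

lemma rho_empty: "rho {} = 0"
proof -
  have "\<not> hasL {}" using classes(1) cycleD(2) unfolding hasL_def by blast
  moreover have "unbs {} = {}" unfolding unbs_def unb_at_def using cycleD(2) by blast
  ultimately show ?thesis by (simp add: rho_def comps_empty)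
qed

sublocale rank_function E rho
proof
  show "finite E" by (rule finite_E)
  show "rho {} = 0" by (rule rho_empty)
  show "rho X \<le> rho (insert e X) \<and> rho (insert e X) \<le> rho X + 1" if "X \<subseteq> E" "e \<in> E" for X e
    using rho_insert[OF that] by simp
  fix X e f
  assume h: "X \<subseteq> E" "e \<in> E" "f \<in> E" "rho (insert e X) = rho X" "rho (insert f X) = rho X"
  then have "spans X e" "spans X f" using rho_insert[OF h(1,2)] rho_insert[OF h(1,3)] by (auto split: if_splits)
  then have "spans (insert e X) f" using spans_mono1 h by blast
  then show "rho (insert f (insert e X)) = rho X" using rho_insert[of "insert e X" f] h by simp
qed

section \<open>Circuits and dependence\<close>

lemma card_unbs_connected:
  assumes "\<And>p q. p \<in> sp X \<Longrightarrow> q \<in> sp X \<Longrightarrow> con X p q"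
  shows "card (unbs X) \<le> 1"
proof -
  have "K = K'" if K: "K \<in> unbs X" "K' \<in> unbs X" for K K'
  proof -
    obtain v v' where v: "v \<in> V" "unb_at X v" "K = comp X v" "v' \<in> V" "unb_at X v'" "K' = comp X v'"
      using K unfolding unbs_def by auto
    obtain w w' where w: "w \<in> sp X" "con X v w" "w' \<in> sp X" "con X v' w'"
      using v(2,5) sp_mono unfolding unb_at_def by blast
    have "con X w w'" using assms w by blast
    then have "con X v v'" using w con_sym con_trans by metis
    then show ?thesis using v comp_eq_iff by blast
  qed
  then show ?thesis using finite_unbs by (metis One_nat_def card_le_Suc0_iff_eq)
qed

text \<open>Two cycles give cyclomatic number at least 2, while the last hypothesis keeps the last
  summand of \<open>rho\<close> at most 1.\<close>

lemma rho_two_cycles: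
  assumes "X \<subseteq> E" "C \<in> cycles" "C \<subseteq> X" "D \<in> cycles" "D \<subseteq> X" "C \<noteq> D"
    and "hasL X \<or> (\<forall>p\<in>sp X. \<forall>q\<in>sp X. con X p q)"
  shows "rho X < card X"
proof -
  obtain e where "e \<in> C" "e \<notin> D" using cycle_antichain assms by blast
  then have "card V + 2 \<le> card (comps X) + card X" using two_cycles_excess assms by blast
  moreover have "(if hasL X then 1 else card (unbs X)) \<le> 1" using assms(7) card_unbs_connected by auto
  moreover have "card (comps X) \<le> card V" using card_comps_le .
  ultimately show ?thesis unfolding rho_def by arith
qed

text \<open>A cycle of \<open>B\<close> has cyclomatic number at least 1 and no unbalanced
  component. Every other kind of circuit contains two cycles and is connected or contains an
  \<open>L\<close>-cycle.\<close>

lemma circuit_dependent: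
  assumes "K \<in> quasi_graphic_circuits G B L F"
  shows "K \<subseteq> E" "rho K < card K"
proof -
  have BLF: "B \<subseteq> cycles" "L \<subseteq> cycles" "F \<subseteq> cycles" using classes(1) by auto
  consider (1) "K \<in> B" | (2) "is_theta G K" | (3) C D where "tight_handcuffs_of G C D K"
    | (4) C D where "K = C \<union> D" "C \<in> L" "D \<in> L" "vertex_disjoint G C D" | (5) C D where "loose_handcuffs_of G C D K"
    using assms unfolding quasi_graphic_circuits_def by blast
  then have "K \<subseteq> E \<and> rho K < card K"
  proof cases
    case 1
    then have K: "K \<in> cycles" using BLF by blast
    have "C = K" if "C \<in> cycles" "C \<subseteq> K" for C using cycle_antichain[OF that(1) K that(2)] .
    then have "\<not> hasL K" "unbs K = {}" using 1 classes BLF unfolding hasL_def unbs_def unb_at_def by blast+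
    then have "rho K = card V - card (comps K)" by (simp add: rho_def)
    moreover have "card V + 1 \<le> card (comps K) + card K" using cycle_excess[OF _ K] cycleD(1)[OF K] by blast
    moreover have "card K > 0" using cycleD(2,5)[OF K] by (simp add: card_gt_0_iff)
    ultimately show ?thesis using cycleD(1)[OF K] by linarith
  next
    case 2
    then obtain u v P Q R where T: "theta3 u v P Q R" "K = P \<union> Q \<union> R" unfolding is_theta_iff by blast
    note c = theta3_cycle[OF T(1)]
    obtain S1 S2 S3 where S: "ipath u v S1 P" "ipath u v S2 Q" "ipath u v S3 R" "u \<noteq> v" "P \<inter> Q = {}" "P \<inter> R = {}"
      using T(1) unfolding theta3_def by blast
    have KE: "K \<subseteq> E" using T(2) S ipath_basic(4) by blast
    have ucon: "con K u p" if "p \<in> sp K" for p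
    proof -
      have "p \<in> S1 \<or> p \<in> S2 \<or> p \<in> S3" using that S ipath_span_subset unfolding T(2) sp_Un by blast
      then have "con P u p \<or> con Q u p \<or> con R u p" using ipath_basic(8) S by blast
      moreover have "P \<subseteq> K" "Q \<subseteq> K" "R \<subseteq> K" using T(2) by auto
      ultimately show ?thesis using con_mono by metis
    qed
    have cK: "con K p q" if "p \<in> sp K" "q \<in> sp K" for p q using ucon[OF that(1)] ucon[OF that(2)] con_sym con_trans by metis
    have "P \<noteq> {}" using ipath_basic(10)[OF S(1)] S(4) by simp
    then have ne: "P \<union> Q \<noteq> Q \<union> R" using S(5,6) by blast
    show ?thesis using KE rho_two_cycles[OF KE c(1) _ c(3) _ ne] cK T(2) by blast
  next
    case (3 C D)
    then obtain v where C: "C \<in> cycles" "D \<in> cycles" "C \<inter> D = {}" "K = C \<union> D" "sp C \<inter> sp D = {v}"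
      unfolding tight_handcuffs_of_def by blast
    have KE: "K \<subseteq> E" using C cycleD(1) by blast
    have v: "v \<in> sp C" "v \<in> sp D" using C(5) by auto
    have vcon: "con K v p" if "p \<in> sp K" for p
    proof -
      have "con C v p \<or> con D v p" using that cycleD(3)[OF C(1)] cycleD(3)[OF C(2)] v unfolding C(4) sp_Un by blast
      then show ?thesis using con_mono C(4) by blast
    qed
    have cK: "con K p q" if "p \<in> sp K" "q \<in> sp K" for p q using vcon[OF that(1)] vcon[OF that(2)] con_sym con_trans by metis
    have "C \<noteq> D" using C(3) cycleD(2)[OF C(1)] by blast
    then show ?thesis using KE rho_two_cycles[OF KE C(1) _ C(2)] cK C(4) by blast
  next
    case (4 C D)
    have C: "C \<in> cycles" "D \<in> cycles" using 4 BLF by auto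
    have KE: "K \<subseteq> E" using C cycleD(1) 4(1) by blast
    have "C \<noteq> D" using 4(4) cycleD(6)[OF C(1)] by (auto simp: vertex_disjoint_def)
    moreover have "hasL K" using 4 unfolding hasL_def by blast
    ultimately show ?thesis using KE rho_two_cycles[OF KE C(1) _ C(2)] 4(1) by blast
  next
    case (5 C D)
    then obtain P u v S where C: "C \<in> cycles" "D \<in> cycles" "sp C \<inter> sp D = {}" "K = C \<union> D \<union> P"
      "u \<in> sp C" "v \<in> sp D" "ipath u v S P"
      unfolding loose_handcuffs_of_def joining_path_def path_between_iff vertex_disjoint_def by blast
    have KE: "K \<subseteq> E" using C cycleD(1) ipath_basic(4) by blast
    have sub: "C \<subseteq> K" "D \<subseteq> K" "P \<subseteq> K" using C(4) by auto
    have uv: "con K u v" using con_mono[OF ipath_basic(8)[OF C(7) ipath_basic(2)[OF C(7)]] sub(3)] .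
    have ucon: "con K u p" if "p \<in> sp K" for p
    proof -
      have "p \<in> sp C \<or> p \<in> sp D \<or> p \<in> S" using that ipath_span_subset[OF C(7)] unfolding C(4) sp_Un by blast
      then consider "p \<in> sp C" | "p \<in> sp D" | "p \<in> S" by blast
      then show ?thesis
      proof cases
        case 1 then show ?thesis using cycleD(3)[OF C(1,5)] con_mono[OF _ sub(1)] by blast
      next
        case 2 then show ?thesis using cycleD(3)[OF C(2,6)] con_mono[OF _ sub(2)] con_trans[OF uv] by blast
      next
        case 3 then show ?thesis using ipath_basic(8)[OF C(7)] con_mono[OF _ sub(3)] by blast
      qed
    qed
    have cK: "con K p q" if "p \<in> sp K" "q \<in> sp K" for p q using ucon[OF that(1)] ucon[OF that(2)] con_sym con_trans by metis
    have "C \<noteq> D" using C(3) cycleD(6)[OF C(1)] by auto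
    then show ?thesis using KE rho_two_cycles[OF KE C(1) sub(1) C(2) sub(2)] cK by blast
  qed
  then show "K \<subseteq> E" "rho K < card K" by auto
qed

text \<open>Each clause of \<open>spans\<close> provides cycles. Inside a component, a cycle through
  \<open>e\<close> is in \<open>B\<close> or is paired with an unbalanced cycle of that component or
  with an \<open>L\<close>-cycle; a bridge pairs unbalanced cycles of the two components that it
  joins.\<close>

lemma spanned_circuit:
  assumes X: "X \<subseteq> E" and e: "e \<in> E" "e \<notin> X" and s: "spans X e"
  shows "\<exists>K\<in>quasi_graphic_circuits G B L F. K \<subseteq> insert e X"
proof -
  let ?X = "insert e X"
  have XE: "?X \<subseteq> E" using X e by blast
  have Bc: "K \<in> quasi_graphic_circuits G B L F" if "K \<in> B" for K
    using that unfolding quasi_graphic_circuits_def by simp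
  obtain a b where ab: "en e = {a, b}" and s': "if con X a b then newunb X e \<longrightarrow> unb_at X a \<or> hasL X
      else \<not> hasL X \<and> unb_at X a \<and> unb_at X b" using s by (rule spansE)
  show ?thesis
  proof (cases "con X a b")
    case True
    obtain C where C: "C \<in> cycles" "e \<in> C" "C \<subseteq> ?X" using con_cycle[OF X e ab True] .
    have aC: "a \<in> sp C" using C(2) ab by (auto simp: sp_iff)
    show ?thesis
    proof (cases "C \<in> B")
      case True then show ?thesis using Bc C by blast
    next
      case nB: False
      then have "unb_at X a \<or> hasL X" using s' True C unfolding newunb_def by auto
      then show ?thesis
      proof
        assume "unb_at X a"
        then obtain D w where D: "D \<in> cycles" "D \<subseteq> X" "D \<notin> B" "w \<in> sp D" "con X a w" unfolding unb_at_def by blast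
        have "C \<noteq> D" "D \<subseteq> ?X" using C D e by auto
        moreover have "con ?X a w" using con_mono[OF D(5)] by blast
        ultimately show ?thesis
          using connected_cycles_contain_circuit[OF XE C(1) D(1) nB D(3) _ C(3) _ aC D(4)] by blast
      next
        assume "hasL X"
        then obtain D where D: "D \<in> L" "D \<subseteq> X" unfolding hasL_def by blast
        have Dc: "D \<in> cycles" "D \<notin> B" using D classes by blast+
        have ne: "C \<noteq> D" "D \<subseteq> ?X" using C D e by auto
        show ?thesis
        proof (cases "sp C \<inter> sp D = {}")
          case True
          then have "C \<notin> F" using LF_meet[OF D(1)] by blast
          then have "C \<in> L" using C(1) nB classes(1) by blast
          then have "C \<union> D \<in> quasi_graphic_circuits G B L F"
            unfolding quasi_graphic_circuits_def vertex_disjoint_def using True D by blast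
          moreover have "C \<union> D \<subseteq> ?X" using C ne by blast
          ultimately show ?thesis by blast
        next
          case False
          then obtain p where "p \<in> sp C" "p \<in> sp D" by blast
          then show ?thesis
            using connected_cycles_contain_circuit[OF XE C(1) Dc(1) nB Dc(2) ne(1) C(3) ne(2)] con_refl by blast
        qed
      qed
    qed
  next
    case False
    then have h: "unb_at X a" "unb_at X b" using s' by auto
    obtain C w where C: "C \<in> cycles" "C \<subseteq> X" "C \<notin> B" "w \<in> sp C" "con X a w" using h(1) unfolding unb_at_def by blast
    obtain D z where D: "D \<in> cycles" "D \<subseteq> X" "D \<notin> B" "z \<in> sp D" "con X b z" using h(2) unfolding unb_at_def by blast
    have "C \<noteq> D"
    proof
      assume "C = D"
      then have "con C w z" using cycleD(3) C D by blast
      then have "con X w z" using con_mono C(2) by blast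
      then have "con X a b" using C(5) D(5) con_sym con_trans by metis
      then show False using False by blast
    qed
    moreover have "con ?X w z"
    proof -
      have "con ?X a w" "con ?X b z" "con ?X a b" using C(5) D(5) con_mono[of X _ _ ?X] con_edge[of e ?X a b] ab by auto
      then show ?thesis using con_sym con_trans by metis
    qed
    moreover have "C \<subseteq> ?X" "D \<subseteq> ?X" using C D by auto
    ultimately show ?thesis
      using connected_cycles_contain_circuit[OF XE C(1) D(1) C(3) D(3) _ _ _ C(4) D(4)] by blast
  qed
qed

lemma dependent_contains_circuit:
  "X \<subseteq> E \<Longrightarrow> rho X \<noteq> card X \<Longrightarrow> \<exists>K\<in>quasi_graphic_circuits G B L F. K \<subseteq> X"
proof (induction X rule: infinite_finite_induct)
  case (infinite X) then show ?case using finite_edges by blast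
next
  case empty then show ?case by (simp add: rho_empty)
next
  case (insert e X)
  show ?case
  proof (cases "rho X = card X")
    case False then show ?thesis using insert by blast
  next
    case True
    then have "spans X e" using rho_insert[of X e] insert by (auto split: if_splits)
    then show ?thesis using spanned_circuit[of X e] insert by blast
  qed
qed

abbreviation "M \<equiv> quasi_graphic_matroid G B L F"

text \<open>Independence in \<open>M\<close> means avoiding the circuit family. Circuits are
  dependent and independence passes to subsets; conversely, a dependent set contains a circuit. From
  here on \<open>rho\<close> is the rank of \<open>M\<close>.\<close>

sublocale matroid_rank E rho M
proof
  show "ground M = E" by (simp add: quasi_graphic_matroid_def matroid_of_circuits_def)
  fix I
  have "I \<subseteq> E \<Longrightarrow> rho I = card I \<longleftrightarrow> (\<forall>K\<in>quasi_graphic_circuits G B L F. \<not> K \<subseteq> I)"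
    using dependent_contains_circuit circuit_dependent r_indep_subset by (metis less_irrefl_nat)
  then show "indep M I \<longleftrightarrow> I \<subseteq> E \<and> rho I = card I"
    by (auto simp: quasi_graphic_matroid_def matroid_of_circuits_def)
qed

end

section \<open>Vertex cuts of an unbreakable quasi-graphic matroid\<close>

context mgraph
begin

definition inside :: "'v set \<Rightarrow> 'e set" where
  "inside S = {e \<in> E. en e \<subseteq> S}"

text \<open>A connected subgraph with vertex set \<open>S\<close> and edge set \<open>X\<close>, not
  necessarily induced: gluing balanced subgraphs requires control over the intersection of their
  edge sets.\<close>

definition cns :: "'v set \<Rightarrow> 'e set \<Rightarrow> bool" where
  "cns S X \<longleftrightarrow> S \<noteq> {} \<and> S \<subseteq> V \<and> X \<subseteq> E \<and> sp X \<subseteq> S \<and> (\<forall>x\<in>S. \<forall>y\<in>S. con X x y)"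

definition conn :: "'v set \<Rightarrow> bool" where
  "conn S \<longleftrightarrow> cns S (inside S)"

definition adj :: "'v \<Rightarrow> 'v \<Rightarrow> bool" where
  "adj x y \<longleftrightarrow> (\<exists>e\<in>E. en e = {x, y})"

definition nadj :: "'v set \<Rightarrow> 'v set \<Rightarrow> bool" where
  "nadj A D \<longleftrightarrow> (\<forall>e\<in>E. en e \<inter> A = {} \<or> en e \<inter> D = {})"

definition cut :: "'v \<Rightarrow> 'v \<Rightarrow> 'v set \<Rightarrow> 'v set \<Rightarrow> bool" where
  "cut u v A D \<longleftrightarrow> u \<noteq> v \<and> u \<in> V \<and> v \<in> V \<and> A \<noteq> {} \<and> D \<noteq> {} \<and> A \<union> D = V - {u, v} \<and>
     A \<inter> D = {} \<and> nadj A D"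

lemma inside_sub: "inside S \<subseteq> E" "sp (inside S) \<subseteq> S"
  by (auto simp: inside_def span_verts_def)

lemma inside_mono: "S \<subseteq> T \<Longrightarrow> inside S \<subseteq> inside T"
  by (auto simp: inside_def)

lemma inside_V: "inside V = E"
  using ends_subset by (auto simp: inside_def)

lemma inside_Int: "inside S \<inter> inside T = inside (S \<inter> T)"
  by (auto simp: inside_def)

lemma inside_iff: "X \<subseteq> E \<Longrightarrow> X \<subseteq> inside S \<longleftrightarrow> sp X \<subseteq> S"
  by (auto simp: inside_def span_verts_def)

lemma cnsD:
  assumes "cns S X"
  shows "S \<noteq> {}" "S \<subseteq> V" "X \<subseteq> E" "sp X \<subseteq> S" "\<And>x y. x \<in> S \<Longrightarrow> y \<in> S \<Longrightarrow> con X x y"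
  using assms by (auto simp: cns_def)

lemma cns_hubI:
  assumes "S \<subseteq> V" "X \<subseteq> E" "sp X \<subseteq> S" "h \<in> S" "\<And>w. w \<in> S \<Longrightarrow> con X h w"
  shows "cns S X"
proof -
  have "con X x y" if "x \<in> S" "y \<in> S" for x y
    using assms(5)[OF that(1)] assms(5)[OF that(2)] con_sym con_trans by metis
  then show ?thesis using assms unfolding cns_def by blast
qed

lemma cns_conn: "cns S X \<Longrightarrow> conn S"
  unfolding conn_def cns_def using con_mono[of X _ _ "inside S"] inside_sub inside_iff by metis

lemma connD:
  assumes "conn S"
  shows "S \<noteq> {}" "S \<subseteq> V" "\<And>x y. x \<in> S \<Longrightarrow> y \<in> S \<Longrightarrow> con (inside S) x y"
  using assms cnsD[of S "inside S"] unfolding conn_def by metis+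

lemma cns_Un:
  assumes "cns S X" "cns T Y" "S \<inter> T \<noteq> {}"
  shows "cns (S \<union> T) (X \<union> Y)"
proof -
  obtain z where z: "z \<in> S" "z \<in> T" using assms(3) by blast
  have "con (X \<union> Y) z w" if w: "w \<in> S \<union> T" for w
  proof (cases "w \<in> S")
    case True
    then show ?thesis using con_mono[OF cnsD(5)[OF assms(1) z(1)]] by blast
  next
    case False
    then show ?thesis using con_mono[OF cnsD(5)[OF assms(2) z(2)]] w by blast
  qed
  moreover have "S \<union> T \<subseteq> V" "X \<union> Y \<subseteq> E" "sp (X \<union> Y) \<subseteq> S \<union> T"
    unfolding sp_Un using cnsD(2-4)[OF assms(1)] cnsD(2-4)[OF assms(2)] by auto
  ultimately show ?thesis using cns_hubI[of "S \<union> T" "X \<union> Y" z] z by blast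
qed

lemma conn_Un: "conn S \<Longrightarrow> conn T \<Longrightarrow> S \<inter> T \<noteq> {} \<Longrightarrow> conn (S \<union> T)"
  using cns_conn[OF cns_Un] unfolding conn_def .

lemma conn_single: "x \<in> V \<Longrightarrow> conn {x}"
  using inside_sub unfolding conn_def cns_def by auto

lemma adj_V: "adj x y \<Longrightarrow> x \<in> V \<and> y \<in> V"
  using ends_subset unfolding adj_def by blast

lemma adj_sym: "adj x y \<Longrightarrow> adj y x"
  unfolding adj_def by (simp add: insert_commute)

lemma conn_pairI: assumes "adj x y" shows "conn {x, y}"
proof -
  obtain e where e: "e \<in> E" "en e = {x, y}" using assms by (auto simp: adj_def)
  then have "con (inside {x, y}) x y" using con_edge[of e "inside {x, y}" x y] by (auto simp: inside_def)
  then show ?thesis unfolding conn_def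
    by (intro cns_hubI[of _ _ x] inside_sub) (use adj_V[OF assms] in auto)
qed

lemma conn_adj:
  assumes "conn S" "conn T" "s \<in> S" "t \<in> T" "adj s t" shows "conn (S \<union> T)"
proof -
  have "conn (S \<union> {s, t})" using conn_Un[OF assms(1) conn_pairI[OF assms(5)]] assms by blast
  then have "conn (S \<union> {s, t} \<union> T)" using conn_Un[OF _ assms(2)] assms by blast
  moreover have "S \<union> {s, t} \<union> T = S \<union> T" using assms by auto
  ultimately show ?thesis by simp
qed

lemma conn_insert:
  assumes "conn S" "s \<in> S" "adj s t" shows "conn (insert t S)"
  using conn_adj[OF assms(1) conn_single _ _ assms(3)] adj_V[OF assms(3)] assms(2) by (simp add: Un_commute)

lemma conn_neighbor:
  assumes "conn S" "v \<in> S" "w \<in> S" "w \<noteq> v"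
  obtains y where "y \<in> S" "y \<noteq> v" "adj v y"
proof -
  have "\<exists>y\<in>S. y \<noteq> v \<and> adj v y"
  proof (rule ccontr)
    assume n: "\<not> ?thesis"
    have "w \<in> {v}"
    proof (rule con_closed[OF connD(3)[OF assms(1-3)]])
      fix e assume e: "e \<in> inside S" "en e \<inter> {v} \<noteq> {}"
      then have eE: "e \<in> E" and eS: "en e \<subseteq> S" "v \<in> en e" by (auto simp: inside_def)
      obtain y where y: "en e = {v, y}" using obtain_other_end[OF eE eS(2)] .
      then have "y = v" using n eE eS(1) unfolding adj_def by auto
      then show "en e \<subseteq> {v}" using y by simp
    qed simp
    then show False using assms(4) by simp
  qed
  then show ?thesis using that by blast
qed

lemma conn_pairD: "conn {a, b} \<Longrightarrow> a \<noteq> b \<Longrightarrow> adj a b"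
  by (rule conn_neighbor[of "{a, b}" a b]) auto

lemma nadjI:
  assumes "A \<inter> D = {}" "\<And>a d. a \<in> A \<Longrightarrow> d \<in> D \<Longrightarrow> \<not> adj a d" shows "nadj A D"
  unfolding nadj_def
proof (intro ballI, rule ccontr)
  fix e assume e: "e \<in> E" "\<not> (en e \<inter> A = {} \<or> en e \<inter> D = {})"
  then obtain a d where ad: "a \<in> en e" "a \<in> A" "d \<in> en e" "d \<in> D" by blast
  obtain y where "en e = {a, y}" using obtain_other_end[OF e(1) ad(1)] .
  moreover have "a \<noteq> d" using ad assms(1) by blast
  ultimately have "en e = {a, d}" using ad by auto
  then show False using assms(2) ad e(1) unfolding adj_def by blast
qed

lemma nadjD: "nadj A D \<Longrightarrow> a \<in> A \<Longrightarrow> d \<in> D \<Longrightarrow> \<not> adj a d"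
  unfolding nadj_def adj_def by blast

lemma nadj_sym: "nadj A D \<Longrightarrow> nadj D A"
  unfolding nadj_def by blast

lemma not_conn_split:
  assumes "S \<subseteq> V" "x \<in> S" "\<not> conn S"
  obtains P where "x \<in> P" "P \<subset> S" "nadj P (S - P)" "\<And>y. y \<in> P \<Longrightarrow> con (inside S) x y"
proof -
  define P where "P = {y \<in> S. con (inside S) x y}"
  have "P \<noteq> S"
  proof
    assume "P = S"
    then have "cns S (inside S)" using cns_hubI[OF assms(1) inside_sub assms(2)] by (auto simp: P_def)
    then show False using assms(3) by (simp add: conn_def)
  qed
  moreover have "nadj P (S - P)"
  proof (rule nadjI)
    fix a d assume ad: "a \<in> P" "d \<in> S - P"
    show "\<not> adj a d"
    proof
      assume "adj a d"
      then obtain e where e: "e \<in> E" "en e = {a, d}" by (auto simp: adj_def)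
      then have "con (inside S) a d" using ad by (intro con_edge) (auto simp: inside_def P_def)
      then have "con (inside S) x d" using ad(1) con_trans unfolding P_def by blast
      then show False using ad by (auto simp: P_def)
    qed
  qed auto
  moreover have "x \<in> P" "P \<subseteq> S" using assms(2) by (auto simp: P_def)
  moreover have "con (inside S) x y" if "y \<in> P" for y using that by (simp add: P_def)
  ultimately show ?thesis using that[of P] by blast
qed

text \<open>A walk leaving \<open>A\<close> must pass \<open>U\<close>, and until then it uses only
  edges that meet \<open>A\<close>. This records where the connection runs, not just that it
  exists.\<close>

lemma exit:
  assumes "con X w t" "w \<in> A" "t \<notin> A" "\<And>e. e \<in> X \<Longrightarrow> en e \<inter> A \<noteq> {} \<Longrightarrow> en e \<subseteq> A \<union> U" "X \<subseteq> E"
  shows "\<exists>u\<in>U. con {e \<in> X. en e \<inter> A \<noteq> {}} w u"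
proof (rule ccontr)
  assume n: "\<not> ?thesis"
  let ?X = "{e \<in> X. en e \<inter> A \<noteq> {}}"
  have "t \<in> {x \<in> A. con ?X w x}"
  proof (rule con_closed[OF assms(1)])
    fix e assume e: "e \<in> X" "en e \<inter> {x \<in> A. con ?X w x} \<noteq> {}"
    then obtain x where x: "x \<in> en e" "x \<in> A" "con ?X w x" by blast
    show "en e \<subseteq> {x \<in> A. con ?X w x}"
    proof
      fix y assume y: "y \<in> en e"
      have "con ?X x y" using con_ends[of e ?X x y] e(1) x y assms(5) by blast
      then have c: "con ?X w y" using x(3) con_trans by blast
      moreover have "y \<in> A \<union> U" using assms(4)[OF e(1)] x y by blast
      ultimately show "y \<in> {x \<in> A. con ?X w x}" using n by blast
    qed
  qed (use assms(2) in simp)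
  then show False using assms(3) by simp
qed

text \<open>The usual pattern for connectivity below: a connected core \<open>H\<close> and a link
  to it from each remaining vertex.\<close>

lemma conn_hub:
  assumes H: "conn H" "H \<subseteq> S" "S \<subseteq> V" and w: "\<And>w. w \<in> S \<Longrightarrow> w \<notin> H \<Longrightarrow> \<exists>h\<in>H. con (inside S) w h"
  shows "conn S"
proof -
  obtain z where z: "z \<in> H" using connD(1)[OF H(1)] by blast
  have zh: "con (inside S) z h" if "h \<in> H" for h
    using con_mono[OF connD(3)[OF H(1) z that] inside_mono[OF H(2)]] .
  have "con (inside S) z x" if x: "x \<in> S" for x
  proof (cases "x \<in> H")
    case False
    then obtain h where "h \<in> H" "con (inside S) x h" using w x by blast
    then show ?thesis using zh con_sym con_trans by metis
  qed (rule zh)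
  then show ?thesis unfolding conn_def using cns_hubI[OF H(3) inside_sub, of z] z H(2) by blast
qed

lemma graph_connected_delete_iff:
  assumes "S \<subseteq> V" shows "graph_connected (delete_vertices G S) \<longleftrightarrow> conn (V - S)"
proof -
  have "{e \<in> E. en e \<inter> S = {}} = inside (V - S)" using ends_subset by (auto simp: inside_def)
  then have "graph_connected (delete_vertices G S) \<longleftrightarrow>
      V - S \<noteq> {} \<and> (\<forall>x\<in>V - S. \<forall>y\<in>V - S. con (inside (V - S)) x y)"
    by (simp add: graph_connected_def delete_vertices_def adjacency_def con_def)
  then show ?thesis using inside_sub unfolding conn_def cns_def by blast
qed

lemma cutD:
  assumes "cut u v A D"
  shows "u \<noteq> v" "u \<in> V" "v \<in> V" "A \<noteq> {}" "D \<noteq> {}" "A \<union> D = V - {u, v}" "A \<inter> D = {}" "nadj A D"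
    "A \<subseteq> V" "D \<subseteq> V" "u \<notin> A" "v \<notin> A" "u \<notin> D" "v \<notin> D"
  using assms unfolding cut_def by blast+

lemma cut_swap: "cut u v A D \<Longrightarrow> cut u v D A"
  unfolding cut_def by (metis Int_commute Un_commute nadj_sym)

lemma cut_flip: "cut u v A D \<Longrightarrow> cut v u A D"
  unfolding cut_def by (metis insert_commute)

lemma cut_card: assumes "cut u v A D" shows "card V = card A + card D + 2"
proof -
  note c = cutD[OF assms]
  have V: "V = A \<union> D \<union> {u, v}" using c(2,3,6) by blast
  have "finite A" "finite D" using c(9,10) finite_V finite_subset by blast+
  then show ?thesis unfolding V using c(1,7,11-14) by (simp add: card_Un_disjoint)
qed

lemma cut_edge:
  assumes "cut u v A D" "e \<in> E" "en e \<inter> A \<noteq> {}"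
  shows "en e \<subseteq> A \<union> {u, v}"
  using cutD(6,8)[OF assms(1)] assms(2,3) ends_subset[OF assms(2)] unfolding nadj_def by blast

text \<open>An edge has at most two ends, so one that meets \<open>A\<close> contains at most one of
  \<open>u\<close> and \<open>v\<close>.\<close>

lemma cut_edge_one:
  assumes "cut u v A D" "e \<in> E" "en e \<inter> A \<noteq> {}"
  shows "en e \<subseteq> A \<union> {u} \<or> en e \<subseteq> A \<union> {v}"
proof -
  obtain x where x: "x \<in> en e" "x \<in> A" using assms(3) by blast
  obtain y where "en e = {x, y}" using obtain_other_end[OF assms(2) x(1)] .
  then show ?thesis using cut_edge[OF assms] x by auto
qed

end

section \<open>Ranks and unions of connected subgraphs\<close>

context qbgraph
begin

abbreviation balv :: "'v set \<Rightarrow> bool" where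
  "balv S \<equiv> bal (inside S)"

lemma balv_mono: "balv T \<Longrightarrow> S \<subseteq> T \<Longrightarrow> balv S"
  using bal_mono inside_mono by blast

lemma rho_connected:
  assumes "cns S X"
  shows "rho X = card S - 1 + (if bal X then 0 else 1)"
proof -
  note c = cnsD[OF assms]
  have "card (comps X) = card V - card S + 1" using comps_connected(2)[OF c(2,1,4,5)] .
  moreover have "card S \<le> card V" using c(2) finite_V by (rule card_mono[rotated])
  moreover have "0 < card S" using c(1,2) finite_V finite_subset by (metis card_gt_0_iff)
  moreover have "(if hasL X then 1 else card (unbs X)) = (if bal X then 0 else 1)"
  proof (cases "bal X")
    case True
    then have "\<not> hasL X" "unbs X = {}" using classes(1,2) unfolding bal_def hasL_def unbs_def unb_at_def by blast+
    then show ?thesis using True by simp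
  next
    case False
    then obtain C where C: "C \<in> cycles" "C \<subseteq> X" "C \<notin> B" unfolding bal_def by blast
    then obtain w where w: "w \<in> sp C" using cycleD(6) by blast
    have "w \<in> V" using w cycleD(7)[OF C(1)] by blast
    moreover have "unb_at X w" unfolding unb_at_def using C w con_refl by blast
    ultimately have "comp X w \<in> unbs X" using comp_in_unbs_iff by blast
    then have "card (unbs X) \<noteq> 0" using finite_unbs by auto
    moreover have "card (unbs X) \<le> 1" by (rule card_unbs_connected) (use c in blast)
    ultimately show ?thesis using False by simp
  qed
  ultimately show ?thesis unfolding rho_def by linarith
qed

text \<open>Vertices outside \<open>S\<close> are balanced singleton components, so together with
  the unbalanced components they number at most \<open>card (comps X)\<close>. With an
  \<open>L\<close>-cycle the last summand is 1, no more than the number of unbalanced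
  components.\<close>

lemma rho_le_verts:
  assumes X: "X \<subseteq> E" "sp X \<subseteq> S" "S \<subseteq> V"
  shows "rho X \<le> card S"
proof -
  have c: "comp X v = {v}" "\<not> unb_at X v" if "v \<in> V - S" for v
  proof -
    have "con X v w \<longleftrightarrow> v = w" for w using con_eq_or_span[of X v w] that X by auto
    moreover have "v \<notin> sp C" if "C \<subseteq> X" for C using sp_mono[OF that] \<open>v \<in> V - S\<close> X by blast
    ultimately show "comp X v = {v}" "\<not> unb_at X v" using that by (auto simp: comp_def unb_at_def)
  qed
  let ?I = "(\<lambda>v. {v}) ` (V - S)"
  have "?I \<subseteq> comps X" using c by (auto simp: comps_def image_iff)
  moreover have "?I \<inter> unbs X = {}"
  proof -
    have "{v} \<notin> unbs X" if "v \<in> V - S" for v using comp_in_unbs_iff[of v X] c[OF that] that by auto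
    then show ?thesis by auto
  qed
  ultimately have "card ?I + card (unbs X) \<le> card (comps X)"
    using card_Un_disjoint[of ?I "unbs X"] card_mono[OF finite_comps, of "?I \<union> unbs X" X] finite_V finite_unbs unbs_sub
    by auto
  moreover have "card ?I = card V - card S"
    using X(3) finite_V by (simp add: card_image card_Diff_subset finite_subset)
  moreover have "hasL X \<Longrightarrow> card (unbs X) \<noteq> 0"
  proof -
    assume "hasL X"
    then obtain C where C: "C \<in> L" "C \<subseteq> X" unfolding hasL_def by blast
    then have Cc: "C \<in> cycles" "C \<notin> B" using classes by blast+
    then obtain w where w: "w \<in> sp C" using cycleD(6) by blast
    have "w \<in> V" using w cycleD(7)[OF Cc(1)] by blast
    moreover have "unb_at X w" unfolding unb_at_def using C Cc w con_refl by blast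
    ultimately have "comp X w \<in> unbs X" using comp_in_unbs_iff by blast
    then show ?thesis using finite_unbs by auto
  qed
  moreover have "card S \<le> card V" using X(3) finite_V by (rule card_mono[rotated])
  moreover have "card (comps X) \<le> card V" by (rule card_comps_le)
  ultimately show ?thesis unfolding rho_def by (cases "hasL X") auto
qed

text \<open>An unbalanced union would have rank \<open>card (S \<union> T)\<close>, one more than
  submodularity allows.\<close>

lemma bal_Un:
  assumes X: "cns S X" "bal X" and Y: "cns T Y" "bal Y" and Z: "cns (S \<inter> T) (X \<inter> Y)"
  shows "bal (X \<union> Y)"
proof (rule ccontr)
  assume n: "\<not> bal (X \<union> Y)"
  have U: "cns (S \<union> T) (X \<union> Y)" by (rule cns_Un[OF X(1) Y(1) cnsD(1)[OF Z]])
  have f: "finite S" "finite T" using X Y cnsD(2) finite_V finite_subset by metis+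
  have "bal (X \<inter> Y)" using bal_mono[OF X(2)] by blast
  then have "rho X = card S - 1" "rho Y = card T - 1" "rho (X \<inter> Y) = card (S \<inter> T) - 1"
    "rho (X \<union> Y) = card (S \<union> T) - 1 + 1"
    using rho_connected X Y Z U n by simp_all
  moreover have "rho (X \<union> Y) + rho (X \<inter> Y) \<le> rho X + rho Y"
    using r_submodular cnsD(3) X(1) Y(1) by metis
  moreover have "card (S \<union> T) + card (S \<inter> T) = card S + card T" using card_Un_Int[OF f] by simp
  moreover have "0 < card (S \<inter> T)" using cnsD(1)[OF Z] f by (simp add: card_gt_0_iff)
  moreover have "card (S \<inter> T) \<le> card S" "card (S \<inter> T) \<le> card T" "card S \<le> card (S \<union> T)"
    using f by (auto intro: card_mono)
  ultimately show False by linarith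
qed

end

text \<open>The assumption \<open>unbalanced\<close> stands for non-graphicness: if all cycles were
  in \<open>B\<close>, then \<open>M\<close> would be the cycle matroid of \<open>G\<close>.\<close>

locale unbreakable_qbgraph = qbgraph +
  assumes three: "n_connected_matroid 3 M"
    and unbreak: "unbreakable M"
    and two: "k_connected_graph 2 G"
    and unbalanced: "\<not> bal E"
begin

lemma conn_delete:
  assumes "S \<subseteq> V" "card S < 2" shows "conn (V - S)"
  using two assms graph_connected_delete_iff[OF assms(1)] by (simp add: k_connected_graph_def)

lemma conn_V: "conn V"
  using conn_delete[of "{}"] by simp

lemma conn_minus1: "x \<in> V \<Longrightarrow> conn (V - {x})"
  using conn_delete[of "{x}"] by simp

lemma rho_E: "rho E = card V"
proof -
  have "cns V E" using conn_V by (simp add: conn_def inside_V)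
  moreover have "0 < card V" using connD(1)[OF conn_V] finite_V by (simp add: card_gt_0_iff)
  ultimately show ?thesis using rho_connected unbalanced by simp
qed

text \<open>After the edges inside \<open>Z\<close> are contracted, those at \<open>P\<close> have
  rank at most \<open>card P\<close>, those at \<open>Q\<close> at most \<open>card Q\<close>, and
  together they have rank \<open>card V - card Z\<close>, the sum of both bounds. So the contraction
  is a direct sum.\<close>

lemma full_no_split:
  assumes Z: "Z \<subseteq> V" "card Z \<le> rho (inside Z)"
    and PQ: "V - Z = P \<union> Q" "P \<inter> Q = {}" "P \<noteq> {}" "Q \<noteq> {}" "nadj P Q"
  shows False
proof -
  define X where "X = {e \<in> E. en e \<inter> P \<noteq> {}}"
  define Y where "Y = {e \<in> E. en e \<inter> Q \<noteq> {}}"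
  let ?F = "inside Z"
  have E: "E = ?F \<union> X \<union> Y" using PQ(1) ends_subset by (fastforce simp: X_def Y_def inside_def)
  have dis: "X \<inter> Y = {}" using PQ(5) by (auto simp: X_def Y_def nadj_def)
  have sub: "?F \<subseteq> E" "X \<subseteq> E" "Y \<subseteq> E" using E by auto
  have FX: "rho (?F \<union> X) \<le> card (Z \<union> P)"
  proof (rule rho_le_verts)
    show "sp (?F \<union> X) \<subseteq> Z \<union> P"
      using PQ(1,5) ends_subset by (fastforce simp: span_verts_def X_def inside_def nadj_def)
  qed (use sub Z PQ in auto)
  have FY: "rho (?F \<union> Y) \<le> card (Z \<union> Q)"
  proof (rule rho_le_verts)
    show "sp (?F \<union> Y) \<subseteq> Z \<union> Q"
      using PQ(1,5) ends_subset by (fastforce simp: span_verts_def Y_def inside_def nadj_def)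
  qed (use sub Z PQ in auto)
  have f: "finite Z" "finite P" "finite Q" using Z PQ(1) finite_V finite_subset by (metis Diff_subset Un_subset_iff)+
  have V: "V = Z \<union> P \<union> Q" "Z \<inter> P = {}" "Z \<inter> Q = {}" using Z PQ by auto
  have cV: "card V = card Z + card P + card Q" "card (Z \<union> P) = card Z + card P" "card (Z \<union> Q) = card Z + card Q"
    using V f PQ(2) by (simp_all add: card_Un_disjoint Int_Un_distrib2)
  have pos: "0 < card P" "0 < card Q" using f PQ by (auto simp: card_gt_0_iff)
  have rF: "rho ?F = card Z" using rho_le_verts[OF sub(1) inside_sub(2) Z(1)] Z(2) by simp
  have "rho (?F \<union> X \<union> (?F \<union> Y)) + rho ((?F \<union> X) \<inter> (?F \<union> Y)) \<le> rho (?F \<union> X) + rho (?F \<union> Y)"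
    by (rule r_submodular) (use sub in auto)
  moreover have "?F \<union> X \<union> (?F \<union> Y) = E" using E by blast
  moreover have "rho ?F \<le> rho ((?F \<union> X) \<inter> (?F \<union> Y))" by (rule r_mono) (use sub in auto)
  ultimately have "rho E + rho ?F \<le> rho (?F \<union> X) + rho (?F \<union> Y)" by simp
  then have "rho ?F < rho (?F \<union> X)" "rho ?F < rho (?F \<union> Y)" "rho (?F \<union> X) + rho (?F \<union> Y) \<le> rho E + rho ?F"
    using FX FY cV pos rF rho_E by linarith+
  then show False using unbreakable_no_separation[OF unbreak E dis] by blast
qed

lemma unbalanced_complement_connected:
  assumes S: "conn S" "\<not> balv S" "S \<noteq> V" shows "conn (V - S)"
proof (rule ccontr)
  assume n: "\<not> conn (V - S)"
  have SV: "S \<subseteq> V" using connD(2)[OF S(1)] .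
  obtain x where x: "x \<in> V - S" using S(3) SV by blast
  obtain P where P: "x \<in> P" "P \<subset> V - S" "nadj P (V - S - P)" using not_conn_split[OF _ x n] by (metis Diff_subset)
  have "0 < card S" using connD(1)[OF S(1)] SV finite_V finite_subset by (metis card_gt_0_iff)
  then have "card S \<le> rho (inside S)" using rho_connected[of S "inside S"] S unfolding conn_def by simp
  then show False using full_no_split[OF SV, of P "V - S - P"] P by blast
qed

lemma unbalanced_complement_pair:
  assumes "a \<in> V" "b \<in> V" "a \<noteq> b" "\<not> adj a b" "conn (V - {a, b})" shows "balv (V - {a, b})"
proof (rule ccontr)
  assume "\<not> ?thesis"
  then have "conn (V - (V - {a, b}))" using unbalanced_complement_connected assms by blast
  moreover have "V - (V - {a, b}) = {a, b}" using assms by blast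
  ultimately show False using conn_pairD assms by metis
qed

text \<open>Deleting \<open>v\<close> leaves \<open>G\<close> connected, and \<open>u\<close> is
  then the only exit from \<open>A\<close>.\<close>

lemma cut_attach:
  assumes c: "cut u v A D" and w: "w \<in> A"
  shows "con {e \<in> E. en e \<inter> A \<noteq> {} \<and> en e \<subseteq> A \<union> {u}} w u"
proof -
  note d = cutD[OF c]
  have "con (inside (V - {v})) w u" using connD(3)[OF conn_minus1[OF d(3)]] w d by blast
  moreover have "en e \<subseteq> A \<union> {u}" if "e \<in> inside (V - {v})" "en e \<inter> A \<noteq> {}" for e
    using cut_edge[OF c _ that(2)] that(1) by (auto simp: inside_def)
  ultimately have "\<exists>u'\<in>{u}. con {e \<in> inside (V - {v}). en e \<inter> A \<noteq> {}} w u'"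
    using exit[of "inside (V - {v})" w u A "{u}"] w d(11) inside_sub(1) by blast
  moreover have "{e \<in> inside (V - {v}). en e \<inter> A \<noteq> {}} \<subseteq> {e \<in> E. en e \<inter> A \<noteq> {} \<and> en e \<subseteq> A \<union> {u}}"
    using cut_edge[OF c] by (auto simp: inside_def)
  ultimately show ?thesis using con_mono by blast
qed

text \<open>The edge set leaves out loops at \<open>u\<close>. Thus the sets for \<open>u\<close>
  and for \<open>v\<close> intersect exactly in the edges inside \<open>A\<close>, and their union
  consists of all edges that meet \<open>A\<close>.\<close>

lemma cut_cns1:
  assumes c: "cut u v A D" shows "cns (A \<union> {u}) {e \<in> E. en e \<inter> A \<noteq> {} \<and> en e \<subseteq> A \<union> {u}}"
  by (rule cns_hubI[of _ _ u]) (use cutD[OF c] cut_attach[OF c] con_sym in \<open>auto simp: span_verts_def\<close>)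

lemma cut_conn1: "cut u v A D \<Longrightarrow> conn (A \<union> {u})"
  by (rule cns_conn[OF cut_cns1])

lemma cut_cns2:
  assumes c: "cut u v A D" shows "cns (A \<union> {u, v}) {e \<in> E. en e \<inter> A \<noteq> {}}"
proof -
  let ?X = "\<lambda>u. {e \<in> E. en e \<inter> A \<noteq> {} \<and> en e \<subseteq> A \<union> {u}}"
  have "cns (A \<union> {u} \<union> (A \<union> {v})) (?X u \<union> ?X v)"
    using cns_Un[OF cut_cns1[OF c] cut_cns1[OF cut_flip[OF c]]] cutD(4)[OF c] by blast
  moreover have "?X u \<union> ?X v = {e \<in> E. en e \<inter> A \<noteq> {}}" using cut_edge_one[OF c] by blast
  moreover have "A \<union> {u} \<union> (A \<union> {v}) = A \<union> {u, v}" by auto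
  ultimately show ?thesis by simp
qed

lemma cut_conn2: "cut u v A D \<Longrightarrow> conn (A \<union> {u, v})"
  by (rule cns_conn[OF cut_cns2])

lemma card_cns: "cns S X \<Longrightarrow> card S \<le> card X + 1"
  using card_comps_lower[of X] comps_connected(2)[of S X] cnsD[of S X] card_mono[OF finite_V, of S] by auto

text \<open>If balanced, this set has rank \<open>card A + 1\<close> and its complement at most
  \<open>card D + 2\<close>, in total at most \<open>rho E + 1\<close>: a 2-separation. Both parts
  have at least two edges, since each contains a connected subgraph on at least three
  vertices.\<close>

lemma cut_unbalanced:
  assumes c: "cut u v A D" shows "\<not> bal {e \<in> E. en e \<inter> A \<noteq> {}}"
proof
  let ?X = "{e \<in> E. en e \<inter> A \<noteq> {}}" and ?Y = "{e \<in> E. en e \<inter> D \<noteq> {}}"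
  assume b: "bal ?X"
  note d = cutD[OF c]
  have f: "finite A" "finite D" using d finite_V finite_subset by metis+
  have cA: "card (A \<union> {u, v}) = card A + 2" and cD: "card (D \<union> {u, v}) = card D + 2"
    using d f by (simp_all add: card_Un_disjoint)
  have "card (E - ?X) \<ge> card ?Y"
    by (rule card_mono) (use finite_E d(8) in \<open>auto simp: nadj_def\<close>)
  moreover have "0 < card A" "0 < card D" using d f by (auto simp: card_gt_0_iff)
  ultimately have "2 \<le> card ?X" "2 \<le> card (E - ?X)"
    using card_cns[OF cut_cns2[OF c]] card_cns[OF cut_cns2[OF cut_swap[OF c]]] cA cD by linarith+
  then have "rho E + 2 \<le> rho ?X + rho (E - ?X)" by (intro three_connected_no_separation[OF three]) auto
  moreover have "rho ?X = card A + 1" using rho_connected[OF cut_cns2[OF c]] b cA by simp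
  moreover have "rho (E - ?X) \<le> card (D \<union> {u, v})"
  proof (rule rho_le_verts)
    show "sp (E - ?X) \<subseteq> D \<union> {u, v}" using d(6) ends_subset by (fastforce simp: span_verts_def)
  qed (use d in auto)
  ultimately show False using rho_E cut_card[OF c] cD by linarith
qed

lemma cut_not_balv: assumes c: "cut u v A D" shows "\<not> balv (A \<union> {u, v})"
proof
  assume "balv (A \<union> {u, v})"
  then have "bal {e \<in> E. en e \<inter> A \<noteq> {}}" by (rule bal_mono) (use cut_edge[OF c] in \<open>auto simp: inside_def\<close>)
  then show False using cut_unbalanced[OF c] by blast
qed

text \<open>A side together with \<open>u\<close> and \<open>v\<close> is connected and unbalanced,
  so its complement, the opposite side, is connected.\<close>

lemma cut_conn: assumes c: "cut u v A D" shows "conn A" "conn D"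
proof -
  have "conn D" if c: "cut u v A D" for A D
  proof -
    note d = cutD[OF c]
    have "conn (V - (A \<union> {u, v}))"
      by (rule unbalanced_complement_connected[OF cut_conn2[OF c] cut_not_balv[OF c]]) (use d in blast)
    moreover have "V - (A \<union> {u, v}) = D" using d by blast
    ultimately show ?thesis by simp
  qed
  then show "conn A" "conn D" using c cut_swap by blast+
qed

text \<open>The two subgraphs overlap in the connected set \<open>A\<close>, so balance would pass
  to all edges that meet \<open>A\<close>.\<close>

lemma cut_not_both_balv:
  assumes c: "cut u v A D" "balv (A \<union> {u})" "balv (A \<union> {v})" shows False
proof -
  let ?X = "\<lambda>u. {e \<in> E. en e \<inter> A \<noteq> {} \<and> en e \<subseteq> A \<union> {u}}"
  note d = cutD[OF c(1)]
  have "bal (?X u)" "bal (?X v)" by (rule bal_mono[OF c(2)], force simp: inside_def) (rule bal_mono[OF c(3)], force simp: inside_def)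
  moreover have "cns ((A \<union> {u}) \<inter> (A \<union> {v})) (?X u \<inter> ?X v)"
  proof -
    have "(A \<union> {u}) \<inter> (A \<union> {v}) = A" using d by blast
    moreover have "?X u \<inter> ?X v = inside A" using d ends_nonempty by (fastforce simp: inside_def)
    ultimately show ?thesis using cut_conn(1)[OF c(1)] by (simp add: conn_def)
  qed
  ultimately have "bal (?X u \<union> ?X v)" using bal_Un[OF cut_cns1[OF c(1)] _ cut_cns1[OF cut_flip[OF c(1)]]] by blast
  moreover have "?X u \<union> ?X v = {e \<in> E. en e \<inter> A \<noteq> {}}" using cut_edge_one[OF c(1)] by blast
  ultimately show False using cut_unbalanced[OF c(1)] by simp
qed

section \<open>Good vertices of a side\<close>

lemma side_minus_attach:
  assumes c: "cut u v A D" and a: "a \<in> A" and w: "w \<in> A" "w \<noteq> a"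
  shows "\<exists>h\<in>{u, v}. con (inside (A \<union> {u, v} - {a})) w h"
proof -
  note d = cutD[OF c]
  have "con (inside (V - {a})) w u" using connD(3)[OF conn_minus1[of a]] a w d by blast
  moreover have "en e \<subseteq> (A - {a}) \<union> {u, v}" if "e \<in> inside (V - {a})" "en e \<inter> (A - {a}) \<noteq> {}" for e
    using cut_edge[OF c, of e] that by (auto simp: inside_def)
  ultimately obtain h where h: "h \<in> {u, v}" "con {e \<in> inside (V - {a}). en e \<inter> (A - {a}) \<noteq> {}} w h"
    using exit[of "inside (V - {a})" w u "A - {a}" "{u, v}"] w d(11) inside_sub(1) by blast
  moreover have "{e \<in> inside (V - {a}). en e \<inter> (A - {a}) \<noteq> {}} \<subseteq> inside (A \<union> {u, v} - {a})"
  proof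
    fix e assume e: "e \<in> {e \<in> inside (V - {a}). en e \<inter> (A - {a}) \<noteq> {}}"
    then have "en e \<subseteq> A \<union> {u, v}" using cut_edge[OF c, of e] by (auto simp: inside_def)
    then show "e \<in> inside (A \<union> {u, v} - {a})" using e by (auto simp: inside_def)
  qed
  ultimately show ?thesis using con_mono by blast
qed

lemma side_minus_conn:
  assumes c: "cut u v A D" and a: "a \<in> A" and H: "conn H" "{u, v} \<subseteq> H" "H \<subseteq> A \<union> {u, v} - {a}"
  shows "conn (A \<union> {u, v} - {a})"
proof (rule conn_hub[OF H(1,3)])
  show "A \<union> {u, v} - {a} \<subseteq> V" using cutD(2,3,9)[OF c] by blast
  fix w assume w: "w \<in> A \<union> {u, v} - {a}" "w \<notin> H"
  then have "w \<in> A" "w \<noteq> a" using H(2) by auto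
  then obtain h where "h \<in> {u, v}" "con (inside (A \<union> {u, v} - {a})) w h" using side_minus_attach[OF c a] by blast
  then show "\<exists>h\<in>H. con (inside (A \<union> {u, v} - {a})) w h" using H(2) by blast
qed

text \<open>An edge between \<open>u\<close> and \<open>v\<close> is by itself a connected core to
  which the rest of the side attaches.\<close>

lemma bad_not_adj:
  assumes c: "cut u v A D" and a: "a \<in> A" "\<not> conn (A \<union> {u, v} - {a})" shows "\<not> adj u v"
proof
  assume "adj u v"
  then have "conn (A \<union> {u, v} - {a})"
    using side_minus_conn[OF c a(1) conn_pairI] a(1) cutD(11,12)[OF c] by blast
  then show False using a by blast
qed

lemma good_conn:
  assumes c: "cut u v A D" and a: "a \<in> A" and b: "b \<in> D" "conn (D \<union> {u, v} - {b})"
  shows "conn (V - {a, b})"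
proof (rule conn_hub[OF b(2)])
  note d = cutD[OF c]
  show "D \<union> {u, v} - {b} \<subseteq> V - {a, b}" using d a by auto
  show "V - {a, b} \<subseteq> V" by blast
  fix w assume w: "w \<in> V - {a, b}" "w \<notin> D \<union> {u, v} - {b}"
  then have "w \<in> A" "w \<noteq> a" using d(6) by auto
  then obtain h where h: "h \<in> {u, v}" "con (inside (A \<union> {u, v} - {a})) w h" using side_minus_attach[OF c a] by blast
  have "inside (A \<union> {u, v} - {a}) \<subseteq> inside (V - {a, b})" by (rule inside_mono) (use d b in auto)
  then have "con (inside (V - {a, b})) w h" using h(2) con_mono by blast
  moreover have "h \<in> D \<union> {u, v} - {b}" using h(1) d b by auto
  ultimately show "\<exists>h\<in>D \<union> {u, v} - {b}. con (inside (V - {a, b})) w h" by blast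
qed

lemma good_balv:
  assumes c: "cut u v A D" and a: "a \<in> A" and b: "b \<in> D" "conn (D \<union> {u, v} - {b})"
  shows "balv (V - {a, b})"
proof (rule unbalanced_complement_pair)
  show "a \<in> V" "b \<in> V" using cutD(9,10)[OF c] a b by blast+
  show "a \<noteq> b" using cutD(7)[OF c] a b by blast
  show "\<not> adj a b" using nadjD[OF cutD(8)[OF c] a b(1)] .
qed (rule good_conn[OF assms])

text \<open>The vertices \<open>K\<close> cut off from \<open>H\<close> would form a side of the cut
  \<open>{a, a'}\<close>. The two balance hypotheses make \<open>K \<union> {a}\<close> and
  \<open>K \<union> {a'}\<close> balanced, which no side of a cut allows.\<close>

lemma pair_conn:
  assumes c: "cut u v A D" and H: "conn H" "{u, v} \<subseteq> H" "H \<subseteq> D \<union> {u, v}"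
    and a: "a \<in> A" "a' \<in> A" "a \<noteq> a'" and b: "balv (A - {a'})" "balv (A - {a})"
  shows "conn (H \<union> A - {a, a'})"
proof -
  note d = cutD[OF c]
  let ?S = "H \<union> A - {a, a'}"
  define K where "K = {w \<in> A - {a, a'}. \<not> (\<exists>h\<in>H. con (inside ?S) w h)}"
  have aH: "a \<notin> H" "a' \<notin> H" using H(3) a d by blast+
  have "K = {}"
  proof (rule ccontr)
    assume ne: "K \<noteq> {}"
    have "nadj K (V - {a, a'} - K)"
    proof (rule nadjI)
      fix k y assume k: "k \<in> K" and y: "y \<in> V - {a, a'} - K"
      have kA: "k \<in> A" using k by (simp add: K_def)
      show "\<not> adj k y"
      proof
        assume "adj k y"
        then obtain e where e: "e \<in> E" "en e = {k, y}" by (auto simp: adj_def)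
        then have "y \<in> A \<union> {u, v}" using cut_edge[OF c e(1)] kA by auto
        then have yS: "y \<in> ?S" using y H(2) by auto
        then have "con (inside ?S) k y" using e k y by (intro con_edge) (auto simp: inside_def K_def)
        moreover have "\<exists>h\<in>H. con (inside ?S) y h"
        proof (cases "y \<in> H")
          case False
          then show ?thesis using yS y unfolding K_def by blast
        qed (use con_refl in blast)
        ultimately have "\<exists>h\<in>H. con (inside ?S) k h" using con_trans by blast
        then show False using k by (simp add: K_def)
      qed
    qed blast
    moreover have "u \<in> V - {a, a'} - K" using d a by (auto simp: K_def)
    moreover have "K \<subseteq> V - {a, a'}" using d by (auto simp: K_def)
    ultimately have "cut a a' K (V - {a, a'} - K)"
      unfolding cut_def using a d ne by auto
    moreover have "balv (K \<union> {a})" "balv (K \<union> {a'})"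
      by (rule balv_mono[OF b(1)], use a in \<open>auto simp: K_def\<close>) (rule balv_mono[OF b(2)], use a in \<open>auto simp: K_def\<close>)
    ultimately show False using cut_not_both_balv by blast
  qed
  then show ?thesis
    by (intro conn_hub[OF H(1)]) (use aH d connD(2)[OF H(1)] in \<open>auto simp: K_def\<close>)
qed

text \<open>Every edge avoids one of the three vertices. The union of the first two pieces lacks
  only the edges between \<open>a1\<close> and \<open>a2\<close>, and the third piece supplies
  them.\<close>

lemma triple_balv:
  assumes SV: "S \<subseteq> V" and a: "a1 \<in> S" "a2 \<in> S" "a3 \<in> S" "a1 \<noteq> a2" "a1 \<noteq> a3" "a2 \<noteq> a3"
    and z: "z \<in> S - {a1, a2, a3}"
    and conn: "conn (S - {a1})" "conn (S - {a2})" "conn (S - {a3})" "conn (S - {a1, a2})" "conn (S - {a1, a3})" "conn (S - {a2, a3})"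
    and bal: "balv (S - {a1})" "balv (S - {a2})" "balv (S - {a3})"
  shows "balv S"
proof -
  let ?E1 = "inside (S - {a1})" and ?E2 = "inside (S - {a2})" and ?E3 = "inside (S - {a3})"
  have 12: "(S - {a1}) \<inter> (S - {a2}) = S - {a1, a2}" "(S - {a1}) \<union> (S - {a2}) = S" using a by auto
  have c12: "cns (S - {a1, a2}) (?E1 \<inter> ?E2)" using conn(4) unfolding inside_Int 12 conn_def .
  have b12: "bal (?E1 \<union> ?E2)"
    using bal_Un[of "S - {a1}" ?E1 "S - {a2}" ?E2] conn(1,2) bal(1,2) c12 unfolding conn_def 12 by blast
  have d12: "cns S (?E1 \<union> ?E2)"
    using cns_Un[of "S - {a1}" ?E1 "S - {a2}" ?E2] conn(1,2) z unfolding conn_def 12 by blast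
  \<comment> \<open>The intersection with the third piece need not be induced; it is connected
    because its two parts share \<open>z\<close>.\<close>
  have "cns (S - {a1, a3} \<union> (S - {a2, a3})) (inside (S - {a1, a3}) \<union> inside (S - {a2, a3}))"
    using cns_Un conn(5,6) z unfolding conn_def by blast
  moreover have "S - {a1, a3} \<union> (S - {a2, a3}) = S - {a3}" using a by auto
  moreover have "inside (S - {a1, a3}) \<union> inside (S - {a2, a3}) = (?E1 \<union> ?E2) \<inter> ?E3"
    by (auto simp: inside_def)
  moreover have "S \<inter> (S - {a3}) = S - {a3}" by blast
  ultimately have "cns (S \<inter> (S - {a3})) ((?E1 \<union> ?E2) \<inter> ?E3)" by simp
  then have "bal (?E1 \<union> ?E2 \<union> ?E3)" using bal_Un[OF d12 b12] conn(3) bal(3) unfolding conn_def by blast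
  moreover have "inside S \<subseteq> ?E1 \<union> ?E2 \<union> ?E3"
  proof
    fix e assume e: "e \<in> inside S"
    then have "e \<in> E" by (simp add: inside_def)
    then obtain x y where "en e = {x, y}" by (rule obtain_ends)
    then show "e \<in> ?E1 \<union> ?E2 \<union> ?E3" using e a by (auto simp: inside_def)
  qed
  ultimately show ?thesis using bal_mono by blast
qed

lemma obtain_three:
  assumes "finite A" "3 \<le> card A"
  obtains a1 a2 a3 where "a1 \<in> A" "a2 \<in> A" "a3 \<in> A" "a1 \<noteq> a2" "a1 \<noteq> a3" "a2 \<noteq> a3"
proof -
  obtain T where T: "T \<subseteq> A" "card T = 3" using obtain_subset_with_card_n[OF assms(2)] by metis
  then obtain x y z where "T = {x, y, z}" "x \<noteq> y" "y \<noteq> z" "x \<noteq> z" by (auto simp: card_3_iff)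
  then show ?thesis using that[of x y z] T by auto
qed

lemma good_card:
  assumes c: "cut u v A D" and b: "b \<in> D" "conn (D \<union> {u, v} - {b})"
  shows "card A \<le> 2"
proof (rule ccontr)
  assume n: "\<not> ?thesis"
  note d = cutD[OF c]
  have "finite A" using d finite_V finite_subset by metis
  then obtain a1 a2 a3 where a: "a1 \<in> A" "a2 \<in> A" "a3 \<in> A" "a1 \<noteq> a2" "a1 \<noteq> a3" "a2 \<noteq> a3"
    using obtain_three[of A] n by auto
  have bA: "b \<notin> A" using b d by blast
  have eq1: "V - {b} - {x} = V - {x, b}" for x by auto
  have bal: "balv (V - {b} - {x})" "conn (V - {b} - {x})" if "x \<in> A" for x
    using good_balv[OF c that b] good_conn[OF c that b] unfolding eq1 by auto
  have pair: "conn (V - {b} - {x, y})" if "x \<in> A" "y \<in> A" "x \<noteq> y" for x y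
  proof -
    have "conn (D \<union> {u, v} - {b} \<union> A - {x, y})"
    proof (rule pair_conn[OF c b(2) _ _ that])
      show "balv (A - {y})" by (rule balv_mono[OF bal(1)[OF that(2)]]) (use d(9) bA in blast)
      show "balv (A - {x})" by (rule balv_mono[OF bal(1)[OF that(1)]]) (use d(9) bA in blast)
    qed (use d b in auto)
    moreover have "D \<union> {u, v} - {b} \<union> A - {x, y} = V - {b} - {x, y}" using d(2,3,6) bA that by auto
    ultimately show ?thesis by simp
  qed
  have "balv (V - {b})"
    by (rule triple_balv[of "V - {b}" a1 a2 a3 u]) (use a bA d b bal pair in auto)
  then have "balv (A \<union> {u, v})" by (rule balv_mono) (use d b in auto)
  then show False using cut_not_balv[OF c] by blast
qed

end

section \<open>Cuts with a short side\<close>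

context mgraph
begin

lemma clique_conn:
  assumes "\<And>x y. x \<in> T \<Longrightarrow> y \<in> T \<Longrightarrow> x \<noteq> y \<Longrightarrow> adj x y" "T \<noteq> {}" "T \<subseteq> V"
  shows "conn T"
proof -
  obtain z where z: "z \<in> T" using assms(2) by blast
  have "con (inside T) z w" if w: "w \<in> T" for w
  proof (cases "w = z")
    case False
    then obtain e where "e \<in> E" "en e = {z, w}" using assms(1)[OF z w] unfolding adj_def by blast
    then show ?thesis using con_edge[of e "inside T" z w] z w by (auto simp: inside_def)
  qed simp
  then show ?thesis unfolding conn_def using cns_hubI[OF assms(3) inside_sub z] by blast
qed

end

section \<open>Sides with at most two vertices opposite a good vertex\<close>

context unbreakable_qbgraph
begin

text \<open>Each remaining vertex of the side attaches to \<open>u\<close> or \<open>v\<close>, so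
  if these two stayed connected, the whole set would be connected.\<close>

lemma bad_split:
  assumes c: "cut u v A D" and a: "a \<in> A" and n: "\<not> conn (A \<union> {u, v} - {a})"
  obtains P Q where "u \<in> P" "v \<in> Q" "P \<union> Q = A \<union> {u, v} - {a}" "P \<inter> Q = {}" "nadj P Q"
proof -
  let ?S = "A \<union> {u, v} - {a}"
  note d = cutD[OF c]
  have SV: "?S \<subseteq> V" using d(2,3,9) by blast
  have uv: "u \<in> ?S" "v \<in> ?S" using a d(11,12) by auto
  obtain P where P: "u \<in> P" "P \<subset> ?S" "nadj P (?S - P)" "\<And>y. y \<in> P \<Longrightarrow> con (inside ?S) u y"
    using not_conn_split[OF SV uv(1) n] by metis
  have "v \<notin> P"
  proof
    assume "v \<in> P"
    then have uv2: "con (inside ?S) u v" using P(4) by blast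
    have "con (inside ?S) u w" if w: "w \<in> ?S" for w
    proof (cases "w \<in> {u, v}")
      case True then show ?thesis using uv2 by auto
    next
      case False
      then obtain h where "h \<in> {u, v}" "con (inside ?S) w h" using side_minus_attach[OF c a, of w] w by blast
      then show ?thesis using uv2 con_sym con_trans by (metis insertE singletonD)
    qed
    then have "conn ?S" unfolding conn_def using cns_hubI[OF SV inside_sub uv(1)] by blast
    then show False using n by blast
  qed
  then show ?thesis using that[of P "?S - P"] P(1-3) uv(2) by blast
qed

text \<open>Both \<open>u\<close> and \<open>v\<close> need a neighbour in \<open>D\<close>, and a
  vertex adjacent to both would make the other vertex of \<open>D\<close> good.\<close>

lemma two_vertex_side:
  assumes c: "cut u v A D" and D: "card D = 2" and bad: "\<And>b. b \<in> D \<Longrightarrow> \<not> conn (D \<union> {u, v} - {b})"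
  obtains b1 b2 where "D = {b1, b2}" "b1 \<noteq> b2" "adj u b1" "\<not> adj u b2" "adj v b2" "\<not> adj v b1"
proof -
  note d = cutD[OF c]
  obtain x y where xy: "D = {x, y}" "x \<noteq> y" using D by (auto simp: card_2_iff)
  have nuv: "\<not> adj u v" using bad_not_adj[OF cut_swap[OF c]] bad xy by blast
  have one: "\<not> (adj u b \<and> adj v b)" if b: "D = {b, b'}" "b \<noteq> b'" for b b'
  proof
    assume h: "adj u b \<and> adj v b"
    then have "conn (insert v {u, b})" using conn_insert[OF conn_pairI[of u b], of b v] adj_sym by blast
    moreover have "insert v {u, b} = D \<union> {u, v} - {b'}" using b d(13,14) by auto
    ultimately show False using bad b by auto
  qed
  have nb: "adj w x \<or> adj w y" if c': "cut w w' D A" and n: "\<not> adj w w'" for w w'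
  proof -
    have cn: "conn (D \<union> {w})" using cut_conn1[OF c'] .
    obtain z where "z \<in> D \<union> {w}" "z \<noteq> w" "adj w z"
      using conn_neighbor[OF cn, of w x] xy cutD(11)[OF c'] by auto
    then show ?thesis using xy by auto
  qed
  have u: "adj u x \<or> adj u y" using nb[OF cut_swap[OF c] nuv] .
  have v: "adj v x \<or> adj v y" using nb[OF cut_flip[OF cut_swap[OF c]]] nuv adj_sym by blast
  have n: "\<not> (adj u x \<and> adj v x)" "\<not> (adj u y \<and> adj v y)" using one[of x y] one[of y x] xy by (auto simp: insert_commute)
  show ?thesis
  proof (cases "adj u x")
    case True then show ?thesis using that[of x y] xy u v n by blast
  next
    case False then show ?thesis using that[of y x] xy u v n by blast
  qed
qed

text \<open>A bad \<open>a\<close> separates \<open>u\<close> from \<open>v\<close> within the side,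
  so \<open>{a, b1}\<close> and \<open>{a, b2}\<close> are cuts with sides \<open>P\<close> and
  \<open>Q\<close>. The good vertex \<open>a0\<close> makes \<open>V - {b1, a0}\<close> and
  \<open>V - {b2, a0}\<close> balanced, and one of these sets contains such a side with both of its
  cut vertices.\<close>

lemma all_good2:
  assumes c: "cut u v A D" and D: "card D = 2" and bad: "\<And>b. b \<in> D \<Longrightarrow> \<not> conn (D \<union> {u, v} - {b})"
    and a0: "a0 \<in> A" "conn (A \<union> {u, v} - {a0})" and a: "a \<in> A"
  shows "conn (A \<union> {u, v} - {a})"
proof (rule ccontr)
  assume n: "\<not> ?thesis"
  note d = cutD[OF c]
  obtain b1 b2 where b: "D = {b1, b2}" "b1 \<noteq> b2" "adj u b1" "\<not> adj u b2" "adj v b2" "\<not> adj v b1"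
    using two_vertex_side[OF c D bad] .
  obtain P Q where PQ: "u \<in> P" "v \<in> Q" "P \<union> Q = A \<union> {u, v} - {a}" "P \<inter> Q = {}" "nadj P Q"
    using bad_split[OF c a n] .
  have bV: "b1 \<in> V" "b2 \<in> V" "b1 \<notin> A \<union> {u, v}" "b2 \<notin> A \<union> {u, v}" using d(7,10,13,14) b(1) by auto
  have V: "V = A \<union> {b1, b2} \<union> {u, v}" using d(2,3,6) b(1) by auto
  have PA: "P \<subseteq> A \<union> {u}" "Q \<subseteq> A \<union> {v}" using PQ by auto
  have nab: "\<not> adj x y" if "x \<in> A" "y \<in> {b1, b2}" for x y using nadjD[OF d(8)] that b(1) by blast
  have c1: "cut a b1 P (Q \<union> {b2})"
    unfolding cut_def
  proof (intro conjI)
    show "a \<noteq> b1" "a \<in> V" "b1 \<in> V" "P \<noteq> {}" "Q \<union> {b2} \<noteq> {}" using a bV d(9) PQ(1) by auto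
    have "P \<union> (Q \<union> {b2}) = A \<union> {u, v} - {a} \<union> {b2}" using PQ(3) by blast
    also have "\<dots> = V - {a, b1}" unfolding V using a bV b(2) d(11,12) by auto
    finally show "P \<union> (Q \<union> {b2}) = V - {a, b1}" .
    show dis: "P \<inter> (Q \<union> {b2}) = {}" using PQ(4) PA bV by blast
    show "nadj P (Q \<union> {b2})"
      by (rule nadjI[OF dis]) (use nadjD[OF PQ(5)] nab b(4) PA in blast)
  qed
  have c2: "cut a b2 Q (P \<union> {b1})"
    unfolding cut_def
  proof (intro conjI)
    show "a \<noteq> b2" "a \<in> V" "b2 \<in> V" "Q \<noteq> {}" "P \<union> {b1} \<noteq> {}" using a bV d(9) PQ(2) by auto
    have "Q \<union> (P \<union> {b1}) = A \<union> {u, v} - {a} \<union> {b1}" using PQ(3) by blast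
    also have "\<dots> = V - {a, b2}" unfolding V using a bV b(2) d(11,12) by auto
    finally show "Q \<union> (P \<union> {b1}) = V - {a, b2}" .
    show dis: "Q \<inter> (P \<union> {b1}) = {}" using PQ(4) PA bV by blast
    show "nadj Q (P \<union> {b1})"
      by (rule nadjI[OF dis]) (use nadjD[OF nadj_sym[OF PQ(5)]] nab b(6) PA in blast)
  qed
  have gb: "balv (V - {b, a0})" if "b \<in> {b1, b2}" for b
    using good_balv[OF cut_swap[OF c] _ a0] that b(1) by blast
  have "a0 \<noteq> a" using a0(2) n by blast
  then have "a0 \<in> P \<or> a0 \<in> Q" using PQ(3) a0(1) by blast
  then show False
  proof
    assume "a0 \<in> P"
    then have "Q \<union> {a, b2} \<subseteq> V - {b1, a0}" using PQ(4) PA \<open>a0 \<noteq> a\<close> a0(1) bV b(2) V a by blast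
    then have "balv (Q \<union> {a, b2})" using balv_mono[OF gb] by blast
    then show False using cut_not_balv[OF c2] by blast
  next
    assume "a0 \<in> Q"
    then have "P \<union> {a, b1} \<subseteq> V - {b2, a0}" using PQ(4) PA \<open>a0 \<noteq> a\<close> a0(1) bV b(2) V a by blast
    then have "balv (P \<union> {a, b1})" using balv_mono[OF gb] by blast
    then show False using cut_not_balv[OF c1] by blast
  qed
qed

lemma good_side_balv:
  assumes c: "cut u v A D" and a: "a \<in> A" "conn (A \<union> {u, v} - {a})" and b: "b \<in> D"
  shows "balv (V - {a, b})"
  using good_balv[OF cut_swap[OF c] b a] by (simp add: insert_commute)

text \<open>If \<open>a\<close> and \<open>a'\<close> were nonadjacent, \<open>V - {a, a'}\<close>
  would be connected by \<open>pair_conn\<close>, hence balanced, although it contains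
  \<open>D \<union> {u, v}\<close>.\<close>

lemma all_good_clique:
  assumes c: "cut u v A D" and good: "\<And>a. a \<in> A \<Longrightarrow> conn (A \<union> {u, v} - {a})"
    and a: "a \<in> A" "a' \<in> A" "a \<noteq> a'"
  shows "adj a a'"
proof (rule ccontr)
  assume n: "\<not> adj a a'"
  note d = cutD[OF c]
  obtain b where b: "b \<in> D" using d(5) by blast
  have bal: "balv (A - {x})" if "x \<in> A" for x
    by (rule balv_mono[OF good_side_balv[OF c that good[OF that] b]]) (use d(7,9) b in blast)
  have "conn (D \<union> {u, v} \<union> A - {a, a'})"
    using pair_conn[OF c cut_conn2[OF cut_swap[OF c]] _ _ a bal[OF a(2)] bal[OF a(1)]] by blast
  moreover have "D \<union> {u, v} \<union> A - {a, a'} = V - {a, a'}" using d(2,3,6) a by blast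
  ultimately have "balv (V - {a, a'})" using unbalanced_complement_pair[of a a'] a n d(9) by auto
  then have "balv (D \<union> {u, v})" by (rule balv_mono) (use d(2,3,7,10,11,12) a in auto)
  then show False using cut_not_balv[OF cut_swap[OF c]] by blast
qed

text \<open>\<open>v\<close> has a neighbour in the clique \<open>A - {a}\<close>, since
  \<open>a\<close> is good and \<open>u\<close>, \<open>v\<close> are nonadjacent. So
  \<open>V - {u, a}\<close> is connected, and it is balanced because \<open>u\<close> and
  \<open>a\<close> are nonadjacent.\<close>

lemma nonneighbour_balv:
  assumes c: "cut u v A D" and good: "\<And>a. a \<in> A \<Longrightarrow> conn (A \<union> {u, v} - {a})"
    and nuv: "\<not> adj u v" and a: "a \<in> A" "\<not> adj u a"
  shows "balv (D \<union> {v})"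
proof -
  note d = cutD[OF c]
  have uva: "v \<in> A \<union> {u, v} - {a}" "u \<in> A \<union> {u, v} - {a}" "u \<noteq> a" using d(11,12) a by auto
  obtain y where y: "y \<in> A \<union> {u, v} - {a}" "y \<noteq> v" "adj v y"
    using conn_neighbor[OF good[OF a(1)] uva(1,2) d(1)] .
  then have yA: "y \<in> A - {a}" using nuv adj_sym by auto
  have "conn (A - {a})" by (rule clique_conn) (use all_good_clique[OF c good] yA d(9) in blast)+
  moreover have "conn (D \<union> {v})" using cut_conn1[OF cut_flip[OF cut_swap[OF c]]] .
  ultimately have "conn (D \<union> {v} \<union> (A - {a}))" using conn_adj y(3) yA by blast
  moreover have "D \<union> {v} \<union> (A - {a}) = V - {u, a}" using d(1,3,6,7,11-14) a(1) by auto
  ultimately have "balv (V - {u, a})" using unbalanced_complement_pair[of u a] uva(3) a d(2,9) by auto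
  then show ?thesis by (rule balv_mono) (use d(1,3,7,10,12,13) a in auto)
qed

text \<open>The aim is \<open>triple_balv\<close> on \<open>A \<union> {u, v}\<close>. As
  \<open>v\<close> is adjacent to the whole clique \<open>A\<close>, deleting two vertices of
  \<open>A\<close> can only isolate \<open>u\<close>; the triple must leave \<open>u\<close> a
  neighbour after the deletion of any of its pairs.\<close>

lemma all_good_complete_false:
  assumes c: "cut u v A D" and good: "\<And>a. a \<in> A \<Longrightarrow> conn (A \<union> {u, v} - {a})"
    and nuv: "\<not> adj u v" and full: "\<And>a. a \<in> A \<Longrightarrow> adj v a" and A: "3 \<le> card A"
    and D: "card A < 4 \<Longrightarrow> card D = 2 \<and> (\<forall>b\<in>D. \<not> conn (D \<union> {u, v} - {b}))"
  shows False
proof -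
  let ?S = "A \<union> {u, v}"
  note d = cutD[OF c]
  obtain b where b: "b \<in> D" using d(5) by blast
  have fA: "finite A" using d(9) finite_V finite_subset by blast
  have nbr: "\<exists>p\<in>A. p \<noteq> a \<and> adj u p" if a: "a \<in> A" for a
  proof -
    have "u \<in> ?S - {a}" "v \<in> ?S - {a}" using d(11,12) a by auto
    then obtain y where "y \<in> ?S - {a}" "y \<noteq> u" "adj u y" using conn_neighbor[OF good[OF a]] d(1) by metis
    then show ?thesis using nuv by blast
  qed
  have pairc: "conn (?S - {x, y})" if xy: "x \<in> A" "y \<in> A" and p: "p \<in> A - {x, y}" "adj u p" for x y p
  proof -
    have "conn (A - {x, y})" by (rule clique_conn) (use all_good_clique[OF c good] p d(9) in blast)+
    then have "conn (insert u (A - {x, y}))" using conn_insert p adj_sym by blast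
    then have "conn (insert v (insert u (A - {x, y})))" using conn_insert[of _ p v] p full[of p] adj_sym by blast
    moreover have "insert v (insert u (A - {x, y})) = ?S - {x, y}" using xy d(11,12) by auto
    ultimately show ?thesis by simp
  qed
  have bal: "balv (?S - {x})" if "x \<in> A" for x
    by (rule balv_mono[OF good_side_balv[OF c that good[OF that] b]]) (use d(2,3,7,9,13,14) b in auto)
  have triple: False if t: "a1 \<in> A" "a2 \<in> A" "a3 \<in> A" "a1 \<noteq> a2" "a1 \<noteq> a3" "a2 \<noteq> a3"
    and p: "p1 \<in> A - {a2, a3}" "adj u p1" "p2 \<in> A - {a1, a3}" "adj u p2" "p3 \<in> A - {a1, a2}" "adj u p3" for a1 a2 a3 p1 p2 p3
  proof -
    have "balv ?S"
    proof (rule triple_balv[of ?S a1 a2 a3 u])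
      show "?S \<subseteq> V" using d(2,3,9) by blast
      show "u \<in> ?S - {a1, a2, a3}" using t d(11) by auto
      show "conn (?S - {a1, a2})" "conn (?S - {a1, a3})" "conn (?S - {a2, a3})"
        using pairc[OF t(1,2) p(5,6)] pairc[OF t(1,3) p(3,4)] pairc[OF t(2,3) p(1,2)] .
    qed (use t good bal in auto)
    then show False using cut_not_balv[OF c] by blast
  qed
  obtain x where "x \<in> A" using d(4) by blast
  then obtain p where p: "p \<in> A" "adj u p" using nbr by blast
  then obtain q where q: "q \<in> A" "q \<noteq> p" "adj u q" using nbr by blast
  show False
  proof (cases "card A < 4")
    case False
    \<comment> \<open>\<open>u\<close> has at least the two neighbours \<open>p\<close> and
      \<open>q\<close>. In the triple \<open>p\<close>, \<open>a\<close>, \<open>a'\<close> with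
      \<open>a\<close>, \<open>a'\<close> different from both, each pair leaves \<open>p\<close> or
      \<open>q\<close>.\<close>
    have "card (A - {p, q}) \<ge> 2" using False p q fA by (simp add: card_Diff_subset)
    then obtain T where T: "T \<subseteq> A - {p, q}" "card T = 2" using obtain_subset_with_card_n by metis
    then obtain a a' where "T = {a, a'}" "a \<noteq> a'" by (auto simp: card_2_iff)
    then have "a \<in> A" "a' \<in> A" "a \<noteq> p" "a \<noteq> q" "a' \<noteq> p" "a' \<noteq> q" "a \<noteq> a'" using T by auto
    then show False using triple[of p a a' p q q] p q by auto
  next
    case True
    then have D2: "card D = 2" and bad: "\<And>b. b \<in> D \<Longrightarrow> \<not> conn (D \<union> {u, v} - {b})" using D by auto
    have "card (A - {p, q}) \<ge> 1" using A p q fA by (simp add: card_Diff_subset)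
    then have "A - {p, q} \<noteq> {}" by (metis card.empty not_one_le_zero)
    then obtain r where r: "r \<in> A" "r \<noteq> p" "r \<noteq> q" by blast
    show False
    proof (cases "adj u r")
      case True
      then show False using triple[of p q r p q r] p q r by auto
    next
      case False
      \<comment> \<open>Now \<open>A = {p, q, r}\<close>, and deleting \<open>p\<close> and
        \<open>q\<close> does isolate \<open>u\<close>. The contradiction comes from the other side:
        the nonneighbour \<open>r\<close> makes \<open>D \<union> {v}\<close> balanced, and
        \<open>D \<union> {u}\<close> is glued from \<open>{u, b1}\<close> and \<open>D\<close>
        along \<open>b1\<close>.\<close>
      have bv: "balv (D \<union> {v})" using nonneighbour_balv[OF c good nuv r(1) False] .
      obtain b1 b2 where h: "D = {b1, b2}" "b1 \<noteq> b2" "adj u b1" "\<not> adj u b2" "adj v b2" "\<not> adj v b1"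
        using two_vertex_side[OF c D2 bad] .
      have b12: "b1 \<in> D" "b2 \<in> D" using h(1) by auto
      have "balv {u, b1}"
        by (rule balv_mono[OF good_side_balv[OF c p(1) good[OF p(1)] b12(2)]]) (use d(2,7,10,11,13) b12 p(1) h(2) in auto)
      moreover have "balv D" by (rule balv_mono[OF bv]) blast
      moreover have "{u, b1} \<inter> D = {b1}" using h(1) d(13) by auto
      moreover have "conn {u, b1}" "conn D" "conn {b1}"
        using conn_pairI[OF h(3)] cut_conn[OF c] conn_single b12 d(10) by auto
      ultimately have "bal (inside {u, b1} \<union> inside D)"
        using bal_Un[of "{u, b1}" "inside {u, b1}" D "inside D"] unfolding conn_def inside_Int by simp
      moreover have "inside (D \<union> {u}) \<subseteq> inside {u, b1} \<union> inside D"
      proof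
        fix e assume e: "e \<in> inside (D \<union> {u})"
        then have eE: "e \<in> E" by (simp add: inside_def)
        then obtain x y where xy: "en e = {x, y}" by (rule obtain_ends)
        have "\<not> (u \<in> en e \<and> b2 \<in> en e)"
        proof
          assume "u \<in> en e \<and> b2 \<in> en e"
          moreover have "u \<noteq> b2" using d(13) b12 by blast
          ultimately have "en e = {u, b2}" using xy by auto
          then show False using h(4) eE unfolding adj_def by blast
        qed
        then show "e \<in> inside {u, b1} \<union> inside D" using e h(1) by (auto simp: inside_def)
      qed
      ultimately have "balv (D \<union> {u})" using bal_mono by blast
      then show False using cut_not_both_balv[OF cut_swap[OF c]] bv by blast
    qed
  qed
qed

text \<open>If both \<open>u\<close> and \<open>v\<close> had nonneighbours in \<open>A\<close>,
  then \<open>D \<union> {v}\<close> and \<open>D \<union> {u}\<close> would both be balanced. So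
  one of them is adjacent to all of \<open>A\<close>, and the roles of \<open>u\<close> and
  \<open>v\<close> can be exchanged.\<close>

lemma all_good_false:
  assumes c: "cut u v A D" and good: "\<And>a. a \<in> A \<Longrightarrow> conn (A \<union> {u, v} - {a})"
    and bad: "\<And>b. b \<in> D \<Longrightarrow> \<not> conn (D \<union> {u, v} - {b})" and A: "3 \<le> card A"
    and D: "card A < 4 \<Longrightarrow> card D = 2"
  shows False
proof -
  note d = cutD[OF c]
  obtain b where b: "b \<in> D" using d(5) by blast
  have nuv: "\<not> adj u v" using bad_not_adj[OF cut_swap[OF c] b bad[OF b]] .
  then have nvu: "\<not> adj v u" using adj_sym by blast
  have sw: "{v, u} = {u, v}" by (simp add: insert_commute)
  show False
  proof (cases "\<forall>a\<in>A. adj v a")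
    case True
    then show False using all_good_complete_false[OF c good nuv _ A] D bad by blast
  next
    case False
    then obtain a' where "a' \<in> A" "\<not> adj v a'" by blast
    then have "balv (D \<union> {u})" using nonneighbour_balv[OF cut_flip[OF c] _ nvu] good unfolding sw by blast
    then have "\<not> balv (D \<union> {v})" using cut_not_both_balv[OF cut_swap[OF c]] by blast
    then have "\<forall>a\<in>A. adj u a" using nonneighbour_balv[OF c good nuv] by blast
    then show False using all_good_complete_false[OF cut_flip[OF c] _ nvu _ A] good D bad unfolding sw by blast
  qed
qed

lemma small_side2_false:
  assumes c: "cut u v A D" and D: "card D = 2" and bad: "\<And>b. b \<in> D \<Longrightarrow> \<not> conn (D \<union> {u, v} - {b})"
    and a0: "a0 \<in> A" "conn (A \<union> {u, v} - {a0})" and A: "3 \<le> card A"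
  shows False
  by (rule all_good_false[OF c all_good2[OF c D bad a0] bad A]) (use D in auto)

text \<open>With a single vertex \<open>b\<close> opposite, the split at \<open>a\<close> gives the
  cut \<open>{a, b}\<close> with sides \<open>P\<close> and \<open>Q\<close>. There
  \<open>a0\<close> is still good, so \<open>Q\<close> has at most two vertices, and
  \<open>7 \<le> card V\<close> then rules out good vertices in \<open>Q\<close>.\<close>

lemma small_side1_split_false:
  assumes c: "cut u v A {b}" and bad: "\<not> conn {u, v}"
    and a0: "a0 \<in> A" "conn (A \<union> {u, v} - {a0})" and V: "7 \<le> card V"
    and a: "a \<in> A" and PQ: "u \<in> P" "v \<in> Q" "P \<union> Q = A \<union> {u, v} - {a}" "P \<inter> Q = {}" "nadj P Q"
    and a0P: "a0 \<in> P"
  shows False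
proof -
  note d = cutD[OF c]
  have bV: "b \<in> V" "b \<notin> A \<union> {u, v}" using d(7,10,13,14) by auto
  have VV: "V = A \<union> {b} \<union> {u, v}" using d(2,3,6) by auto
  have PA: "P \<subseteq> A \<union> {u}" "Q \<subseteq> A \<union> {v}" "a \<notin> P" "a \<notin> Q" using PQ by auto
  have nab: "\<not> adj x b" if "x \<in> A" for x using nadjD[OF d(8) that] by blast
  have c1: "cut a b P Q"
    unfolding cut_def
  proof (intro conjI)
    show "a \<noteq> b" "a \<in> V" "b \<in> V" "P \<noteq> {}" "Q \<noteq> {}" using a bV d(9) PQ(1,2) by auto
    show "P \<union> Q = V - {a, b}" unfolding PQ(3) VV using a bV d(11,12) by auto
  qed (use PQ in auto)
  have fP: "finite P" using cutD(9)[OF c1] finite_V finite_subset by blast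
  have ua0: "u \<noteq> a0" using a0(1) d(11) by blast
  \<comment> \<open>Within the old side without \<open>a0\<close>, a vertex of \<open>P\<close>
    still reaches \<open>v\<close>, and it can leave \<open>P\<close> only through
    \<open>a\<close>.\<close>
  have con1: "conn (P \<union> {a} - {a0})"
  proof (rule conn_hub[of "{a}"])
    show "conn {a}" using conn_single a d(9) by blast
    show "{a} \<subseteq> P \<union> {a} - {a0}" using PA a0P by blast
    show "P \<union> {a} - {a0} \<subseteq> V" using cutD(9)[OF c1] a d(9) by blast
    fix w assume w: "w \<in> P \<union> {a} - {a0}" "w \<notin> {a}"
    let ?X = "inside (A \<union> {u, v} - {a0})"
    have vS: "v \<in> A \<union> {u, v} - {a0}" "v \<notin> P - {a0}" using d(12) a0(1) PQ(2,4) by auto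
    have wS: "w \<in> A \<union> {u, v} - {a0}" "w \<in> P - {a0}" using w PA by auto
    have edge: "en e \<subseteq> P - {a0} \<union> {a}" if e: "e \<in> ?X" "en e \<inter> (P - {a0}) \<noteq> {}" for e
    proof -
      have "en e \<inter> Q = {}" using e PQ(5) unfolding nadj_def inside_def by blast
      then show ?thesis using e(1) PQ(3) unfolding inside_def by blast
    qed
    have "\<exists>h\<in>{a}. con {e \<in> ?X. en e \<inter> (P - {a0}) \<noteq> {}} w h"
      by (rule exit[OF connD(3)[OF a0(2) wS(1) vS(1)] wS(2) vS(2) edge inside_sub(1)])
    moreover have "{e \<in> ?X. en e \<inter> (P - {a0}) \<noteq> {}} \<subseteq> inside (P \<union> {a} - {a0})"
    proof
      fix e assume e: "e \<in> {e \<in> ?X. en e \<inter> (P - {a0}) \<noteq> {}}"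
      then have "en e \<subseteq> P - {a0} \<union> {a}" using edge by blast
      then show "e \<in> inside (P \<union> {a} - {a0})" using e a0P PA(3) by (auto simp: inside_def)
    qed
    ultimately show "\<exists>h\<in>{a}. con (inside (P \<union> {a} - {a0})) w h" using con_mono by blast
  qed
  have bn: "y = u \<or> y = v" if y: "adj b y" "y \<in> A \<union> {u, v}" for y
    using nab[of y] y adj_sym by blast
  have ub: "adj u b"
  proof -
    have "conn ({b} \<union> {u})" using cut_conn1[OF cut_swap[OF c]] .
    then have "conn {u, b}" by (simp add: insert_commute)
    then show ?thesis using conn_pairD d(13) by blast
  qed
  have "conn (insert b (P \<union> {a} - {a0}))" using conn_insert[OF con1 _ ub] PQ(1) ua0 by blast
  moreover have "insert b (P \<union> {a} - {a0}) = P \<union> {a, b} - {a0}" using bV a0(1) by auto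
  ultimately have g0: "conn (P \<union> {a, b} - {a0})" by simp
  have cQ: "card Q \<le> 2" using good_card[OF cut_swap[OF c1] a0P g0] .
  have cV: "card V = card P + card Q + 2" using cut_card[OF c1] .
  have badQ: "\<not> conn (Q \<union> {a, b} - {y})" if y: "y \<in> Q" for y
  proof
    assume "conn (Q \<union> {a, b} - {y})"
    then have "card P \<le> 2" using good_card[OF c1 y] by blast
    then show False using cQ cV V by linarith
  qed
  have P3: "3 \<le> card P" using cV cQ V by linarith
  have "finite Q" "Q \<noteq> {}" using cutD(5,10)[OF c1] finite_V finite_subset by blast+
  then have "card Q = 1 \<or> card Q = 2" using cQ by (metis One_nat_def Suc_1 card_0_eq le_Suc_eq le_zero_eq)
  then show False
  proof
    assume "card Q = 2"
    \<comment> \<open>\<open>all_good2\<close> makes \<open>u\<close> good for the new cut as well.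
      But \<open>b\<close> has no neighbours apart from \<open>u\<close> and \<open>v\<close>, so
      without \<open>u\<close> it is cut off from the rest of
      \<open>P \<union> {a, b}\<close>.\<close>
    then have "conn (P \<union> {a, b} - {u})" using all_good2[OF c1 _ badQ a0P g0 PQ(1)] by blast
    moreover have "b \<in> P \<union> {a, b} - {u}" "a \<in> P \<union> {a, b} - {u}" "a \<noteq> b" using bV a d(11) by auto
    ultimately obtain y where "y \<in> P \<union> {a, b} - {u}" "y \<noteq> b" "adj b y" using conn_neighbor by metis
    moreover from this have "y = u \<or> y = v" using bn PA a by blast
    ultimately have "v \<in> P \<union> {a, b}" by blast
    then show False using PQ(2,4) d(12,14) a by blast
  next
    assume "card Q = 1"
    then have Q: "Q = {v}" using PQ(2) by (metis card_1_singletonE singletonD)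
    have "P = A \<union> {u, v} - {a} - {v}" using PQ(3,4) unfolding Q by blast
    also have "\<dots> = A - {a} \<union> {u}" using d(1,11,12) a by blast
    finally have P: "P = A - {a} \<union> {u}" .
    have ne: "A - {a} \<noteq> {}" using a0(1) a0P PA by blast
    \<comment> \<open>The cut is changed once more, to \<open>{u, a}\<close> with the two-vertex
      side \<open>{v, b}\<close>, which is the case already settled.\<close>
    have c2: "cut u a (A - {a}) {v, b}"
      unfolding cut_def
    proof (intro conjI)
      show "u \<noteq> a" "u \<in> V" "a \<in> V" "{v, b} \<noteq> {}" using a d(2,9,11) by auto
      show "A - {a} \<union> {v, b} = V - {u, a}" unfolding VV using a bV d(1,11,12) by auto
      show dis: "(A - {a}) \<inter> {v, b} = {}" using d(12) bV by auto
      show "nadj (A - {a}) {v, b}"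
        by (rule nadjI[OF dis]) (use nadjD[OF PQ(5)] nab P Q in blast)
    qed (rule ne)
    have eq: "A - {a} \<union> {u, a} - {a0} = P \<union> {a} - {a0}" unfolding P by auto
    have a0A: "a0 \<in> A - {a}" using a0(1) a0P PA by blast
    have cA: "card (A - {a}) + 4 = card V" using cut_card[OF c2] bV by (auto simp: card_insert_if)
    have bad2: "\<not> conn ({v, b} \<union> {u, a} - {y})" if y: "y \<in> {v, b}" for y
    proof
      assume "conn ({v, b} \<union> {u, a} - {y})"
      then have "card (A - {a}) \<le> 2" using good_card[OF c2 y] by blast
      then show False using cA V by linarith
    qed
    have "card {v, b} = 2" using bV by auto
    then show False
      using small_side2_false[OF c2 _ bad2 a0A] con1 cA V unfolding eq by linarith
  qed
qed

lemma good_bad_false: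
  assumes c: "cut u v A D" and bad: "\<And>b. b \<in> D \<Longrightarrow> \<not> conn (D \<union> {u, v} - {b})"
    and a0: "a0 \<in> A" "conn (A \<union> {u, v} - {a0})" and V: "7 \<le> card V"
  shows False
proof -
  note d = cutD[OF c]
  have cD: "card D \<le> 2" using good_card[OF cut_swap[OF c] a0] .
  have cV: "card V = card A + card D + 2" using cut_card[OF c] .
  have "finite D" "D \<noteq> {}" using d(5,10) finite_V finite_subset by blast+
  then have "card D = 1 \<or> card D = 2" using cD by (metis One_nat_def Suc_1 card_0_eq le_Suc_eq le_zero_eq)
  then show False
  proof
    assume "card D = 2"
    then show False using small_side2_false[OF c _ bad a0] cV V by linarith
  next
    assume D1: "card D = 1"
    then obtain b where b: "D = {b}" by (auto simp: card_1_singleton_iff)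
    have cb: "cut u v A {b}" using c b by simp
    have "{b} \<union> {u, v} - {b} = {u, v}" using d(13,14) b by auto
    then have buv: "\<not> conn {u, v}" using bad[of b] b by simp
    show False
    proof (cases "\<forall>a\<in>A. conn (A \<union> {u, v} - {a})")
      case True
      then show False using all_good_false[OF c _ bad] cV V D1 by force
    next
      case False
      then obtain a where a: "a \<in> A" "\<not> conn (A \<union> {u, v} - {a})" by blast
      obtain P Q where PQ: "u \<in> P" "v \<in> Q" "P \<union> Q = A \<union> {u, v} - {a}" "P \<inter> Q = {}" "nadj P Q"
        using bad_split[OF c a] .
      have "a0 \<noteq> a" using a0 a by blast
      then have "a0 \<in> P \<or> a0 \<in> Q" using PQ(3) a0(1) by blast
      then show False
      proof
        assume "a0 \<in> P"
        then show False using small_side1_split_false[OF cb buv a0 V a(1) PQ] by blast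
      next
        assume "a0 \<in> Q"
        moreover have "{u, v} = {v, u}" by (simp add: insert_commute)
        ultimately show False
          using small_side1_split_false[OF cut_flip[OF cb] _ a0(1) _ V a(1) PQ(2,1) _ _ nadj_sym[OF PQ(5)]] buv a0(2) PQ(3,4)
          by (simp add: Un_commute Int_commute)
      qed
    qed
  qed
qed

end

section \<open>Cyclic graphs and the main theorem\<close>

context mgraph
begin

lemma conn_sequence:
  assumes "i \<le> j" "c i \<in> V" "\<And>k. i \<le> k \<Longrightarrow> k < j \<Longrightarrow> adj (c k) (c (Suc k))"
  shows "conn (c ` {i..j})"
  using assms
proof (induction j rule: dec_induct)
  case base
  then show ?case by (simp add: conn_single)
next
  case (step j)
  then have "conn (insert (c (Suc j)) (c ` {i..j}))" using conn_insert[of "c ` {i..j}" "c j"] by auto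
  moreover have "c ` {i..Suc j} = insert (c (Suc j)) (c ` {i..j})" using step by (simp add: atLeastAtMostSuc_conv)
  ultimately show ?case by simp
qed

text \<open>The enumeration continues periodically over all natural numbers, so that a window of
  length \<open>n\<close> may start at any index. Loops and parallel edges are not
  restricted.\<close>

definition cyclic :: "(nat \<Rightarrow> 'v) \<Rightarrow> nat \<Rightarrow> bool" where
  "cyclic c n \<longleftrightarrow> 3 \<le> n \<and> (\<forall>i. c i = c (i mod n)) \<and> inj_on c {..<n} \<and> c ` {..<n} = V \<and>
     (\<forall>i. adj (c i) (c (Suc i))) \<and> (\<forall>i j. i < j \<longrightarrow> j < n \<longrightarrow> adj (c i) (c j) \<longrightarrow> j = Suc i \<or> i = 0 \<and> Suc j = n)"

lemma mod_window_less:
  fixes i j n :: nat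
  assumes "i < j" "j < i + n"
  shows "i mod n < j mod n \<and> j mod n = i mod n + (j - i) \<or> j mod n < i mod n \<and> j mod n + n = i mod n + (j - i)"
proof -
  have n: "0 < n" using assms by linarith
  define r where "r = i mod n"
  define d where "d = j - i"
  have d: "0 < d" "d < n" "j = i + d" using assms by (auto simp: d_def)
  have r: "r < n" using n by (simp add: r_def)
  have "j mod n = (r + d) mod n" unfolding d(3) r_def by (simp add: mod_add_left_eq)
  also have "\<dots> = (if r + d < n then r + d else r + d - n)"
    using r d by (simp add: mod_if[of "r + d"])
  finally have "j mod n = (if r + d < n then r + d else r + d - n)" .
  then show ?thesis using d r unfolding r_def[symmetric] d_def[symmetric] by (auto split: if_splits)
qed

text \<open>Moves the conditions from the window at 0 to an arbitrary one;
  \<open>mod_window_less\<close> tells whether the step from \<open>i\<close> to \<open>j\<close>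
  wraps around.\<close>

lemma cyclicD:
  assumes "cyclic c n"
  shows "3 \<le> n" "c (i + n) = c i" "c i \<in> V" "adj (c i) (c (Suc i))" "inj_on c {i..<i + n}"
    "c ` {i..<i + n} = V" "card V = n"
    "\<And>j. i < j \<Longrightarrow> j < i + n \<Longrightarrow> adj (c i) (c j) \<Longrightarrow> j = Suc i \<or> Suc j = i + n"
proof -
  have m: "c i = c (i mod n)" for i using assms unfolding cyclic_def by blast
  show n: "3 \<le> n" and "adj (c i) (c (Suc i))" using assms unfolding cyclic_def by blast+
  show "c (i + n) = c i" using m[of "i + n"] m[of i] by simp
  have inj: "inj_on c {..<n}" and im: "c ` {..<n} = V" using assms unfolding cyclic_def by blast+
  have modn: "i mod n < n" for i using n by simp
  show V: "c i \<in> V" for i using m[of i] im modn[of i] by blast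
  show cV: "card V = n" using im card_image[OF inj] by simp
  have ne: "c j \<noteq> c k" if "j < k" "k < j + n" for j k
  proof
    assume "c j = c k"
    then have "c (j mod n) = c (k mod n)" using m by metis
    then have "j mod n = k mod n" using inj modn by (simp add: inj_on_def)
    then show False using mod_window_less[OF that] by linarith
  qed
  show injw: "inj_on c {i..<i + n}"
  proof (rule inj_onI)
    fix x y assume "x \<in> {i..<i + n}" "y \<in> {i..<i + n}" "c x = c y"
    then show "x = y" using ne[of x y] ne[of y x] by (cases x y rule: linorder_cases) auto
  qed
  show "c ` {i..<i + n} = V"
    by (rule card_subset_eq[OF finite_V]) (use V card_image[OF injw] cV in auto)
  fix j assume j: "i < j" "j < i + n" "adj (c i) (c j)"
  have chord: "l = Suc k \<or> k = 0 \<and> Suc l = n" if "k < l" "l < n" "adj (c k) (c l)" for k l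
    using assms that unfolding cyclic_def by blast
  have a: "adj (c (i mod n)) (c (j mod n))" using j(3) m by metis
  from mod_window_less[OF j(1,2)] show "j = Suc i \<or> Suc j = i + n"
  proof
    assume h: "i mod n < j mod n \<and> j mod n = i mod n + (j - i)"
    then show ?thesis using chord[OF _ modn a] j by linarith
  next
    assume h: "j mod n < i mod n \<and> j mod n + n = i mod n + (j - i)"
    then show ?thesis using chord[OF _ modn adj_sym[OF a]] j by linarith
  qed
qed

lemma cyclic_si:
  assumes c: "cyclic c n" and V: "conn V"
  shows "is_cycle_graph (si G)"
proof -
  let ?H = "si G"
  define P where "P = en ` {e \<in> E. card (en e) = 2}"
  have H: "vertices ?H = V" "edges ?H = P" "ends ?H = (\<lambda>p. p)" by (simp_all add: si_def P_def)
  have P: "{x, y} \<in> P \<longleftrightarrow> x \<noteq> y \<and> adj x y" for x y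
    unfolding P_def adj_def by (auto simp: card_2_iff image_iff)
  have Pform: "\<exists>y. y \<noteq> x \<and> p = {x, y} \<and> adj x y" if "p \<in> P" "x \<in> p" for p x
  proof -
    have "card p = 2" using that(1) unfolding P_def by auto
    then obtain a b where ab: "p = {a, b}" "a \<noteq> b" by (auto simp: card_2_iff)
    then have "adj a b" using P that(1) by blast
    have "x = a \<or> x = b" using ab that(2) by blast
    then show ?thesis
    proof
      assume "x = a"
      then show ?thesis using ab \<open>adj a b\<close> by (intro exI[of _ b]) auto
    next
      assume "x = b"
      then show ?thesis using ab adj_sym[OF \<open>adj a b\<close>] by (intro exI[of _ a]) auto
    qed
  qed
  have nbr: "c i \<noteq> c (Suc i)" for i
    using inj_onD[OF cyclicD(5)[OF c, of i], of i "Suc i"] cyclicD(1)[OF c] by auto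
  have span: "span_verts ?H P = V"
  proof
    show "span_verts ?H P \<subseteq> V" using Pform adj_V unfolding span_verts_def H by blast
    show "V \<subseteq> span_verts ?H P"
    proof
      fix v assume "v \<in> V"
      then obtain i where "v = c i" using cyclicD(6)[OF c, of 0] by blast
      then have "{v, c (Suc i)} \<in> P" using P nbr cyclicD(4)[OF c] by blast
      then show "v \<in> span_verts ?H P" unfolding span_verts_def H by blast
    qed
  qed
  have adjH: "adjacency (edge_subgraph ?H P) = {(u, v). {u, v} \<in> P}"
    by (auto simp: adjacency_def edge_subgraph_def H)
  have "(u, v) \<in> (adjacency (edge_subgraph ?H P))\<^sup>*" if "u \<in> V" "v \<in> V" for u v
  proof -
    have "con E u v" using connD(3)[OF V that] by (simp add: inside_V)
    then show ?thesis
    proof (induction rule: con_induct)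
      case (step y z e)
      then have "adj y z" unfolding adj_def by blast
      then have "y = z \<or> (y, z) \<in> adjacency (edge_subgraph ?H P)" unfolding adjH using P by blast
      with step.IH show ?case by (meson rtrancl.simps)
    qed simp
  qed
  then have con: "graph_connected (edge_subgraph ?H P)"
    using connD(1)[OF V] unfolding graph_connected_def by (simp add: edge_subgraph_def span)
  have deg: "vdegree (edge_subgraph ?H P) v = 2" if "v \<in> V" for v
  proof -
    obtain i0 where "v = c i0" using cyclicD(6)[OF c, of 0] \<open>v \<in> V\<close> by blast
    define i where "i = i0"
    have v: "v = c i" using \<open>v = c i0\<close> by (simp add: i_def)
    \<comment> \<open>\<open>i + n - 1\<close> is the predecessor of \<open>i\<close>, shifted by
      one period so that it is right for \<open>i = 0\<close> as well.\<close>
    let ?y = "c (Suc i)" and ?z = "c (i + n - 1)"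
    have n: "3 \<le> n" using cyclicD(1)[OF c] .
    have "{p \<in> P. v \<in> p} = {{v, ?y}, {v, ?z}}"
    proof (intro set_eqI iffI)
      fix p assume "p \<in> {p \<in> P. v \<in> p}"
      then obtain y where y: "y \<noteq> v" "p = {v, y}" "adj v y" using Pform by blast
      then obtain j where j: "j \<in> {i..<i + n}" "y = c j" using cyclicD(6)[OF c, of i] adj_V by blast
      then have "i < j" "j < i + n" using y v by (auto simp: le_less)
      then have "j = Suc i \<or> Suc j = i + n" using cyclicD(8)[OF c] y(3) v j(2) by blast
      then show "p \<in> {{v, ?y}, {v, ?z}}" using y(2) j(2) by (metis diff_Suc_1 insertI1 insertI2)
    next
      fix p assume p: "p \<in> {{v, ?y}, {v, ?z}}"
      have "adj ?z v" using cyclicD(4)[OF c, of "i + n - 1"] cyclicD(2)[OF c, of i] n v by (simp add: Suc_diff_1)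
      moreover have "?z \<noteq> v" using nbr[of "i + n - 1"] cyclicD(2)[OF c, of i] n v by (simp add: Suc_diff_1)
      moreover have "adj v ?y" "v \<noteq> ?y" using cyclicD(4)[OF c] nbr v by auto
      ultimately show "p \<in> {p \<in> P. v \<in> p}" using p P adj_sym by auto
    qed
    moreover have "?y \<noteq> ?z"
    proof
      assume "?y = ?z"
      moreover have "Suc i \<in> {i..<i + n}" "i + n - 1 \<in> {i..<i + n}" using n by auto
      ultimately have "Suc i = i + n - 1" using cyclicD(5)[OF c, of i] by (meson inj_onD)
      then show False using n by linarith
    qed
    then have "{v, ?y} \<noteq> {v, ?z}" by (auto simp: doubleton_eq_iff)
    ultimately have "card {p \<in> P. v \<in> p} = 2" by simp
    moreover have "card p = 2" if "p \<in> P" for p using that unfolding P_def by auto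
    then have "{p \<in> P. p = {v}} = {}" by force
    ultimately show ?thesis unfolding vdegree_def by (simp add: edge_subgraph_def H)
  qed
  have "P \<in> graph_cycles ?H"
    unfolding graph_cycles_def using con deg span by (auto simp: H)
  then show ?thesis unfolding is_cycle_graph_def H span by simp
qed

text \<open>The vertex of \<open>C\<close> of largest index (counted from \<open>r\<close>) carries a loop of \<open>C\<close>, or else
  both edges of \<open>C\<close> at it go to the preceding vertex.\<close>

lemma cyclic_short_cycle:
  assumes c: "cyclic c n" and C: "C \<in> cycles" and q: "c r \<notin> sp C"
  obtains i where "C \<subseteq> inside {c i, c (Suc i)}"
proof -
  define J where "J = {k \<in> {Suc r..<r + n}. c k \<in> sp C}"
  have idx: "\<exists>k\<in>J. y = c k" if "y \<in> sp C" for y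
  proof -
    have "y \<in> c ` {r..<r + n}" using that cycleD(7)[OF C] cyclicD(6)[OF c, of r] by blast
    then obtain k where "r \<le> k" "k < r + n" "y = c k" by auto
    moreover from this have "k \<noteq> r" using q that by auto
    ultimately show ?thesis using that by (intro bexI[of _ k]) (auto simp: J_def)
  qed
  have finJ: "finite J" by (simp add: J_def)
  have neJ: "J \<noteq> {}" using idx cycleD(6)[OF C] by blast
  define b where "b = Max J"
  have bJ: "b \<in> J" using Max_in[OF finJ neJ] by (simp add: b_def)
  have bmax: "k \<le> b" if "k \<in> J" for k using Max_ge[OF finJ that] by (simp add: b_def)
  have b: "Suc r \<le> b" "b < r + n" "c b \<in> sp C" using bJ by (auto simp: J_def)
  define i where "i = b - 1"
  have bi: "b = Suc i" using b by (simp add: i_def)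
  have CE: "C \<subseteq> E" using cycleD(1)[OF C] .
  have edge: "en e = {c b} \<or> en e = {c b, c i}" if e: "e \<in> C" "c b \<in> en e" for e
  proof -
    have eE: "e \<in> E" using e CE by blast
    obtain y where y: "en e = {c b, y}" using obtain_other_end[OF eE e(2)] .
    have "y \<in> sp C" using e y by (auto simp: sp_iff)
    then obtain k where k: "k \<in> J" "y = c k" using idx by blast
    then have kb: "k \<le> b" "Suc r \<le> k" using bmax by (auto simp: J_def)
    show ?thesis
    proof (cases "k = b")
      case True then show ?thesis using y k by simp
    next
      case False
      then have "k < b" "b < k + n" using kb b by auto
      moreover have "adj (c k) (c b)" using eE y k unfolding adj_def by (auto simp: insert_commute)
      ultimately have "b = Suc k \<or> Suc b = k + n" using cyclicD(8)[OF c] by blast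
      \<comment> \<open>Wrapping around is impossible: as \<open>C\<close> misses
        \<open>c r\<close>, all its indices lie from \<open>Suc r\<close> to below
        \<open>r + n\<close>.\<close>
      then have "b = Suc k" using kb b by linarith
      then show ?thesis using y k bi by simp
    qed
  qed
  let ?X = "{e \<in> C. c b \<in> en e}"
  have "C \<subseteq> ?X"
  proof (cases "\<exists>e\<in>C. en e = {c b}")
    case True
    then obtain e where "e \<in> C" "en e = {c b}" by blast
    then show ?thesis using cycle_loop[OF C] by auto
  next
    case False
    then have "{e \<in> C. en e = {c b}} = {}" by blast
    then have "card {e \<in> C. en e = {c b}} = 0" by (simp only: card.empty)
    then have "card ?X = 2" using cycleD(4)[OF C b(3)] unfolding dg_def by linarith
    then obtain e1 e2 where e12: "?X = {e1, e2}" "e1 \<noteq> e2" by (auto simp: card_2_iff)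
    have e: "e1 \<in> C" "e2 \<in> C" "en e1 = {c b, c i}" "en e2 = {c b, c i}"
    proof -
      have "e1 \<in> ?X" "e2 \<in> ?X" unfolding e12(1) by auto
      then show "e1 \<in> C" "e2 \<in> C" "en e1 = {c b, c i}" "en e2 = {c b, c i}"
        using edge[of e1] edge[of e2] False by blast+
    qed
    have ne: "c b \<noteq> c i" using e(1,3) False by auto
    have "ipath (c b) (c i) {c b, c i} {e1}" using ipath_single[of e1 "c b" "c i"] e CE ne by blast
    then have "insert e2 {e1} \<in> cycles" using path_edge_cycle(1)[of "c b" "c i" _ "{e1}" e2] e e12(2) CE ne by blast
    then have "{e1, e2} = C" using cycle_antichain[OF _ C, of "{e1, e2}"] e by (simp add: insert_commute)
    then show ?thesis using e12 by simp
  qed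
  then have "C \<subseteq> inside {c i, c (Suc i)}" using edge CE bi by (fastforce simp: inside_def)
  then show ?thesis using that by blast
qed

lemma cyclic_cut:
  assumes c: "cyclic c n" and k: "2 \<le> k" "k + 2 \<le> n"
  shows "cut (c i) (c (i + k)) (c ` {Suc i..<i + k}) (c ` {Suc (i + k)..<i + n})" "\<not> adj (c i) (c (i + k))"
proof -
  have inj: "c x \<noteq> c y" if "x \<in> {i..<i + n}" "y \<in> {i..<i + n}" "x \<noteq> y" for x y
    using inj_onD[OF cyclicD(5)[OF c, of i]] that by blast
  show "\<not> adj (c i) (c (i + k))" using cyclicD(8)[OF c, of i "i + k"] k by auto
  show "cut (c i) (c (i + k)) (c ` {Suc i..<i + k}) (c ` {Suc (i + k)..<i + n})"
    unfolding cut_def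
  proof (intro conjI)
    show "c i \<noteq> c (i + k)" using inj k by simp
    show "c i \<in> V" "c (i + k) \<in> V" using cyclicD(3)[OF c] by auto
    show "c ` {Suc i..<i + k} \<noteq> {}" "c ` {Suc (i + k)..<i + n} \<noteq> {}" using k by auto
    have "{i..<i + n} - {i, i + k} = {Suc i..<i + k} \<union> {Suc (i + k)..<i + n}" using k by auto
    then have "c ` {Suc i..<i + k} \<union> c ` {Suc (i + k)..<i + n} = c ` ({i..<i + n} - {i, i + k})"
      by (simp add: image_Un)
    also have "\<dots> = c ` {i..<i + n} - c ` {i, i + k}"
      by (rule inj_on_image_set_diff[OF cyclicD(5)[OF c, of i]]) (use k in auto)
    also have "\<dots> = V - {c i, c (i + k)}" using cyclicD(6)[OF c, of i] by simp
    finally show "c ` {Suc i..<i + k} \<union> c ` {Suc (i + k)..<i + n} = V - {c i, c (i + k)}" .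
    show dis: "c ` {Suc i..<i + k} \<inter> c ` {Suc (i + k)..<i + n} = {}"
      using inj by fastforce
    show "nadj (c ` {Suc i..<i + k}) (c ` {Suc (i + k)..<i + n})"
    proof (rule nadjI[OF dis])
      fix a d assume "a \<in> c ` {Suc i..<i + k}" "d \<in> c ` {Suc (i + k)..<i + n}"
      then obtain x y where "x \<in> {Suc i..<i + k}" "y \<in> {Suc (i + k)..<i + n}" "a = c x" "d = c y" by blast
      then show "\<not> adj a d" using cyclicD(8)[OF c, of x y] by auto
    qed
  qed
qed

end

section \<open>Sides without good vertices, and degeneracy\<close>

context unbreakable_qbgraph
begin

text \<open>Any path from \<open>u\<close> to \<open>v\<close> inside the side will do. If it missed
  a vertex, it would be a core showing that vertex to be good; a chord would do the same for a
  vertex that it skips.\<close>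

lemma bad_side_path:
  assumes ct: "cut u v A D" and bad: "\<And>a. a \<in> A \<Longrightarrow> \<not> conn (A \<union> {u, v} - {a})"
  obtains p m where "p 0 = u" "p m = v" "inj_on p {..m}" "p ` {..m} = A \<union> {u, v}" "2 \<le> m"
    "\<And>i. i < m \<Longrightarrow> adj (p i) (p (Suc i))"
    "\<And>i j. i < j \<Longrightarrow> j \<le> m \<Longrightarrow> adj (p i) (p j) \<Longrightarrow> j = Suc i"
proof -
  note d = cutD[OF ct]
  have "con (inside (A \<union> {u, v})) u v" using connD(3)[OF cut_conn2[OF ct]] by blast
  then obtain S P where P: "ipath u v S P" "P \<subseteq> inside (A \<union> {u, v})" using con_ipath inside_sub(1) d(2) by metis
  obtain vs es where l: "distinct vs" "length vs = length es + 1" "hd vs = u" "last vs = v" "set vs = S" "set es = P"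
    "\<forall>i<length es. en (es ! i) = {vs ! i, vs ! Suc i}" using lists_of_ipath[OF P(1)] by blast
  define p where "p = (!) vs"
  define m where "m = length es"
  have ne: "vs \<noteq> []" using l(2) by auto
  have p0: "p 0 = u" "p m = v" using l(2,3,4) ne by (auto simp: p_def m_def hd_conv_nth last_conv_nth)
  have inj: "inj_on p {..m}" using l(1,2) by (auto simp: p_def m_def inj_on_def nth_eq_iff_index_eq)
  have imS: "p ` {..m} = S"
    unfolding l(5)[symmetric] p_def m_def set_conv_nth using l(2) by (auto simp: less_Suc_eq_le image_iff Bex_def)
  have adjp: "adj (p i) (p (Suc i))" if "i < m" for i
  proof -
    have "es ! i \<in> P" using that l(6) by (auto simp: m_def)
    then show ?thesis using l(7) that ipath_basic(4)[OF P(1)] unfolding adj_def p_def m_def by blast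
  qed
  have SA: "S \<subseteq> A \<union> {u, v}" using ipath_span[OF P(1) d(1)] P(2) by (auto simp: span_verts_def inside_def)
  have pV: "p i \<in> V" if "i \<le> m" for i using imS that ipath_basic(3)[OF P(1)] by blast
  have seq: "conn (p ` {i..j})" if "i \<le> j" "j \<le> m" for i j
    by (rule conn_sequence[OF that(1)]) (use that pV adjp in auto)
  have all: "S = A \<union> {u, v}"
  proof (rule ccontr)
    assume "S \<noteq> A \<union> {u, v}"
    moreover have uvS: "u \<in> S" "v \<in> S" using ipath_basic(1,2)[OF P(1)] by auto
    ultimately obtain a where a: "a \<in> A" "a \<notin> S" using SA by blast
    have "conn S" using seq[of 0 m] imS by (simp add: atLeast0AtMost)
    then show False using side_minus_conn[OF ct a(1), of S] bad[OF a(1)] uvS SA a by blast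
  qed
  have chord: "j = Suc i" if ij: "i < j" "j \<le> m" "adj (p i) (p j)" for i j
  proof (rule ccontr)
    assume n: "j \<noteq> Suc i"
    let ?a = "p (Suc i)"
    \<comment> \<open>The two end segments, joined by the chord, still connect \<open>u\<close> to
      \<open>v\<close> and avoid \<open>?a\<close>.\<close>
    let ?H = "p ` {0..i} \<union> p ` {j..m}"
    have inj': "p x \<noteq> p y" if "x \<le> m" "y \<le> m" "x \<noteq> y" for x y using inj_onD[OF inj, of x y] that by auto
    have aA: "?a \<in> A"
    proof -
      have "?a \<in> A \<union> {u, v}" using imS all ij by auto
      moreover have "?a \<noteq> u" "?a \<noteq> v" using inj'[of "Suc i" 0] inj'[of "Suc i" m] p0 ij n by auto
      ultimately show ?thesis by blast
    qed
    have "conn ?H" using conn_adj[OF seq[of 0 i] seq[of j m] _ _ ij(3)] ij by auto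
    moreover have "{u, v} \<subseteq> ?H" using p0 ij by force
    moreover have "?H \<subseteq> A \<union> {u, v} - {?a}"
    proof -
      have "?H \<subseteq> p ` {..m}" using ij by auto
      moreover have "?a \<notin> ?H" using inj' ij n by fastforce
      ultimately show ?thesis using imS all by blast
    qed
    ultimately show False using side_minus_conn[OF ct aA] bad[OF aA] by blast
  qed
  have "2 \<le> m"
  proof -
    have "card (p ` {..m}) = Suc m" using card_image[OF inj] by simp
    moreover have "finite A" using d(9) finite_V finite_subset by blast
    then have "card (A \<union> {u, v}) = card A + 2" "0 < card A" using d(1,4,11,12) by (auto simp: card_Un_disjoint card_gt_0_iff)
    ultimately show ?thesis using imS all by simp
  qed
  then show ?thesis using that[of p m] p0 inj imS all adjp chord by blast
qed

text \<open>The path through \<open>A\<close> from \<open>u\<close> to \<open>v\<close> is continued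
  by the path through \<open>D\<close> back to \<open>u\<close>. Index \<open>m\<close> is read off
  \<open>q\<close>, where \<open>q 0 = v = p m\<close>, and index \<open>n\<close> wraps around to
  \<open>p 0 = u\<close>.\<close>

lemma bad_sides_cyclic:
  assumes ct: "cut u v A D" and badA: "\<And>a. a \<in> A \<Longrightarrow> \<not> conn (A \<union> {u, v} - {a})"
    and badD: "\<And>b. b \<in> D \<Longrightarrow> \<not> conn (D \<union> {u, v} - {b})"
  obtains c n where "cyclic c n"
proof -
  note d = cutD[OF ct]
  obtain p m where p: "p 0 = u" "p m = v" "inj_on p {..m}" "p ` {..m} = A \<union> {u, v}" "2 \<le> m"
    "\<And>i. i < m \<Longrightarrow> adj (p i) (p (Suc i))"
    "\<And>i j. i < j \<Longrightarrow> j \<le> m \<Longrightarrow> adj (p i) (p j) \<Longrightarrow> j = Suc i"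
    using bad_side_path[OF ct badA] by blast
  have badD': "\<not> conn (D \<union> {v, u} - {b})" if "b \<in> D" for b
    using badD[OF that] by (simp add: insert_commute)
  obtain q k where q: "q 0 = v" "q k = u" "inj_on q {..k}" "q ` {..k} = D \<union> {v, u}" "2 \<le> k"
    "\<And>i. i < k \<Longrightarrow> adj (q i) (q (Suc i))"
    "\<And>i j. i < j \<Longrightarrow> j \<le> k \<Longrightarrow> adj (q i) (q j) \<Longrightarrow> j = Suc i"
    using bad_side_path[OF cut_flip[OF cut_swap[OF ct]] badD'] by blast
  define n where "n = m + k"
  define c where "c i = (if i mod n < m then p (i mod n) else q (i mod n - m))" for i
  have n: "4 \<le> n" "m < n" using p(5) q(5) by (auto simp: n_def)
  have cp: "c r = p r" if "r < m" for r using that n by (simp add: c_def)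
  have cq: "c (m + s) = q s" if "s < k" for s using that by (simp add: c_def n_def)
  have cm: "c m = p m" using cq[of 0] q(1,5) p(2) by simp
  have cn: "c n = u" using cp[of 0] p(1,5) by (simp add: c_def)
  have pm: "p r \<in> A \<union> {u}" if "r < m" for r
  proof -
    have "p r \<noteq> p m" using inj_onD[OF p(3), of r m] that by auto
    moreover have "p r \<in> p ` {..m}" using that by auto
    ultimately show ?thesis using p(2,4) by blast
  qed
  have qk: "q s \<in> D \<union> {v}" if "s < k" for s
  proof -
    have "q s \<noteq> q k" using inj_onD[OF q(3), of s k] that by auto
    moreover have "q s \<in> q ` {..k}" using that by auto
    ultimately show ?thesis using q(2,4) by blast
  qed
  have split: "r < m \<or> (\<exists>s<k. r = m + s)" if "r < n" for r
    using that by (metis add_less_cancel_left le_Suc_ex n_def not_less)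
  have split2: "y < m \<or> (\<exists>s<k. x < m \<and> y = m + s) \<or> (\<exists>s t. x = m + s \<and> y = m + t \<and> t < k \<and> s < t)"
    if xy: "x < y" "y < n" for x y
  proof (cases "y < m")
    case False
    then have y: "y = m + (y - m)" "y - m < k" using xy(2) by (auto simp: n_def)
    show ?thesis
    proof (cases "x < m")
      case True then show ?thesis using y by blast
    next
      case False
      then have "x = m + (x - m)" "x - m < y - m" using xy(1) by auto
      then show ?thesis using y by blast
    qed
  qed simp
  have pq: "p r \<noteq> q s" if "r < m" "s < k" for r s
    using pm[OF that(1)] qk[OF that(2)] d(1,7,11-14) by auto
  have "cyclic c n"
    unfolding cyclic_def
  proof (intro conjI allI impI)
    show "3 \<le> n" using n by simp
    show "c i = c (i mod n)" for i by (simp add: c_def)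
    have inj: "c x \<noteq> c y" if "x < y" "y < n" for x y
    proof -
      consider "y < m" | s where "x < m" "s < k" "y = m + s" | s t where "x = m + s" "y = m + t" "t < k" "s < t"
        using split2[of x y] \<open>x < y\<close> \<open>y < n\<close> by blast
      then show ?thesis
      proof cases
        case 1 then show ?thesis using cp that inj_onD[OF p(3), of x y] by auto
      next
        case 2 then show ?thesis using cp cq pq by simp
      next
        case 3 then show ?thesis using cq inj_onD[OF q(3), of s t] by auto
      qed
    qed
    show "inj_on c {..<n}"
    proof (rule inj_onI)
      fix x y assume "x \<in> {..<n}" "y \<in> {..<n}" "c x = c y"
      then show "x = y" using inj[of x y] inj[of y x] by (cases x y rule: linorder_cases) auto
    qed
    show "c ` {..<n} = V"
    proof
      have "c r \<in> V" if "r < n" for r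
        using split[OF that]
      proof
        assume r: "r < m"
        then show ?thesis using cp[OF r] pm[OF r] d(2,9) by auto
      next
        assume "\<exists>s<k. r = m + s"
        then obtain s where "s < k" "r = m + s" by blast
        then show ?thesis using cq[of s] qk[of s] d(3,10) by auto
      qed
      then show "c ` {..<n} \<subseteq> V" by blast
      show "V \<subseteq> c ` {..<n}"
      proof
        fix x assume "x \<in> V"
        then have "x \<in> p ` {..m} \<or> x \<in> q ` {..k}" using p(4) q(4) d(6) by blast
        then obtain i where "x = p i \<and> i \<le> m \<or> x = q i \<and> i \<le> k" by blast
        then consider "x = p i" "i < m" | "x = v" | "x = q i" "i < k" | "x = u" using p(2) q(2) by fastforce
        then show "x \<in> c ` {..<n}"
        proof cases
          case 1 then show ?thesis using cp[of i] n by (intro image_eqI[of _ _ i]) auto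
        next
          case 2 then show ?thesis using cm p(2) n by (intro image_eqI[of _ _ m]) auto
        next
          case 3 then show ?thesis using cq[of i] by (intro image_eqI[of _ _ "m + i"]) (auto simp: n_def)
        next
          case 4 then show ?thesis using cp[of 0] p(1,5) n by (intro image_eqI[of _ _ 0]) auto
        qed
      qed
    qed
    have adj: "adj (c r) (c (Suc r))" if "r < n" for r
      using split[OF that]
    proof
      assume r: "r < m"
      then have "c (Suc r) = p (Suc r)" using cp cm by (metis Suc_lessI)
      then show ?thesis using cp[OF r] p(6)[OF r] by simp
    next
      assume "\<exists>s<k. r = m + s"
      then obtain s where s: "s < k" "r = m + s" by blast
      have "c (Suc r) = q (Suc s)"
      proof (cases "Suc s = k")
        case True
        then have "Suc r = n" using s by (simp add: n_def)
        then show ?thesis using True cn q(2) by simp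
      next
        case False
        then show ?thesis using cq[of "Suc s"] s by simp
      qed
      then show ?thesis using cq[OF s(1)] q(6)[OF s(1)] s(2) by simp
    qed
    show "adj (c i) (c (Suc i))" for i
    proof -
      have "c i = c (i mod n)" "c (Suc i) = c (Suc (i mod n))" by (simp_all add: c_def mod_Suc_eq)
      then show ?thesis using adj[of "i mod n"] n by simp
    qed
    fix x y assume xy: "x < y" "y < n" "adj (c x) (c y)"
    consider "y < m" | s where "x < m" "s < k" "y = m + s" | s t where "x = m + s" "y = m + t" "t < k" "s < t"
      using split2[OF xy(1,2)] by blast
    then show "y = Suc x \<or> x = 0 \<and> Suc y = n"
    proof cases
      case 1 then show ?thesis using cp xy p(7)[of x y] by simp
    next
      case 3 then show ?thesis using cq xy(3) q(7)[of s t] by simp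
    next
      \<comment> \<open>No edge joins \<open>A\<close> to \<open>D\<close>, so an edge between the
        two paths has \<open>u\<close> or \<open>v\<close> as an end. It is then an edge within one
        path and joins consecutive vertices.\<close>
      case (2 s)
      have a: "adj (p x) (q s)" using xy(3) cp cq 2 by simp
      show ?thesis
      proof (cases "s = 0")
        case True
        then have "adj (p x) (p m)" using a q(1) p(2) by simp
        then show ?thesis using p(7)[of x m] 2 True by simp
      next
        case False
        then have "q s \<noteq> v" using inj_onD[OF q(3), of s 0] 2(2) q(1) by auto
        then have "q s \<in> D" using qk[OF 2(2)] by blast
        then have "p x = u" using pm[OF 2(1)] nadjD[OF d(8)] a by blast
        then have "x = 0" using inj_onD[OF p(3), of x 0] 2(1) p(1) by auto
        moreover have "adj (q s) (q k)" using adj_sym[OF a] \<open>p x = u\<close> q(2) by simp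
        then have "k = Suc s" using q(7)[of s k] 2(2) by simp
        ultimately show ?thesis using 2(3) by (simp add: n_def)
      qed
    qed
  qed
  then show ?thesis by (rule that)
qed

text \<open>Good vertices on both sides would leave at most 2 + 2 + 2 vertices in all. So at most
  one side has any, and \<open>good_bad_false\<close> excludes that.\<close>

lemma cut_cyclic:
  assumes ct: "cut u v A D" and V: "7 \<le> card V"
  obtains c n where "cyclic c n"
proof (rule bad_sides_cyclic[OF ct])
  have cV: "card V = card A + card D + 2" using cut_card[OF ct] .
  show "\<not> conn (A \<union> {u, v} - {a})" if a: "a \<in> A" for a
  proof
    assume g: "conn (A \<union> {u, v} - {a})"
    then have "card D \<le> 2" using good_card[OF cut_swap[OF ct] a] by blast
    moreover have "card A \<le> 2" if "b \<in> D" "conn (D \<union> {u, v} - {b})" for b using good_card[OF ct that] .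
    ultimately have "\<And>b. b \<in> D \<Longrightarrow> \<not> conn (D \<union> {u, v} - {b})" using cV V by fastforce
    then show False using good_bad_false[OF ct _ a g V] by blast
  qed
  show "\<not> conn (D \<union> {u, v} - {b})" if b: "b \<in> D" for b
  proof
    assume g: "conn (D \<union> {u, v} - {b})"
    then have "card A \<le> 2" using good_card[OF ct b] by blast
    moreover have "card D \<le> 2" if "a \<in> A" "conn (A \<union> {u, v} - {a})" for a using good_card[OF cut_swap[OF ct] that] .
    ultimately have "\<And>a. a \<in> A \<Longrightarrow> \<not> conn (A \<union> {u, v} - {a})" using cV V by fastforce
    then show False using good_bad_false[OF cut_swap[OF ct] _ b g V] by blast
  qed
qed (rule that)

text \<open>The edges inside \<open>A \<union> D\<close> have at most the four components
  \<open>A\<close>, \<open>D\<close>, \<open>{x}\<close>, \<open>{y}\<close>, at least two of them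
  unbalanced, so their rank reaches \<open>card V - 4 + 2\<close>, the number of vertices of
  \<open>A \<union> D\<close>. The complement \<open>{x, y}\<close> is split, as \<open>x\<close>
  and \<open>y\<close> are nonadjacent.\<close>

lemma cut_F_cycles_false:
  assumes ct: "cut x y A D" and n: "\<not> adj x y"
    and C: "C \<in> F" "C \<subseteq> inside A" and C': "C' \<in> F" "C' \<subseteq> inside D"
  shows False
proof -
  note d = cutD[OF ct]
  let ?X = "inside (A \<union> D)"
  have X: "?X = inside A \<union> inside D"
    using d(8) ends_nonempty unfolding inside_def nadj_def by fastforce
  have Cc: "C \<in> cycles" "C \<notin> B" "C' \<in> cycles" "C' \<notin> B" using classes C C' by blast+
  have AD: "conn A" "conn D" using cut_conn[OF ct] .
  have closed: "w \<in> S" if "con ?X v w" "v \<in> S" "S = A \<or> S = D" for v w S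
    using that(1,2) by (rule con_closed) (use that(3) d(8) in \<open>auto simp: X inside_def nadj_def\<close>)
  have compS: "comp ?X v = S" if "v \<in> S" "S = A \<or> S = D" for v S
  proof -
    have "con ?X v w" if "w \<in> S" for w
      using connD(3)[of S v w] AD \<open>S = A \<or> S = D\<close> \<open>v \<in> S\<close> that con_mono[of "inside S" v w ?X] X by blast
    moreover have "S \<subseteq> V" using that(2) d(9,10) by blast
    ultimately show ?thesis using closed that unfolding comp_def by blast
  qed
  have "comp ?X v \<in> {A, D, {x}, {y}}" if "v \<in> V" for v
  proof -
    have "v \<in> V - {x, y} \<or> v = x \<or> v = y" using that by blast
    then consider "v \<in> A" | "v \<in> D" | "v = x" | "v = y" unfolding d(6)[symmetric] by blast
    then show ?thesis
    proof cases
      case 3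
      then have "v \<notin> sp ?X" using inside_sub(2)[of "A \<union> D"] d(11,13) by blast
      then have "comp ?X v = {v}" using con_eq_or_span[of ?X v] that unfolding comp_def by auto
      then show ?thesis using 3 by simp
    next
      case 4
      then have "v \<notin> sp ?X" using inside_sub(2)[of "A \<union> D"] d(12,14) by blast
      then have "comp ?X v = {v}" using con_eq_or_span[of ?X v] that unfolding comp_def by auto
      then show ?thesis using 4 by simp
    qed (use compS in auto)
  qed
  then have "comps ?X \<subseteq> {A, D, {x}, {y}}" unfolding comps_def by blast
  then have "card (comps ?X) \<le> card {A, D, {x}, {y}}" by (intro card_mono) auto
  also have "\<dots> \<le> 4" by (simp add: card_insert_if)
  finally have cc: "card (comps ?X) \<le> 4" .
  have unb: "S \<in> unbs ?X" if S: "S = A \<or> S = D" and K: "K \<in> cycles" "K \<notin> B" "K \<subseteq> inside S" for S K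
  proof -
    obtain w where w: "w \<in> sp K" using cycleD(6)[OF K(1)] by blast
    then have wS: "w \<in> S" "w \<in> V" using sp_mono[OF K(3)] inside_sub(2)[of S] cycleD(7)[OF K(1)] by blast+
    have "K \<subseteq> ?X" using K(3) S X by blast
    moreover have "\<exists>z\<in>sp K. con ?X w z" using w by (intro bexI[of _ w]) simp_all
    ultimately have "unb_at ?X w" unfolding unb_at_def using K(1,2) by blast
    then show ?thesis using comp_in_unbs_iff[of w ?X] compS[of w S] S wS by simp
  qed
  \<comment> \<open>An \<open>L\<close>-cycle would lie within one side and be disjoint from the
    \<open>F\<close>-cycle in the other. In its absence both unbalanced components count.\<close>
  have "\<not> hasL ?X"
  proof
    assume "hasL ?X"
    then obtain K where K: "K \<in> L" "K \<subseteq> ?X" unfolding hasL_def by blast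
    then have Kc: "K \<in> cycles" using classes by blast
    obtain w where w: "w \<in> sp K" using cycleD(6)[OF Kc] by blast
    have "w \<in> A \<or> w \<in> D" using w sp_mono[OF K(2)] inside_sub(2)[of "A \<union> D"] by blast
    then obtain S where S: "S = A \<or> S = D" "w \<in> S" by blast
    have KS: "sp K \<subseteq> S"
    proof
      fix z assume "z \<in> sp K"
      then have "con K w z" using cycleD(3)[OF Kc w] by blast
      then show "z \<in> S" using closed[OF con_mono[OF _ K(2)] S(2,1)] by blast
    qed
    have "sp C \<subseteq> A" "sp C' \<subseteq> D"
      using subset_trans[OF sp_mono[OF C(2)] inside_sub(2)] subset_trans[OF sp_mono[OF C'(2)] inside_sub(2)] .
    then show False using KS S(1) LF_meet[OF K(1) C(1)] LF_meet[OF K(1) C'(1)] d(7) by blast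
  qed
  moreover have "2 \<le> card (unbs ?X)"
  proof -
    have "{A, D} \<subseteq> unbs ?X" using unb[of A C] unb[of D C'] Cc C C' by blast
    moreover have "A \<noteq> D" using d(4,7) by blast
    ultimately show ?thesis using card_mono[OF finite_unbs, of "{A, D}" ?X] by simp
  qed
  moreover have cV: "card V = card A + card D + 2" using cut_card[OF ct] .
  moreover have "finite A" "finite D" using d(9,10) finite_V finite_subset by blast+
  then have "card (A \<union> D) = card A + card D" using d(7) by (simp add: card_Un_disjoint)
  ultimately have "card (A \<union> D) \<le> rho ?X" unfolding rho_def using cc by simp
  moreover have "A \<union> D \<subseteq> V" "V - (A \<union> D) = {x} \<union> {y}" using d(2,3,6,9,10) by auto
  moreover have "nadj {x} {y}" by (rule nadjI) (use d(1) n in auto)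
  ultimately show False using full_no_split[of "A \<union> D" "{x}" "{y}"] d(1) by blast
qed

text \<open>\<open>D\<close> may lie right beside \<open>C\<close>, with no room for a cut between
  them. It shows that \<open>C\<close> misses a vertex and so lives on two consecutive vertices; a
  cycle \<open>K\<close> farther away then takes its place.\<close>

lemma cyclic_degenerate:
  assumes c: "cyclic c n" and n: "7 \<le> n"
  shows "degenerate G F"
proof (rule ccontr)
  assume "\<not> ?thesis"
  then obtain C D where CD: "C \<in> F" "D \<in> F" "sp C \<inter> sp D = {}" unfolding degenerate_def vertex_disjoint_def by blast
  have Fc: "K \<in> cycles" if "K \<in> F" for K using classes that by blast
  obtain r where r: "c r \<in> sp D"
  proof -
    obtain x where x: "x \<in> sp D" "x \<in> V" using cycleD(6,7)[OF Fc[OF CD(2)]] by blast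
    then have "x \<in> c ` {0..<0 + n}" using cyclicD(6)[OF c, of 0] by simp
    then show ?thesis using that x by blast
  qed
  then have "c r \<notin> sp C" using CD(3) by blast
  then obtain i where Ci: "C \<subseteq> inside {c i, c (Suc i)}" using cyclic_short_cycle[OF c Fc[OF CD(1)]] by blast
  \<comment> \<open>The single vertex \<open>c (Suc j)\<close> is a side of a cut, so together with
    at least one of its two neighbours it is unbalanced.\<close>
  have hot: "\<not> balv {c j, c (Suc j)} \<or> \<not> balv {c (Suc j), c (Suc (Suc j))}" for j
  proof -
    have "cut (c j) (c (j + 2)) (c ` {Suc j..<j + 2}) (c ` {Suc (j + 2)..<j + n})"
      using cyclic_cut(1)[OF c, of 2 j] n by simp
    moreover have "{Suc j..<j + 2} = {Suc j}" by auto
    ultimately have "cut (c j) (c (j + 2)) {c (Suc j)} (c ` {Suc (j + 2)..<j + n})" by simp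
    then show ?thesis using cut_not_both_balv by (fastforce simp: insert_commute)
  qed
  \<comment> \<open>Starting at \<open>i + 3\<close> keeps \<open>c (i + 2)\<close> free as a cut
    vertex. The indices go up to \<open>i + 5\<close> at most, which is below
    \<open>i + n - 1\<close> because \<open>n \<ge> 7\<close>.\<close>
  obtain j where j: "j = i + 3 \<or> j = i + 4" "\<not> balv {c j, c (Suc j)}"
    using hot[of "i + 3"] by (auto simp: numeral_eq_Suc)
  then obtain K where K: "K \<in> cycles" "K \<subseteq> inside {c j, c (Suc j)}" "K \<notin> B" unfolding bal_def by blast
  have ne: "c x \<noteq> c y" if "x \<in> {i..<i + n}" "y \<in> {i..<i + n}" "x \<noteq> y" for x y
    using inj_onD[OF cyclicD(5)[OF c, of i]] that by blast
  have "sp K \<subseteq> {c j, c (Suc j)}" "sp C \<subseteq> {c i, c (Suc i)}"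
    using sp_mono[OF K(2)] sp_mono[OF Ci] inside_sub(2) by blast+
  moreover have "{c j, c (Suc j)} \<inter> {c i, c (Suc i)} = {}"
    using ne[of j i] ne[of j "Suc i"] ne[of "Suc j" i] ne[of "Suc j" "Suc i"] j(1) n by auto
  ultimately have "K \<notin> L" using LF_meet[OF _ CD(1)] by blast
  then have KF: "K \<in> F" using K classes by blast
  \<comment> \<open>The predecessor of \<open>i\<close>, shifted by one period. The cut consists of
    the two vertices that flank the pair carrying \<open>C\<close>.\<close>
  let ?I = "i + n - 1"
  have ct: "cut (c ?I) (c (?I + 3)) (c ` {Suc ?I..<?I + 3}) (c ` {Suc (?I + 3)..<?I + n})" "\<not> adj (c ?I) (c (?I + 3))"
    using cyclic_cut[OF c, of 3 ?I] n by auto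
  have per: "c (k + n) = c k" for k using cyclicD(2)[OF c] .
  have "C \<subseteq> inside (c ` {Suc ?I..<?I + 3})"
  proof -
    have "c i \<in> c ` {Suc ?I..<?I + 3}" using per[of i] n by (intro image_eqI[of _ _ "i + n"]) auto
    moreover have "c (Suc i) \<in> c ` {Suc ?I..<?I + 3}" using per[of "Suc i"] n by (intro image_eqI[of _ _ "Suc i + n"]) auto
    ultimately show ?thesis using Ci inside_mono[of "{c i, c (Suc i)}"] by blast
  qed
  moreover have "K \<subseteq> inside (c ` {Suc (?I + 3)..<?I + n})"
  proof -
    have "c j \<in> c ` {Suc (?I + 3)..<?I + n}" using per[of j] n j(1) by (intro image_eqI[of _ _ "j + n"]) auto
    moreover have "c (Suc j) \<in> c ` {Suc (?I + 3)..<?I + n}" using per[of "Suc j"] n j(1) by (intro image_eqI[of _ _ "Suc j + n"]) auto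
    ultimately show ?thesis using K(2) inside_mono[of "{c j, c (Suc j)}"] by blast
  qed
  ultimately show False using cut_F_cycles_false[OF ct CD(1) _ KF] by blast
qed

end

section \<open>The balanced case\<close>

context mgraph
begin

text \<open>\<open>graphic\<close> asks for natural numbers as vertices, so the finite vertex set is
  renamed by an injection; as edge sets, the cycles do not change.\<close>

lemma cycle_matroid_graphic: "graphic (cycle_matroid G)"
proof -
  obtain f :: "'v \<Rightarrow> nat" where f: "inj_on f V" using finite_imp_inj_to_nat_seg[OF finite_V] by blast
  define H :: "(nat, 'e) multigraph" where "H = \<lparr>vertices = f ` V, edges = E, ends = (\<lambda>e. f ` en e)\<rparr>"
  have H: "vertices H = f ` V" "edges H = E" "ends H = (\<lambda>e. f ` en e)" by (simp_all add: H_def)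
  have inj: "inj_on f (en e)" if "e \<in> E" for e using f ends_subset[OF that] inj_on_subset by blast
  have fin: "finite_multigraph H"
    unfolding finite_multigraph_def H using finite_V finite_E finite_graph ends_subset
    by (auto simp: card_image[OF inj] finite_multigraph_def)
  have mem: "f v \<in> f ` en e \<longleftrightarrow> v \<in> en e" if "e \<in> E" "v \<in> V" for e v
    using f ends_subset[OF that(1)] that(2) by (auto simp: inj_on_def)
  have single: "f ` en e = {f v} \<longleftrightarrow> en e = {v}" if "e \<in> E" "v \<in> V" for e v
    using inj_on_image_eq_iff[OF f ends_subset[OF that(1)], of "{v}"] that(2) by simp
  have pair: "f ` en e = {f u, f v} \<longleftrightarrow> en e = {u, v}" if "e \<in> E" "u \<in> V" "v \<in> V" for e u v
    using inj_on_image_eq_iff[OF f ends_subset[OF that(1)], of "{u, v}"] that(2,3) by simp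
  have "C \<in> graph_cycles H \<longleftrightarrow> C \<in> cycles" if CE: "C \<subseteq> E" for C
  proof -
    have span: "span_verts H C = f ` sp C" by (auto simp: span_verts_def H)
    have deg: "vdegree (edge_subgraph H C) (f v) = vdegree (edge_subgraph G C) v" if "v \<in> V" for v
    proof -
      have "{e \<in> C. f v \<in> f ` en e} = {e \<in> C. v \<in> en e}" "{e \<in> C. f ` en e = {f v}} = {e \<in> C. en e = {v}}"
        using mem single that CE by blast+
      then show ?thesis by (simp add: vdegree_def edge_subgraph_def H)
    qed
    have reach: "(f u, f v) \<in> (adjacency (edge_subgraph H C))\<^sup>* \<longleftrightarrow> con C u v" if uv: "u \<in> V" "v \<in> V" for u v
    proof
      assume "con C u v"
      then show "(f u, f v) \<in> (adjacency (edge_subgraph H C))\<^sup>*"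
      proof (induction rule: con_induct)
        case (step y z e)
        then have "(f y, f z) \<in> adjacency (edge_subgraph H C)" by (auto simp: adjacency_def edge_subgraph_def H)
        with step.IH show ?case by simp
      qed simp
    next
      assume "(f u, f v) \<in> (adjacency (edge_subgraph H C))\<^sup>*"
      then have "\<exists>w\<in>V. f v = f w \<and> con C u w"
      proof (induction rule: rtrancl_induct)
        case base then show ?case using uv by auto
      next
        case (step y z)
        then obtain w where w: "w \<in> V" "y = f w" "con C u w" by blast
        obtain e where e: "e \<in> C" "f ` en e = {y, z}" using step.hyps(2) by (auto simp: adjacency_def edge_subgraph_def H)
        then obtain x where x: "x \<in> en e" "z = f x" by blast
        have eE: "e \<in> E" using e CE by blast
        then have "x \<in> V" using x ends_subset by blast
        moreover have "w \<in> en e" using mem[OF eE w(1)] e w(2) by auto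
        then have "con C w x" using con_ends[OF e(1) CE] x by blast
        ultimately show ?case using x w con_trans by blast
      qed
      then show "con C u v" using f uv by (auto simp: inj_on_def)
    qed
    have sV: "sp C \<subseteq> V" using sp_V[OF CE] .
    have "graph_connected (edge_subgraph H C) \<longleftrightarrow> graph_connected (edge_subgraph G C)"
      unfolding graph_connected_def using reach sV
      by (simp add: con_iff_adjacency[symmetric] span edge_subgraph_def[of H] edge_subgraph_def[of G, symmetric] subset_iff)
        (auto simp: edge_subgraph_def)
    moreover have "(\<forall>v\<in>span_verts H C. vdegree (edge_subgraph H C) v = 2) \<longleftrightarrow>
        (\<forall>v\<in>sp C. vdegree (edge_subgraph G C) v = 2)"
      unfolding span using deg sV by (simp add: subset_iff)
    ultimately show ?thesis unfolding graph_cycles_def using CE by (simp add: H)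
  qed
  moreover have "C \<subseteq> E" if "C \<in> graph_cycles H \<or> C \<in> cycles" for C using that by (auto simp: graph_cycles_def H)
  ultimately have "graph_cycles H = cycles" by blast
  then have "cycle_matroid G = cycle_matroid H" by (simp add: cycle_matroid_def H)
  then show ?thesis using fin unfolding graphic_def by blast
qed

end

text \<open>With all cycles in \<open>B\<close>, every theta contains a member of \<open>B\<close>,
  and handcuffs and \<open>L\<close>-pairs need cycles outside \<open>B\<close>; only the cycles
  remain as circuits.\<close>

lemma (in qbgraph) balanced_graphic:
  assumes "bal E" shows "graphic M"
proof -
  have B: "B = cycles" using assms classes(1) cycleD(1) unfolding bal_def by blast
  then have LF: "L = {}" "F = {}" using classes by blast+
  have "\<not> (is_theta G T \<and> (\<forall>C\<in>B. \<not> C \<subseteq> T))" for T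
    using theta3_cycle(1) B unfolding is_theta_iff by blast
  then have "quasi_graphic_circuits G B L F = cycles"
    unfolding quasi_graphic_circuits_def LF using B by (auto simp: tight_handcuffs_of_def)
  then have "M = cycle_matroid G" by (simp add: quasi_graphic_matroid_def cycle_matroid_def)
  then show ?thesis using cycle_matroid_graphic by simp
qed

theorem theorem4p6:
  fixes G :: "('v, 'e) multigraph"
    and \<B> \<L> \<F> :: "'e set set"
    and M :: "'e pre_matroid"
  assumes "quasi_biased_graph G \<B> \<L> \<F>"
    and "\<forall>K\<in>component_vertex_sets G. 2 \<le> card K"
    and "M = quasi_graphic_matroid G \<B> \<L> \<F>"
    and "n_connected_matroid 3 M"
    and "unbreakable M"
    and "\<not> graphic M"
    and "k_connected_graph 2 G"
    and "\<not> k_connected_graph 3 G"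
  shows "card (vertices G) \<le> 6 \<or> (is_cycle_graph (si G) \<and> degenerate G \<F>)"
proof (cases "card (vertices G) \<le> 6")
  case False
  then have V: "7 \<le> card (vertices G)" by simp
  interpret qbgraph G \<B> \<L> \<F>
    by unfold_locales (use assms(1) in \<open>simp_all add: quasi_biased_graph_def\<close>)
  interpret unbreakable_qbgraph G \<B> \<L> \<F>
    by unfold_locales (use assms(3-7) balanced_graphic in auto)
  obtain S where S: "S \<subseteq> vertices G" "card S < 3" "\<not> graph_connected (delete_vertices G S)"
    using assms(8) V by (auto simp: k_connected_graph_def)
  then have n: "\<not> conn (vertices G - S)" using graph_connected_delete_iff by blast
  \<comment> \<open>Deleting fewer than two vertices leaves \<open>G\<close> connected, so the
    failure of 3-connectivity comes from exactly two.\<close>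
  then have "card S = 2" using conn_delete[OF S(1)] S(2) by fastforce
  then obtain u v where uv: "S = {u, v}" "u \<noteq> v" by (auto simp: card_2_iff)
  have "vertices G - S \<noteq> {}" using S V card_mono[of S "vertices G"] finite_subset[OF S(1) finite_V] by auto
  then obtain x where "x \<in> vertices G - S" by blast
  then obtain P where P: "x \<in> P" "P \<subset> vertices G - S" "nadj P (vertices G - S - P)"
    using not_conn_split[OF _ _ n] by (metis Diff_subset)
  then have "cut u v P (vertices G - S - P)"
    unfolding cut_def using uv S(1) by blast
  then obtain c m where c: "cyclic c m" using cut_cyclic V by metis
  have "is_cycle_graph (si G)" using cyclic_si[OF c conn_V] .
  moreover have "degenerate G \<F>" using cyclic_degenerate[OF c] cyclicD(7)[OF c] V by simp
  ultimately show ?thesis by blast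
qed simp

end
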